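(* Let $\{f_n\}$ be a quasi basis of $\mathfrak{H}$, and let $\mathcal{C}_0$ be the operator associated with the dual definite subspaces generated by $\{f_n\}$. Then there exists an operator of $\mathcal{C}$-symmetry $\mathcal{C}=Je^{Q}\supset\mathcal{C}_0$ such that, with $G=e^Q$, for all elements $g\in\mathfrak{D}[G]$ of the energetic linear manifold $$g=\sum_{n=1}^\infty[g,\mathcal{C}f_n]f_n,\qquad e^{Q/2}g=\sum_{n=1}^\infty[g,\mathcal{C}f_n]e^{Q/2}f_n,$$ where the series converge in the Hilbert spaces $(\mathfrak{H}_G,(\cdot,\cdot)_G)$ and $(\mathfrak{H},(\cdot,\cdot))$, respectively.
   Context: $\mathfrak{H}$ is a complex Hilbert space with inner product $(\cdot,\cdot)$ (linear in the first argument), $J$ is a bounded operator with $J=J^*$, $J^2=I$, $J\neq\pm I$, $[f,g]=(Jf,g)$, and $\mathfrak{H}_\pm=\frac12(I\pm J)\mathfrak{H}$. Subspaces are closed. A subspace is positive (negative) if $[f,f]>0$ ($<0$) for all its nonzero $f$, and maximal positive (negative) if it is not a proper subspace of another positive (negative) subspace. Dual definite subspaces $\mathfrak{L}_\pm$: $\mathfrak{L}_+$ positive, $\mathfrak{L}_-$ negative, $[f_+,f_-]=0$ for all $f_\pm\in\mathfrak{L}_\pm$; dual maximal definite if moreover $\mathfrak{L}_+$ is maximal positive and $\mathfrak{L}_-$ is maximal negative. A sequence $\{f_n\}$ is $J$-orthonormal if $|[f_n,f_m]|=\delta_{nm}$; it is complete if its linear span is dense in $\mathfrak{H}$. The subspaces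 $\mathfrak{L}_+$ and $\mathfrak{L}_-$ generated by a complete $J$-orthonormal $\{f_n\}$ are the closures in $\mathfrak{H}$ of the spans of $\{f_n:[f_n,f_n]=1\}$ and $\{f_n:[f_n,f_n]=-1\}$ respectively; they are dual definite and $\mathfrak{L}_++\mathfrak{L}_-$ is dense in $\mathfrak{H}$. The operator $\mathcal{C}_0$ associated with dual definite $\mathfrak{L}_\pm$ with dense sum has domain $\mathfrak{L}_++\mathfrak{L}_-$ and $\mathcal{C}_0(f_++f_-)=f_+-f_-$, $f_\pm\in\mathfrak{L}_\pm$. It is called an operator of $\mathcal{C}$-symmetry, and denoted $\mathcal{C}$, if the subspaces are dual maximal definite. Equivalently, $\mathcal{C}=Je^Q$ with $Q$ self-adjoint and $JQ=-QJ$. Put $G_0=J\mathcal{C}_0$. For $\mathcal{C}=Je^Q$ put $G=J\mathcal{C}=e^Q$; $(\mathfrak{H}_G,(\cdot,\cdot)_G)$ is the completion of $D(G)=D(\mathcal{C})$ with respect to $(f,g)_G=(Gf,g)$. The energetic linear manifold is $\mathfrak{D}[G]=D(\sqrt{G})=D(e^{Q/2})$, the completion of $D(G)$ in the norm $(\|f\|^2+(Gf,f))^{1/2}$; it is regarded as the common part $\mathfrak{H}\cap\mathfrak{H}_G$ (on it $(f,g)_G=(\sqrt{G}f,\sqrt{G}g)$). Dual definite $\mathfrak{L}_\pm$ with dense sum are quasi maximal if there exists a positive self-adjoint extension $G\supset G_0$ with $JGf=G^{-1}Jf$ for all $f\in D(G)$ (equivalently, $G=J\mathcal{C}$ for an operator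 of $\mathcal{C}$-symmetry $\mathcal{C}\supset\mathcal{C}_0$) such that $D(G_0)=\mathfrak{L}_++\mathfrak{L}_-$ is dense in $(\mathfrak{H}_G,(\cdot,\cdot)_G)$. A complete $J$-orthonormal sequence is a quasi basis of $\mathfrak{H}$ if the subspaces $\mathfrak{L}_\pm$ it generates are quasi maximal. *)

theory Defs
  imports "HOL-Analysis.Analysis"
begin

section \<open>Complex Hilbert spaces\<close>

text \<open>The underlying real inner product is required to be the real part of the complex one, so
  that the norm and the topology of the complex Hilbert space are those of the library. The
  complex inner product is linear in its first argument.\<close>

class complex_hilbert = real_inner + complete_space +
  fixes scaleC :: "complex \<Rightarrow> 'a \<Rightarrow> 'a" (infixr "*\<^sub>C" 75)
    and cinner :: "'a \<Rightarrow> 'a \<Rightarrow> complex"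
  assumes scaleC_add_right: "c *\<^sub>C (x + y) = c *\<^sub>C x + c *\<^sub>C y"
    and scaleC_add_left: "(c + d) *\<^sub>C x = c *\<^sub>C x + d *\<^sub>C x"
    and scaleC_scaleC: "c *\<^sub>C (d *\<^sub>C x) = (c * d) *\<^sub>C x"
    and scaleC_of_real: "complex_of_real r *\<^sub>C x = r *\<^sub>R x"
    and cinner_add_left: "cinner (x + y) z = cinner x z + cinner y z"
    and cinner_scaleC_left: "cinner (c *\<^sub>C x) y = c * cinner x y"
    and cinner_commute: "cinner x y = cnj (cinner y x)"
    and inner_eq_Re_cinner: "inner x y = Re (cinner x y)"

global_interpretation cvec: vector_space "scaleC :: complex \<Rightarrow> 'a \<Rightarrow> 'a::complex_hilbert"
  defines csubspace = cvec.subspace and cspan = cvec.span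
proof
  show "1 *\<^sub>C x = x" for x :: 'a
    using scaleC_of_real[of 1 x] by simp
qed (simp_all add: scaleC_add_right scaleC_add_left scaleC_scaleC)

definition clinear_map :: "('a::complex_hilbert \<Rightarrow> 'a) \<Rightarrow> bool" where
  "clinear_map T \<longleftrightarrow> (\<forall>x y. T (x + y) = T x + T y) \<and> (\<forall>c x. T (c *\<^sub>C x) = c *\<^sub>C T x)"


section \<open>Unbounded operators\<close>

text \<open>An unbounded operator is represented by its graph: its domain is \<^const>\<open>Domain\<close>, its inverse
  is the converse relation, and \<open>A \<subseteq> B\<close> says that \<open>B\<close> extends \<open>A\<close>.\<close>

definition linear_operator :: "'a::complex_hilbert rel \<Rightarrow> bool" where
  "linear_operator A \<longleftrightarrow> single_valued A \<and> (0, 0) \<in> A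
     \<and> (\<forall>f h f' h'. (f, h) \<in> A \<longrightarrow> (f', h') \<in> A \<longrightarrow> (f + f', h + h') \<in> A)
     \<and> (\<forall>c f h. (f, h) \<in> A \<longrightarrow> (c *\<^sub>C f, c *\<^sub>C h) \<in> A)"

definition op_app :: "'a rel \<Rightarrow> 'a \<Rightarrow> 'a" where
  "op_app A f = (THE h. (f, h) \<in> A)"

definition op_adjoint :: "'a::complex_hilbert rel \<Rightarrow> 'a rel" where
  "op_adjoint A = {(u, v). \<forall>(f, h) \<in> A. cinner h u = cinner f v}"

definition self_adjoint :: "'a::complex_hilbert rel \<Rightarrow> bool" where
  "self_adjoint A \<longleftrightarrow> linear_operator A \<and> closure (Domain A) = UNIV \<and> op_adjoint A = A"

definition positive_operator :: "'a::complex_hilbert rel \<Rightarrow> bool" where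
  "positive_operator A \<longleftrightarrow> (\<forall>(f, h) \<in> A. f \<noteq> 0 \<longrightarrow> Re (cinner h f) > 0)"

definition map_op :: "('a \<Rightarrow> 'a) \<Rightarrow> 'a rel \<Rightarrow> 'a rel" where
  "map_op J A = {(f, J h) | f h. (f, h) \<in> A}"

text \<open>\<open>J Q = - Q J\<close>, including the equality of the domains.\<close>

definition anticommutes :: "('a::complex_hilbert \<Rightarrow> 'a) \<Rightarrow> 'a rel \<Rightarrow> bool" where
  "anticommutes J Q \<longleftrightarrow> map_op J Q = {(f, - h) | f h. (J f, h) \<in> Q}"


section \<open>Functions of a self-adjoint operator\<close>

definition orthogonal_projection :: "('a::complex_hilbert \<Rightarrow> 'a) \<Rightarrow> bool" where
  "orthogonal_projection P \<longleftrightarrow> clinear_map P \<and> (\<forall>x. P (P x) = P x)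
     \<and> (\<forall>x y. cinner (P x) y = cinner x (P y))"

definition projection_valued_measure :: "(real set \<Rightarrow> 'a::complex_hilbert \<Rightarrow> 'a) \<Rightarrow> bool" where
  "projection_valued_measure E \<longleftrightarrow> (\<forall>B \<in> sets borel. orthogonal_projection (E B))
     \<and> (\<forall>x. E UNIV x = x)
     \<and> (\<forall>B x. range B \<subseteq> sets borel \<longrightarrow> disjoint_family B \<longrightarrow>
          (\<lambda>i::nat. E (B i) x) sums E (\<Union>i. B i) x)"

definition spectral_measure :: "(real set \<Rightarrow> 'a::complex_hilbert \<Rightarrow> 'a) \<Rightarrow> 'a \<Rightarrow> real measure" where
  "spectral_measure E f = measure_of UNIV (sets borel) (\<lambda>B. ennreal (Re (cinner (E B f) f)))"

text \<open>\<open>T\<close> is the spectral integral of the real Borel function \<open>\<phi>\<close> with respect to \<open>E\<close>. By polarization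
  the quadratic form determines the linear operator \<open>T\<close>.\<close>

definition is_spectral_integral ::
  "(real set \<Rightarrow> 'a::complex_hilbert \<Rightarrow> 'a) \<Rightarrow> (real \<Rightarrow> real) \<Rightarrow> 'a rel \<Rightarrow> bool" where
  "is_spectral_integral E \<phi> T \<longleftrightarrow> linear_operator T
     \<and> Domain T = {f. integrable (spectral_measure E f) (\<lambda>x. (\<phi> x)\<^sup>2)}
     \<and> (\<forall>(f, h) \<in> T. cinner h f = complex_of_real (integral\<^sup>L (spectral_measure E f) \<phi>))"

text \<open>\<open>T = \<phi>(Q)\<close> in the sense of the functional calculus. The spectral measure \<open>E\<close> of a self-adjoint
  operator \<open>Q\<close> is unique, so that \<open>T\<close> is determined by \<open>Q\<close> and \<open>\<phi>\<close>.\<close>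

definition is_function_of :: "'a::complex_hilbert rel \<Rightarrow> (real \<Rightarrow> real) \<Rightarrow> 'a rel \<Rightarrow> bool" where
  "is_function_of Q \<phi> T \<longleftrightarrow> self_adjoint Q \<and> (\<exists>E. projection_valued_measure E
     \<and> is_spectral_integral E (\<lambda>x. x) Q \<and> is_spectral_integral E \<phi> T)"


section \<open>Indefinite inner product and definite subspaces\<close>

definition fundamental_symmetry :: "('a::complex_hilbert \<Rightarrow> 'a) \<Rightarrow> bool" where
  "fundamental_symmetry J \<longleftrightarrow> clinear_map J \<and> bounded_linear J
     \<and> (\<forall>x y. cinner (J x) y = cinner x (J y)) \<and> (\<forall>x. J (J x) = x)
     \<and> J \<noteq> (\<lambda>x. x) \<and> J \<noteq> (\<lambda>x. - x)"

definition indef :: "('a::complex_hilbert \<Rightarrow> 'a) \<Rightarrow> 'a \<Rightarrow> 'a \<Rightarrow> complex" where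
  "indef J f g = cinner (J f) g"

text \<open>Subspaces are closed. The numbers \<open>[f, f]\<close> are real, since \<open>J\<close> is self-adjoint.\<close>

definition positive_subspace :: "('a::complex_hilbert \<Rightarrow> 'a) \<Rightarrow> 'a set \<Rightarrow> bool" where
  "positive_subspace J L \<longleftrightarrow> csubspace L \<and> closed L \<and> (\<forall>f\<in>L. f \<noteq> 0 \<longrightarrow> Re (indef J f f) > 0)"

definition negative_subspace :: "('a::complex_hilbert \<Rightarrow> 'a) \<Rightarrow> 'a set \<Rightarrow> bool" where
  "negative_subspace J L \<longleftrightarrow> csubspace L \<and> closed L \<and> (\<forall>f\<in>L. f \<noteq> 0 \<longrightarrow> Re (indef J f f) < 0)"

definition maximal_positive :: "('a::complex_hilbert \<Rightarrow> 'a) \<Rightarrow> 'a set \<Rightarrow> bool" where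
  "maximal_positive J L \<longleftrightarrow> positive_subspace J L \<and> \<not> (\<exists>M. positive_subspace J M \<and> L \<subset> M)"

definition maximal_negative :: "('a::complex_hilbert \<Rightarrow> 'a) \<Rightarrow> 'a set \<Rightarrow> bool" where
  "maximal_negative J L \<longleftrightarrow> negative_subspace J L \<and> \<not> (\<exists>M. negative_subspace J M \<and> L \<subset> M)"

definition dual_definite :: "('a::complex_hilbert \<Rightarrow> 'a) \<Rightarrow> 'a set \<Rightarrow> 'a set \<Rightarrow> bool" where
  "dual_definite J Lp Lm \<longleftrightarrow> positive_subspace J Lp \<and> negative_subspace J Lm
     \<and> (\<forall>f\<in>Lp. \<forall>g\<in>Lm. indef J f g = 0)"

definition dual_maximal_definite :: "('a::complex_hilbert \<Rightarrow> 'a) \<Rightarrow> 'a set \<Rightarrow> 'a set \<Rightarrow> bool" where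
  "dual_maximal_definite J Lp Lm \<longleftrightarrow>
     dual_definite J Lp Lm \<and> maximal_positive J Lp \<and> maximal_negative J Lm"

text \<open>The operator \<open>C\<^sub>0\<close> associated with a pair of subspaces; its domain is \<open>Lp + Lm\<close>.\<close>

definition C_op :: "'a::complex_hilbert set \<Rightarrow> 'a set \<Rightarrow> 'a rel" where
  "C_op Lp Lm = {(u + v, u - v) | u v. u \<in> Lp \<and> v \<in> Lm}"

definition C_symmetry :: "('a::complex_hilbert \<Rightarrow> 'a) \<Rightarrow> 'a rel \<Rightarrow> bool" where
  "C_symmetry J C \<longleftrightarrow> (\<exists>Lp Lm. dual_maximal_definite J Lp Lm
     \<and> closure (Domain (C_op Lp Lm)) = UNIV \<and> C = C_op Lp Lm)"


section \<open>The energetic space of a positive operator\<close>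

definition energy_norm :: "'a::complex_hilbert rel \<Rightarrow> 'a \<Rightarrow> real" where
  "energy_norm G f = sqrt (Re (cinner (op_app G f) f))"

text \<open>The completion of \<open>D(G)\<close> with respect to \<open>(f, g)\<^sub>G = (G f, g)\<close> is represented by the Cauchy
  sequences in \<open>D(G)\<close>; two of them represent the same element of the completion iff their distance
  is \<open>0\<close>. An element \<open>u\<close> of \<open>D(G)\<close> is represented by the constant sequence.\<close>

definition energy_Cauchy :: "'a::complex_hilbert rel \<Rightarrow> (nat \<Rightarrow> 'a) \<Rightarrow> bool" where
  "energy_Cauchy G X \<longleftrightarrow> (\<forall>n. X n \<in> Domain G)
     \<and> (\<forall>e>0. \<exists>M. \<forall>m\<ge>M. \<forall>n\<ge>M. energy_norm G (X m - X n) < e)"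

definition energy_dist :: "'a::complex_hilbert rel \<Rightarrow> (nat \<Rightarrow> 'a) \<Rightarrow> (nat \<Rightarrow> 'a) \<Rightarrow> real" where
  "energy_dist G X Y = lim (\<lambda>n. energy_norm G (X n - Y n))"

definition energy_dense :: "'a::complex_hilbert rel \<Rightarrow> 'a set \<Rightarrow> bool" where
  "energy_dense G D \<longleftrightarrow> D \<subseteq> Domain G
     \<and> (\<forall>X. energy_Cauchy G X \<longrightarrow> (\<forall>e>0. \<exists>u\<in>D. energy_dist G X (\<lambda>_. u) < e))"

text \<open>A sequence in \<open>D(G)\<close> is Cauchy in the norm \<open>(\<parallel>f\<parallel>\<^sup>2 + (G f, f))\<^sup>1\<^sup>/\<^sup>2\<close> iff it converges in the Hilbert
  space and is energy-Cauchy. As the form of a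
  positive self-adjoint operator is closable, the completion of \<open>D(G)\<close> in this norm
  is the following set of limits. The limit \<open>g\<close> is identified with the element of the completion
  represented by the energy-Cauchy sequence \<open>X\<close>.\<close>

definition energy_represents :: "'a::complex_hilbert rel \<Rightarrow> (nat \<Rightarrow> 'a) \<Rightarrow> 'a \<Rightarrow> bool" where
  "energy_represents G X g \<longleftrightarrow> energy_Cauchy G X \<and> X \<longlonglongrightarrow> g"

definition energetic_manifold :: "'a::complex_hilbert rel \<Rightarrow> 'a set" where
  "energetic_manifold G = {g. \<exists>X. energy_represents G X g}"

definition energy_sums :: "'a::complex_hilbert rel \<Rightarrow> (nat \<Rightarrow> 'a) \<Rightarrow> 'a \<Rightarrow> bool" where
  "energy_sums G s g \<longleftrightarrow> (\<forall>n. s n \<in> Domain G) \<and> (\<exists>X. energy_represents G X g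
     \<and> (\<lambda>N. energy_dist G X (\<lambda>_. \<Sum>n<N. s n)) \<longlonglongrightarrow> 0)"


section \<open>Quasi bases\<close>

text \<open>The condition on \<open>(f, h) \<in> G\<close> says \<open>J G f = G\<^sup>-\<^sup>1 J f\<close>, where \<open>G\<^sup>-\<^sup>1\<close> is the converse of \<open>G\<close>.\<close>

definition quasi_maximal :: "('a::complex_hilbert \<Rightarrow> 'a) \<Rightarrow> 'a set \<Rightarrow> 'a set \<Rightarrow> bool" where
  "quasi_maximal J Lp Lm \<longleftrightarrow> dual_definite J Lp Lm \<and> closure (Domain (C_op Lp Lm)) = UNIV
     \<and> (\<exists>G. self_adjoint G \<and> positive_operator G \<and> map_op J (C_op Lp Lm) \<subseteq> G
          \<and> (\<forall>(f, h) \<in> G. (J f, J h) \<in> converse G)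
          \<and> energy_dense G (Domain (C_op Lp Lm)))"

definition J_orthonormal :: "('a::complex_hilbert \<Rightarrow> 'a) \<Rightarrow> (nat \<Rightarrow> 'a) \<Rightarrow> bool" where
  "J_orthonormal J f \<longleftrightarrow> (\<forall>n m. cmod (indef J (f n) (f m)) = (if n = m then 1 else 0))"

definition complete_seq :: "(nat \<Rightarrow> 'a::complex_hilbert) \<Rightarrow> bool" where
  "complete_seq f \<longleftrightarrow> closure (cspan (range f)) = UNIV"

definition L_plus :: "('a::complex_hilbert \<Rightarrow> 'a) \<Rightarrow> (nat \<Rightarrow> 'a) \<Rightarrow> 'a set" where
  "L_plus J f = closure (cspan {f n | n. indef J (f n) (f n) = 1})"

definition L_minus :: "('a::complex_hilbert \<Rightarrow> 'a) \<Rightarrow> (nat \<Rightarrow> 'a) \<Rightarrow> 'a set" where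
  "L_minus J f = closure (cspan {f n | n. indef J (f n) (f n) = - 1})"

definition quasi_basis :: "('a::complex_hilbert \<Rightarrow> 'a) \<Rightarrow> (nat \<Rightarrow> 'a) \<Rightarrow> bool" where
  "quasi_basis J f \<longleftrightarrow> J_orthonormal J f \<and> complete_seq f
     \<and> quasi_maximal J (L_plus J f) (L_minus J f)"

end

theory Submission
  imports Defs "HOL-Probability.Probability" "HOL-Real_Asymp.Real_Asymp"
begin

text \<open>
  Quasi maximality supplies a positive self-adjoint \<open>G\<close> that extends \<open>G\<^sub>0 = J C\<^sub>0\<close>, satisfies
  \<open>J G = G\<^sup>-\<^sup>1 J\<close>, and has \<open>D(G\<^sub>0)\<close> dense in its energy space. This is the \<open>G\<close> of the conclusion, with
  \<open>C = J G\<close>, \<open>Q = ln G\<close> and \<open>S = \<surd>G = e\<^sup>Q\<^sup>/\<^sup>2\<close>. Granted these functions of \<open>G\<close>, the expansion is a Fourier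
  series. From \<open>G f\<^sub>n = [f\<^sub>n, f\<^sub>n] J f\<^sub>n\<close> one gets
  \<open>(\<surd>G f\<^sub>n, \<surd>G f\<^sub>m) = (G f\<^sub>n, f\<^sub>m) = [f\<^sub>n, f\<^sub>n] [f\<^sub>n, f\<^sub>m]\<close>, so that the vectors \<open>\<surd>G f\<^sub>n\<close> are orthonormal. Their
  coefficients are \<open>(\<surd>G g, \<surd>G f\<^sub>n) = (g, G f\<^sub>n) = [g, C f\<^sub>n]\<close>. On the subspaces generated by the
  sequence the energy norm is at most the Hilbert norm, since \<open>(G u, u) = |[u, u]| \<le> \<parallel>u\<parallel>\<^sup>2\<close> there. Hence the
  span of the \<open>f\<^sub>n\<close> is dense in \<open>D(G\<^sub>0)\<close> for the energy norm, and by hypothesis in the energy space. So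
  \<open>\<surd>G g\<close> lies in the closed span of the \<open>\<surd>G f\<^sub>n\<close> for every \<open>g\<close> in the energetic manifold, and its Fourier
  series converges to it (\<open>fourier_sums\<close>, \<open>expansion\<close>). The energy norm of \<open>g\<close> is the norm of \<open>\<surd>G g\<close>, so the
  other series is the same one seen in the energy space.

  Most of the work goes into the functional calculus of \<open>G\<close>. It is read off from the resolvent
  \<open>A = (1 + G)\<^sup>-\<^sup>1\<close>, which is everywhere defined and satisfies \<open>0 \<le> A \<le> 1\<close>. For each vector \<open>x\<close> there is a
  measure on \<open>[0, 1]\<close> with \<open>\<integral> p = (p(A) x, x)\<close> for all polynomials \<open>p\<close>. It is obtained as in
  Hausdorff's solution of the moment problem, because the Bernstein polynomials are positive at \<open>A\<close>.
  Then \<open>p \<mapsto> p(A) x\<close> is isometric for the norm of \<open>L\<^sup>2\<close>, polynomials are dense there, and the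
  map extends to all square integrable \<open>\<phi>\<close>. This extension \<open>fcalc \<phi> x\<close> is \<open>\<phi>(A) x\<close>. Additivity in \<open>x\<close> and symmetry
  hold because one sequence of polynomials can approximate \<open>\<phi>\<close> with respect to the measures of several
  vectors at once (\<open>polynomials_l2_dense\<close>). Unbounded \<open>\<phi>\<close> are reached by truncation, and \<open>\<phi>(A)\<close> is
  self-adjoint on its natural domain (\<open>self_adjoint_fop\<close>). The projections \<open>1\<^sub>B(A)\<close>, transported by
  \<open>t \<mapsto> ln ((1 - t) / t)\<close>, form the spectral measure of \<open>Q\<close>.

  The relation \<open>J G = G\<^sup>-\<^sup>1 J\<close> says \<open>A J = J (1 - A)\<close>, that is, \<open>J\<close> reflects the spectrum of \<open>A\<close> at \<open>1/2\<close>
  and that of \<open>Q\<close> at \<open>0\<close>, hence \<open>J Q = - Q J\<close>. It also makes \<open>C = J G\<close> an involution of \<open>D(G)\<close>, whose eigenspaces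
  are maximal definite (\<open>maximal_positive_eigen_plus\<close>, \<open>maximal_negative_eigen_minus\<close>) and sum to \<open>D(G)\<close>.
\<close>

section \<open>Polynomials of a positive contraction\<close>

locale positive_contraction =
  fixes A :: "'a::{real_inner,complete_space} \<Rightarrow> 'a"
  assumes linear_A: "linear A"
    and symmetric_A: "inner (A x) y = inner x (A y)"
    and inner_A_nonneg: "0 \<le> inner (A x) x"
    and inner_A_le: "inner (A x) x \<le> inner x x"
begin

definition peval :: "real poly \<Rightarrow> 'a \<Rightarrow> 'a" where
  "peval p = fold_coeffs (\<lambda>c g x. c *\<^sub>R x + A (g x)) p (\<lambda>x. 0)"

lemma A_zero [simp]: "A 0 = 0"
  using linear_A by (rule linear_0)

lemma peval_0 [simp]: "peval 0 x = 0"
  by (simp add: peval_def)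

lemma peval_pCons [simp]: "peval (pCons c p) x = c *\<^sub>R x + A (peval p x)"
  by (cases "p = 0 \<and> c = 0") (auto simp: peval_def)

lemma peval_add: "peval (p + q) x = peval p x + peval q x"
  by (induction p q rule: poly_induct2)
     (simp_all add: linear_add[OF linear_A] scaleR_left_distrib)

lemma peval_smult: "peval (smult c p) x = c *\<^sub>R peval p x"
  by (induction p)
     (simp_all add: linear_scale[OF linear_A] scaleR_right_distrib)

lemma peval_diff: "peval (p - q) x = peval p x - peval q x"
  using peval_add[of p "- q" x] peval_smult[of "-1" q x] by simp

lemma peval_sum: "peval (\<Sum>i\<in>I. p i) x = (\<Sum>i\<in>I. peval (p i) x)"
  by (induction I rule: infinite_finite_induct) (simp_all add: peval_add)

lemma peval_mult: "peval (p * q) x = peval p (peval q x)"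
  by (induction p) (simp_all add: peval_add peval_smult)

lemma linear_peval: "linear (peval p)"
proof (rule linearI)
  show "peval p (x + y) = peval p x + peval p y" for x y
    by (induction p) (simp_all add: linear_add[OF linear_A] algebra_simps)
  show "peval p (c *\<^sub>R x) = c *\<^sub>R peval p x" for c x
    by (induction p) (simp_all add: linear_scale[OF linear_A] algebra_simps)
qed

lemma symmetric_peval: "inner (peval p x) y = inner x (peval p y)"
proof (induction p arbitrary: x y)
  case (pCons c p)
  have "inner (A (peval p x)) y = inner x (peval p (A y))"
    by (simp add: symmetric_A pCons.IH)
  also have "peval p (A y) = A (peval p y)"
    using peval_mult[of p "[:0, 1:]" y] peval_mult[of "[:0, 1:]" p y] by (simp add: mult.commute)
  finally show ?case by (simp add: inner_add_left inner_add_right)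
qed simp

lemma inner_peval_square_mult:
  "inner (peval (q * q * r) x) x = inner (peval r (peval q x)) (peval q x)"
proof -
  have "peval (q * q * r) x = peval q (peval r (peval q x))"
    by (metis mult.assoc mult.commute peval_mult)
  then show ?thesis by (simp add: symmetric_peval)
qed

text \<open>A power product \<open>t\<^sup>k (1 - t)\<^sup>m\<close> is a square times one of \<open>1\<close>, \<open>t\<close>, \<open>1 - t\<close> and \<open>t (1 - t)\<close>. The
  first three are nonnegative at \<open>A\<close> because \<open>0 \<le> A \<le> 1\<close>, and the last one reduces to them by
  \<open>t (1 - t) = t\<^sup>2 (1 - t) + (1 - t)\<^sup>2 t\<close>.\<close>

lemma inner_peval_power_nonneg:
  "0 \<le> inner (peval ([:0, 1:] ^ k * [:1, -1:] ^ m) x) x"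
proof -
  let ?X = "[:0, 1:] :: real poly" and ?Y = "[:1, -1:] :: real poly"
  have X: "0 \<le> inner (peval ?X y) y" for y
    using inner_A_nonneg by simp
  have Y: "0 \<le> inner (peval ?Y y) y" for y
    using inner_A_le[of y] by (simp add: inner_diff_left linear_neg[OF linear_A])
  have XY: "0 \<le> inner (peval (?X * ?Y) y) y" for y
  proof -
    have "?X * ?Y = ?X * ?X * ?Y + ?Y * ?Y * ?X"
      by simp
    then have "inner (peval (?X * ?Y) y) y
        = inner (peval ?Y (peval ?X y)) (peval ?X y) + inner (peval ?X (peval ?Y y)) (peval ?Y y)"
      by (simp only: peval_add inner_add_left inner_peval_square_mult)
    then show ?thesis using X Y by simp
  qed
  define q where "q = ?X ^ (k div 2) * ?Y ^ (m div 2)"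
  define r where "r = ?X ^ (k mod 2) * ?Y ^ (m mod 2)"
  have k: "?X ^ k = ?X ^ (k div 2) * ?X ^ (k div 2) * ?X ^ (k mod 2)"
    by (simp only: power_add[symmetric]) (rule arg_cong[where f="\<lambda>i. ?X ^ i"], presburger)
  have m: "?Y ^ m = ?Y ^ (m div 2) * ?Y ^ (m div 2) * ?Y ^ (m mod 2)"
    by (simp only: power_add[symmetric]) (rule arg_cong[where f="\<lambda>i. ?Y ^ i"], presburger)
  have "?X ^ k * ?Y ^ m = q * q * r"
    unfolding q_def r_def by (subst k, subst m) (simp only: mult_ac)
  moreover have "0 \<le> inner (peval r y) y" for y
  proof -
    have "k mod 2 = 0 \<or> k mod 2 = 1" "m mod 2 = 0 \<or> m mod 2 = 1" by auto
    then consider "r = 1" | "r = ?X" | "r = ?Y" | "r = ?X * ?Y"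
      unfolding r_def by fastforce
    then show ?thesis
    proof cases
      case 1
      then show ?thesis by (simp add: one_pCons)
    qed (use X Y XY in auto)
  qed
  ultimately show ?thesis by (simp only: inner_peval_square_mult)
qed

end

section \<open>The moment problem on the unit interval\<close>

definition bernstein_poly :: "nat \<Rightarrow> nat \<Rightarrow> real poly" where
  "bernstein_poly n k = smult (real (n choose k)) ([:0, 1:] ^ k * [:1, -1:] ^ (n - k))"

text \<open>With the weights \<open>(k choose m) / (n choose m)\<close> in place of \<open>(k / n)\<^sup>m\<close> the Bernstein sum reproduces \<open>t\<^sup>m\<close>
  exactly: as \<open>(n choose k) (k choose m) = (n choose m) (n - m choose k - m)\<close>, it is \<open>t\<^sup>m\<close> times the binomial expansion of
  \<open>(t + (1 - t))\<^sup>n\<^sup>-\<^sup>m\<close>. This is an identity of polynomials, so it holds at the operator \<open>A\<close> as well.\<close>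

lemma sum_binomial_bernstein_poly:
  assumes "m \<le> n"
  shows "(\<Sum>k\<le>n. smult (real (k choose m) / real (n choose m)) (bernstein_poly n k)) = [:0, 1:] ^ m"
proof -
  let ?X = "[:0, 1:] :: real poly" and ?Y = "[:1, -1:] :: real poly"
  have pos: "real (n choose m) > 0" using assms by simp
  have "(\<Sum>k\<le>n. smult (real (k choose m) / real (n choose m)) (bernstein_poly n k))
      = (\<Sum>k=m..n. smult (real (k choose m) / real (n choose m)) (bernstein_poly n k))"
    by (rule sum.mono_neutral_right) (auto simp: binomial_eq_0)
  also have "\<dots> = (\<Sum>k=m..n. smult (real ((n - m) choose (k - m))) (?X ^ k * ?Y ^ (n - k)))"
  proof (rule sum.cong[OF refl])
    fix k assume k: "k \<in> {m..n}"
    have "real (n choose k) * real (k choose m) = real (n choose m) * real ((n - m) choose (k - m))"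
      using choose_mult[of m k n] k by (metis atLeastAtMost_iff of_nat_mult)
    then have "real (k choose m) / real (n choose m) * real (n choose k) = real ((n - m) choose (k - m))"
      using pos by (simp add: field_simps)
    then show "smult (real (k choose m) / real (n choose m)) (bernstein_poly n k)
        = smult (real ((n - m) choose (k - m))) (?X ^ k * ?Y ^ (n - k))"
      unfolding bernstein_poly_def by (simp only: smult_smult)
  qed
  also have "\<dots> = (\<Sum>j\<le>n - m. smult (real ((n - m) choose j)) (?X ^ (j + m) * ?Y ^ (n - m - j)))"
    using assms by (intro sum.reindex_bij_witness[of _ "\<lambda>j. j + m" "\<lambda>k. k - m"]) auto
  also have "\<dots> = ?X ^ m * (\<Sum>j\<le>n - m. of_nat ((n - m) choose j) * ?X ^ j * ?Y ^ (n - m - j))"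
    by (simp only: sum_distrib_left power_add of_nat_poly)
       (rule sum.cong[OF refl], simp add: mult_ac)
  also have "\<dots> = ?X ^ m * (?X + ?Y) ^ (n - m)"
    by (simp only: binomial_ring)
  also have "?X + ?Y = 1" by (simp add: one_pCons)
  finally show ?thesis by simp
qed

text \<open>The two kinds of weights differ by \<open>O(1/n)\<close> uniformly in \<open>k\<close>: the quotient of binomial
  coefficients is the product of the \<open>m\<close> factors \<open>(k - i) / (n - i)\<close>, each of which is within \<open>m / (n - m)\<close> of
  \<open>k / n\<close>. The condition \<open>2 m < n\<close> bounds the factors by \<open>1\<close> in absolute value, also when \<open>k < i\<close>.\<close>

lemma binomial_quotient_bound:
  assumes "k \<le> n" and "2 * m < n"
  shows "\<bar>(real k / real n) ^ m - real (k choose m) / real (n choose m)\<bar> \<le> real (m * m) / real (n - m)"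
proof -
  have b: "real (j choose m) = (\<Prod>i<m. real j - real i) / fact m" for j
    by (simp add: binomial_gbinomial gbinomial_prod_rev atLeast0LessThan)
  have "real (k choose m) / real (n choose m) = (\<Prod>i<m. (real k - real i) / (real n - real i))"
    by (simp add: b prod_dividef)
  moreover have "norm ((\<Prod>i<m. real k / real n) - (\<Prod>i<m. (real k - real i) / (real n - real i)))
      \<le> (\<Sum>i<m. norm (real k / real n - (real k - real i) / (real n - real i)))"
  proof (rule norm_prod_diff)
    show "norm (real k / real n) \<le> 1" for i :: nat using assms by simp
    show "norm ((real k - real i) / (real n - real i)) \<le> 1" if "i \<in> {..<m}" for i
    proof -
      have "\<bar>real k - real i\<bar> \<le> real n - real i" using assms that by auto
      moreover have "real n - real i > 0" using assms that by simp
      ultimately show ?thesis by simp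
    qed
  qed
  moreover have "(\<Sum>i<m. norm (real k / real n - (real k - real i) / (real n - real i)))
      \<le> (\<Sum>i<m. real m / real (n - m))"
  proof (rule sum_mono)
    fix i assume i: "i \<in> {..<m}"
    have pos: "real n > 0" "real n - real i > 0" "real (n - m) > 0" "real (n - m) \<le> real n - real i"
      using assms i by auto
    have "real k / real n - (real k - real i) / (real n - real i)
        = (real i / (real n - real i)) * ((real n - real k) / real n)"
      using pos by (simp add: field_simps)
    then have "norm (real k / real n - (real k - real i) / (real n - real i))
        = (real i / (real n - real i)) * ((real n - real k) / real n)"
      using pos assms by (simp add: abs_mult)
    also have "\<dots> \<le> (real i / (real n - real i)) * 1"
      using pos assms by (intro mult_left_mono) auto
    also have "\<dots> \<le> real m / real (n - m)"
      using pos i by (simp, intro frac_le) auto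
    finally show "norm (real k / real n - (real k - real i) / (real n - real i)) \<le> real m / real (n - m)" .
  qed
  ultimately show ?thesis by simp
qed

context positive_contraction
begin

lemma inner_bernstein_poly_nonneg: "0 \<le> inner (peval (bernstein_poly n k) x) x"
  using inner_peval_power_nonneg by (simp add: bernstein_poly_def peval_smult)

lemma sum_inner_bernstein_poly: "(\<Sum>k\<le>n. inner (peval (bernstein_poly n k) x) x) = inner x x"
proof -
  have "(\<Sum>k\<le>n. inner (peval (bernstein_poly n k) x) x) = inner (peval (\<Sum>k\<le>n. bernstein_poly n k) x) x"
    by (simp add: peval_sum inner_sum_left)
  also have "(\<Sum>k\<le>n. bernstein_poly n k) = 1"
    using sum_binomial_bernstein_poly[of 0 n] by simp
  finally show ?thesis by (simp add: one_pCons)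
qed

definition bernstein_pmf :: "'a \<Rightarrow> nat \<Rightarrow> nat pmf" where
  "bernstein_pmf x n = embed_pmf (\<lambda>k. if k \<le> n then inner (peval (bernstein_poly n k) x) x else 0)"

lemma pmf_bernstein_pmf:
  assumes "norm x = 1"
  shows "pmf (bernstein_pmf x n) k = (if k \<le> n then inner (peval (bernstein_poly n k) x) x else 0)"
  unfolding bernstein_pmf_def
proof (rule pmf_embed_pmf)
  let ?f = "\<lambda>k. if k \<le> n then inner (peval (bernstein_poly n k) x) x else 0"
  show "0 \<le> ?f k" for k using inner_bernstein_poly_nonneg by simp
  have "(\<integral>\<^sup>+ k. ennreal (?f k) \<partial>count_space UNIV) = (\<Sum>k\<le>n. ennreal (?f k))"
    by (rule nn_integral_count_space'[of "{..n}"]) (auto split: if_splits)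
  also have "\<dots> = ennreal (\<Sum>k\<le>n. ?f k)"
    using inner_bernstein_poly_nonneg by (intro sum_ennreal) auto
  also have "(\<Sum>k\<le>n. ?f k) = 1"
    using sum_inner_bernstein_poly[of n x] assms by (simp add: dot_square_norm)
  finally show "(\<integral>\<^sup>+ k. ennreal (?f k) \<partial>count_space UNIV) = 1" by simp
qed

lemma expectation_bernstein_pmf:
  fixes h :: "nat \<Rightarrow> real"
  assumes "norm x = 1"
  shows "measure_pmf.expectation (bernstein_pmf x n) h
    = (\<Sum>k\<le>n. h k * inner (peval (bernstein_poly n k) x) x)"
proof -
  have "measure_pmf.expectation (bernstein_pmf x n) h = (\<Sum>k\<le>n. h k * pmf (bernstein_pmf x n) k)"
    by (rule integral_measure_pmf_real)
       (auto simp: set_pmf_eq pmf_bernstein_pmf[OF assms] split: if_splits)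
  then show ?thesis by (simp add: pmf_bernstein_pmf[OF assms])
qed

text \<open>The factorial moments are exact by \<open>sum_binomial_bernstein_poly\<close>, and since the
  masses are nonnegative with sum \<open>1\<close>, replacing the weights costs no more than their uniform distance.\<close>

lemma bernstein_moments:
  assumes x: "norm x = 1"
  shows "(\<lambda>n. measure_pmf.expectation (bernstein_pmf x n) (\<lambda>k. (real k / real n) ^ m))
    \<longlonglongrightarrow> inner (peval ([:0, 1:] ^ m) x) x"
proof -
  let ?b = "\<lambda>n k. inner (peval (bernstein_poly n k) x) x"
  have exact: "(\<Sum>k\<le>n. real (k choose m) / real (n choose m) * ?b n k) = inner (peval ([:0, 1:] ^ m) x) x"
    if "m \<le> n" for n
    by (simp add: sum_binomial_bernstein_poly[OF that, symmetric] peval_sum peval_smult inner_sum_left)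
  have "(\<lambda>n. measure_pmf.expectation (bernstein_pmf x n) (\<lambda>k. (real k / real n) ^ m)
      - inner (peval ([:0, 1:] ^ m) x) x) \<longlonglongrightarrow> 0"
  proof (rule Lim_null_comparison)
    show "\<forall>\<^sub>F n in sequentially. norm (measure_pmf.expectation (bernstein_pmf x n) (\<lambda>k. (real k / real n) ^ m)
      - inner (peval ([:0, 1:] ^ m) x) x) \<le> real (m * m) / (real n - real m)"
    proof (rule eventually_sequentiallyI)
      fix n assume n: "2 * m + 1 \<le> n"
      have "measure_pmf.expectation (bernstein_pmf x n) (\<lambda>k. (real k / real n) ^ m)
          - inner (peval ([:0, 1:] ^ m) x) x
          = (\<Sum>k\<le>n. ((real k / real n) ^ m - real (k choose m) / real (n choose m)) * ?b n k)"
        using exact[of n] n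
        by (simp add: expectation_bernstein_pmf[OF x] left_diff_distrib sum_subtractf)
      also have "\<bar>\<dots>\<bar> \<le> (\<Sum>k\<le>n. \<bar>((real k / real n) ^ m - real (k choose m) / real (n choose m)) * ?b n k\<bar>)"
        by (rule sum_abs)
      also have "\<dots> \<le> (\<Sum>k\<le>n. real (m * m) / real (n - m) * ?b n k)"
      proof (rule sum_mono)
        fix k assume "k \<in> {..n}"
        then have "\<bar>(real k / real n) ^ m - real (k choose m) / real (n choose m)\<bar> \<le> real (m * m) / real (n - m)"
          using binomial_quotient_bound[of k n m] n by simp
        then show "\<bar>((real k / real n) ^ m - real (k choose m) / real (n choose m)) * ?b n k\<bar>
            \<le> real (m * m) / real (n - m) * ?b n k"
          unfolding abs_mult abs_of_nonneg[OF inner_bernstein_poly_nonneg]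
          by (rule mult_right_mono[OF _ inner_bernstein_poly_nonneg])
      qed
      also have "\<dots> = real (m * m) / real (n - m) * (\<Sum>k\<le>n. ?b n k)"
        by (simp add: sum_distrib_left)
      also have "\<dots> = real (m * m) / (real n - real m)"
        using n x by (simp add: sum_inner_bernstein_poly dot_square_norm of_nat_diff)
      finally show "norm (measure_pmf.expectation (bernstein_pmf x n) (\<lambda>k. (real k / real n) ^ m)
          - inner (peval ([:0, 1:] ^ m) x) x) \<le> real (m * m) / (real n - real m)"
        by simp
    qed
    show "(\<lambda>n. real (m * m) / (real n - real m)) \<longlonglongrightarrow> 0"
      by real_asymp
  qed
  then show ?thesis by (rule LIM_zero_cancel)
qed

lemma peval_eq_sum: "peval p x = (\<Sum>i\<le>degree p. coeff p i *\<^sub>R peval ([:0, 1:] ^ i) x)"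
proof -
  have "peval p x = peval (\<Sum>i\<le>degree p. smult (coeff p i) ([:0, 1:] ^ i)) x"
    by (simp only: poly_as_sum_of_monoms flip: monom_altdef)
  then show ?thesis by (simp only: peval_sum peval_smult)
qed

lemma bernstein_poly_moments:
  assumes x: "norm x = 1"
  shows "(\<lambda>n. measure_pmf.expectation (bernstein_pmf x n) (\<lambda>k. poly p (real k / real n)))
    \<longlonglongrightarrow> inner (peval p x) x"
proof -
  have "(\<lambda>n. measure_pmf.expectation (bernstein_pmf x n) (\<lambda>k. poly p (real k / real n)))
    = (\<lambda>n. \<Sum>i\<le>degree p. coeff p i * measure_pmf.expectation (bernstein_pmf x n) (\<lambda>k. (real k / real n) ^ i))"
    unfolding expectation_bernstein_pmf[OF x] poly_altdef sum_distrib_left sum_distrib_right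
    by (subst sum.swap) (simp only: mult_ac)
  moreover have "inner (peval p x) x = (\<Sum>i\<le>degree p. coeff p i * inner (peval ([:0, 1:] ^ i) x) x)"
    by (subst peval_eq_sum) (simp add: inner_sum_left)
  ultimately show ?thesis
    by (simp only:) (intro tendsto_intros bernstein_moments x)
qed

definition represents_moments :: "'a \<Rightarrow> real measure \<Rightarrow> bool" where
  "represents_moments x M \<longleftrightarrow> finite_measure M \<and> sets M = sets borel \<and> (AE t in M. t \<in> {0..1})
     \<and> (\<forall>p. integral\<^sup>L M (poly p) = inner (peval p x) x)"

text \<open>The discrete measures with the masses of \<open>bernstein_pmf\<close> at the points \<open>k / n\<close> have the right moments
  in the limit. They live on a compact interval, so that by Helly's selection theorem a subsequence converges
  weakly.\<close>

lemma represents_moments_unit: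
  assumes x: "norm x = 1"
  shows "\<exists>M. represents_moments x M"
proof -
  define \<mu> where "\<mu> n = distr (measure_pmf (bernstein_pmf x n)) borel (\<lambda>k. real k / real n)" for n
  have supp: "real k / real n \<in> {0..1}" if "k \<in> set_pmf (bernstein_pmf x n)" for k n
    using that by (auto simp: set_pmf_eq pmf_bernstein_pmf[OF x] divide_le_eq_1 split: if_splits)
  have dist: "real_distribution (\<mu> n)" for n
    unfolding \<mu>_def by (intro prob_space.real_distribution_distr measure_pmf.prob_space_axioms) simp
  have "tight \<mu>"
    unfolding tight_def
  proof (intro conjI allI impI dist)
    fix e :: real assume e: "e > 0"
    have "measure (\<mu> n) {-1<..1} = 1" for n
    proof -
      interpret real_distribution "\<mu> n" by (rule dist)
      show ?thesis
      proof (rule prob_eq_1[THEN iffD2])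
        show "{-1<..1} \<in> events" by (simp add: \<mu>_def)
        have "AE k in measure_pmf (bernstein_pmf x n). real k / real n \<in> {-1<..1}"
        proof (rule AE_pmfI)
          fix k assume "k \<in> set_pmf (bernstein_pmf x n)"
          from supp[OF this] show "real k / real n \<in> {-1<..1}"
            unfolding atLeastAtMost_iff greaterThanAtMost_iff by linarith
        qed
        then show "AE t in \<mu> n. t \<in> {-1<..1}"
          unfolding \<mu>_def by (subst AE_distr_iff) auto
      qed
    qed
    then show "\<exists>a b. a < b \<and> (\<forall>n. measure (\<mu> n) {a<..b} > 1 - e)"
      using e by (intro exI[of _ "-1"] exI[of _ 1]) auto
  qed
  from tight_imp_convergent_subsubsequence[OF this, of "\<lambda>n. n"]
  obtain r M where r: "strict_mono r" and M: "real_distribution M"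
    and lim: "weak_conv_m (\<lambda>n. \<mu> (r n)) M"
    by (auto simp: strict_mono_def o_def)
  interpret M: real_distribution M by (rule M)
  \<comment> \<open>Weak convergence tests against bounded continuous functions, so polynomials are composed with the
    retraction \<open>c\<close> of the line to \<open>[0, 1]\<close>. The limit measure is then moved to the interval by \<open>c\<close>.\<close>
  define c :: "real \<Rightarrow> real" where "c t = max 0 (min 1 t)" for t
  have c_cont: "continuous_on UNIV c"
    unfolding c_def by (intro continuous_intros)
  have c_meas [measurable]: "c \<in> borel_measurable borel"
    by (rule borel_measurable_continuous_onI[OF c_cont])
  have c_range: "c t \<in> {0..1}" for t by (simp add: c_def)
  have c_id: "c t = t" if "t \<in> {0..1}" for t using that by (simp add: c_def)
  have c_M: "c \<in> borel_measurable M" by simp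
  have p_meas: "poly p \<in> borel_measurable borel" for p :: "real poly"
    by (intro borel_measurable_continuous_onI continuous_intros)
  have "integral\<^sup>L (distr M borel c) (poly p) = inner (peval p x) x" for p
  proof -
    have "bounded (poly p ` {0..1})"
      by (intro compact_imp_bounded compact_continuous_image continuous_intros) auto
    then obtain B where B: "\<forall>y \<in> poly p ` {0..1}. norm y \<le> B"
      unfolding bounded_iff by blast
    have "(\<lambda>n. integral\<^sup>L (\<mu> (r n)) (\<lambda>t. poly p (c t))) \<longlonglongrightarrow> integral\<^sup>L M (\<lambda>t. poly p (c t))"
    proof (rule weak_conv_imp_integral_bdd_continuous_conv[OF dist M lim])
      have "continuous_on UNIV (\<lambda>t. poly p (c t))"
        unfolding c_def by (intro continuous_intros)
      then show "isCont (\<lambda>t. poly p (c t)) t" for t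
        by (simp add: continuous_on_eq_continuous_at)
      show "norm (poly p (c t)) \<le> B" for t by (rule B[rule_format, OF imageI, OF c_range])
    qed
    moreover have "integral\<^sup>L (\<mu> n) (\<lambda>t. poly p (c t))
        = measure_pmf.expectation (bernstein_pmf x n) (\<lambda>k. poly p (real k / real n))" for n
    proof -
      have "integral\<^sup>L (\<mu> n) (\<lambda>t. poly p (c t))
          = measure_pmf.expectation (bernstein_pmf x n) (\<lambda>k. poly p (c (real k / real n)))"
        unfolding \<mu>_def by (rule integral_distr) (auto intro: measurable_compose[OF c_meas p_meas])
      also have "\<dots> = measure_pmf.expectation (bernstein_pmf x n) (\<lambda>k. poly p (real k / real n))"
        by (rule integral_cong_AE) (auto simp: AE_measure_pmf_iff c_id[OF supp])
      finally show ?thesis .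
    qed
    ultimately have "(\<lambda>n. measure_pmf.expectation (bernstein_pmf x (r n)) (\<lambda>k. poly p (real k / real (r n))))
        \<longlonglongrightarrow> integral\<^sup>L M (\<lambda>t. poly p (c t))"
      by simp
    moreover have "(\<lambda>n. measure_pmf.expectation (bernstein_pmf x (r n)) (\<lambda>k. poly p (real k / real (r n))))
        \<longlonglongrightarrow> inner (peval p x) x"
      using LIMSEQ_subseq_LIMSEQ[OF bernstein_poly_moments[OF x, of p] r] by (simp add: o_def)
    ultimately have "integral\<^sup>L M (\<lambda>t. poly p (c t)) = inner (peval p x) x"
      by (rule LIMSEQ_unique)
    then show ?thesis
      by (subst integral_distr[OF c_M p_meas])
  qed
  moreover have "AE t in distr M borel c. t \<in> {0..1}"
    by (subst AE_distr_iff) (use c_range in auto)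
  moreover have "finite_measure (distr M borel c)"
    by (rule M.finite_measure_distr) simp
  ultimately show ?thesis
    unfolding represents_moments_def by (intro exI[of _ "distr M borel c"]) simp
qed

lemma represents_moments_exists: "\<exists>M. represents_moments x M"
proof (cases "x = 0")
  case True
  have "represents_moments x (null_measure borel)"
    unfolding represents_moments_def
    by (auto simp: True linear_0[OF linear_peval] finite_measure_def finite_measure_axioms_def
        sigma_finite_measure_def AE_iff_null null_sets_def intro!: exI[of _ "{UNIV}"])
  then show ?thesis by blast
next
  case False
  define u where "u = x /\<^sub>R norm x"
  have "norm u = 1" using False by (simp add: u_def)
  then obtain M where "represents_moments u M" using represents_moments_unit by blast
  then interpret M: finite_measure M by (simp add: represents_moments_def)
  have M: "sets M = sets borel" "AE t in M. t \<in> {0..1}" "\<And>p. integral\<^sup>L M (poly p) = inner (peval p u) u"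
    using \<open>represents_moments u M\<close> by (auto simp: represents_moments_def)
  have x: "x = norm x *\<^sub>R u" using False by (simp add: u_def)
  let ?N = "density M (\<lambda>_. ennreal ((norm x)\<^sup>2))"
  have "finite_measure ?N"
    by (rule finite_measureI) (auto simp: emeasure_density ennreal_mult_eq_top_iff)
  moreover have "sets ?N = sets borel" using M(1) by simp
  moreover have "AE t in ?N. t \<in> {0..1}"
    using M(2) by (subst AE_density) auto
  moreover have "integral\<^sup>L ?N (poly p) = inner (peval p x) x" for p
  proof -
    have [measurable]: "poly p \<in> borel_measurable M"
      unfolding measurable_cong_sets[OF M(1) refl]
      by (intro borel_measurable_continuous_onI continuous_intros)
    have "integral\<^sup>L ?N (poly p) = (norm x)\<^sup>2 * integral\<^sup>L M (poly p)"
      by (subst integral_density) auto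
    also have "\<dots> = inner (peval p (norm x *\<^sub>R u)) (norm x *\<^sub>R u)"
      by (simp add: M(3) linear_scale[OF linear_peval] power2_eq_square)
    finally show ?thesis using x by simp
  qed
  ultimately show ?thesis unfolding represents_moments_def by blast
qed

definition moment_measure :: "'a \<Rightarrow> real measure" where
  "moment_measure x = (SOME M. represents_moments x M)"

lemma represents_moments_moment_measure: "represents_moments x (moment_measure x)"
  unfolding moment_measure_def using represents_moments_exists by (rule someI_ex)

lemma
  shows finite_moment_measure: "finite_measure (moment_measure x)"
    and sets_moment_measure [simp, measurable_cong]: "sets (moment_measure x) = sets borel"
    and space_moment_measure [simp]: "space (moment_measure x) = UNIV"
    and AE_moment_measure: "AE t in moment_measure x. t \<in> {0..1}"
    and integral_poly_moment_measure: "integral\<^sup>L (moment_measure x) (poly p) = inner (peval p x) x"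
  using represents_moments_moment_measure[of x] sets_eq_imp_space_eq[of "moment_measure x" borel]
  by (auto simp: represents_moments_def)

end

section \<open>Square integrable functions\<close>

definition sq_integrable :: "'b measure \<Rightarrow> ('b \<Rightarrow> real) \<Rightarrow> bool" where
  "sq_integrable M f \<longleftrightarrow> f \<in> borel_measurable M \<and> integrable M (\<lambda>t. (f t)\<^sup>2)"

lemma sq_integrable_measurable: "sq_integrable M f \<Longrightarrow> f \<in> borel_measurable M"
  by (simp add: sq_integrable_def)

lemma sq_integrable_square: "sq_integrable M f \<Longrightarrow> integrable M (\<lambda>t. (f t)\<^sup>2)"
  by (simp add: sq_integrable_def)

lemma sq_integrable_mult:
  assumes "sq_integrable M f" "sq_integrable M g"
  shows "integrable M (\<lambda>t. f t * g t)"
proof (rule Bochner_Integration.integrable_bound)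
  show "integrable M (\<lambda>t. (f t)\<^sup>2 + (g t)\<^sup>2)"
    using assms by (auto simp: sq_integrable_def)
  show "(\<lambda>t. f t * g t) \<in> borel_measurable M"
    using assms by (auto simp: sq_integrable_def)
  show "AE t in M. norm (f t * g t) \<le> norm ((f t)\<^sup>2 + (g t)\<^sup>2)"
  proof (rule AE_I2)
    fix t
    have "2 * (\<bar>f t\<bar> * \<bar>g t\<bar>) \<le> (f t)\<^sup>2 + (g t)\<^sup>2"
      using sum_squares_bound[of "\<bar>f t\<bar>" "\<bar>g t\<bar>"] by (simp add: mult.assoc)
    moreover have "0 \<le> \<bar>f t\<bar> * \<bar>g t\<bar>" by simp
    ultimately show "norm (f t * g t) \<le> norm ((f t)\<^sup>2 + (g t)\<^sup>2)"
      unfolding real_norm_def abs_mult by linarith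
  qed
qed

lemma sq_integrable_bound:
  assumes "sq_integrable M g" "f \<in> borel_measurable M" "AE t in M. \<bar>f t\<bar> \<le> \<bar>g t\<bar>"
  shows "sq_integrable M f"
  unfolding sq_integrable_def
proof (intro conjI assms(2) Bochner_Integration.integrable_bound[OF sq_integrable_square[OF assms(1)]])
  show "(\<lambda>t. (f t)\<^sup>2) \<in> borel_measurable M" using assms(2) by simp
  show "AE t in M. norm ((f t)\<^sup>2) \<le> norm ((g t)\<^sup>2)"
    using assms(3) by (simp add: abs_le_square_iff)
qed

lemma sq_integrable_cmult:
  assumes "sq_integrable M f"
  shows "sq_integrable M (\<lambda>t. c * f t)"
  using assms by (auto simp: sq_integrable_def power_mult_distrib)

lemma sq_integrable_add:
  assumes "sq_integrable M f" "sq_integrable M g"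
  shows "sq_integrable M (\<lambda>t. f t + g t)"
  using assms sq_integrable_mult[OF assms]
  by (auto simp: sq_integrable_def power2_sum mult.assoc)

lemma sq_integrable_diff:
  assumes "sq_integrable M f" "sq_integrable M g"
  shows "sq_integrable M (\<lambda>t. f t - g t)"
  using sq_integrable_add[OF assms(1) sq_integrable_cmult[OF assms(2), of "-1"]] by simp

lemma (in finite_measure) sq_integrable_bounded:
  assumes "f \<in> borel_measurable M" "AE t in M. \<bar>f t\<bar> \<le> B"
  shows "sq_integrable M f"
proof (rule sq_integrable_bound[OF _ assms(1)])
  show "sq_integrable M (\<lambda>_. B)" by (simp add: sq_integrable_def)
  show "AE t in M. \<bar>f t\<bar> \<le> \<bar>B\<bar>" using assms(2) by eventually_elim simp
qed

text \<open>The quadratic polynomial \<open>s \<mapsto> \<integral>(s f - g)\<^sup>2\<close> is nonnegative.\<close>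

lemma integral_cauchy_schwarz:
  assumes f: "sq_integrable M f" and g: "sq_integrable M g"
  shows "\<bar>\<integral>t. f t * g t \<partial>M\<bar> \<le> sqrt (\<integral>t. (f t)\<^sup>2 \<partial>M) * sqrt (\<integral>t. (g t)\<^sup>2 \<partial>M)"
proof -
  define a b c where "a = (\<integral>t. (f t)\<^sup>2 \<partial>M)" and "b = (\<integral>t. (g t)\<^sup>2 \<partial>M)" and "c = (\<integral>t. f t * g t \<partial>M)"
  have quad: "0 \<le> s\<^sup>2 * a - 2 * s * c + b" for s
  proof -
    have "0 \<le> (\<integral>t. (s * f t - g t)\<^sup>2 \<partial>M)" by simp
    also have "(\<lambda>t. (s * f t - g t)\<^sup>2) = (\<lambda>t. s\<^sup>2 * (f t)\<^sup>2 - 2 * s * (f t * g t) + (g t)\<^sup>2)"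
      by (auto simp: power2_eq_square algebra_simps)
    also have "(\<integral>t. s\<^sup>2 * (f t)\<^sup>2 - 2 * s * (f t * g t) + (g t)\<^sup>2 \<partial>M) = s\<^sup>2 * a - 2 * s * c + b"
      using sq_integrable_square[OF f] sq_integrable_square[OF g] sq_integrable_mult[OF f g]
      by (simp add: a_def b_def c_def)
    finally show ?thesis .
  qed
  have "0 \<le> a" "0 \<le> b" by (simp_all add: a_def b_def)
  have "c\<^sup>2 \<le> a * b"
  proof (cases "a = 0")
    case True
    have "c = 0"
    proof (rule ccontr)
      assume "c \<noteq> 0"
      then show False using quad[of "(b + 1) / (2 * c)"] True \<open>0 \<le> b\<close> by (simp add: field_simps)
    qed
    then show ?thesis using True by simp
  next
    case False
    have "0 \<le> a * ((c / a)\<^sup>2 * a - 2 * (c / a) * c + b)"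
      by (rule mult_nonneg_nonneg[OF \<open>0 \<le> a\<close> quad])
    also have "\<dots> = a * b - c\<^sup>2" using False by (simp add: field_simps power2_eq_square)
    finally show ?thesis by simp
  qed
  then have "\<bar>c\<bar> \<le> sqrt (a * b)" by (rule real_le_rsqrt[of "\<bar>c\<bar>", unfolded power2_abs])
  then show ?thesis by (simp add: a_def b_def c_def real_sqrt_mult)
qed

definition l2_tendsto :: "'b measure \<Rightarrow> (nat \<Rightarrow> 'b \<Rightarrow> real) \<Rightarrow> ('b \<Rightarrow> real) \<Rightarrow> bool" where
  "l2_tendsto M F f \<longleftrightarrow> (\<forall>n. sq_integrable M (F n)) \<and> sq_integrable M f
     \<and> (\<lambda>n. \<integral>t. (F n t - f t)\<^sup>2 \<partial>M) \<longlonglongrightarrow> 0"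

lemma l2_tendsto_integral_mult:
  assumes F: "l2_tendsto M F f" and g: "sq_integrable M g"
  shows "(\<lambda>n. \<integral>t. F n t * g t \<partial>M) \<longlonglongrightarrow> (\<integral>t. f t * g t \<partial>M)"
proof (rule LIM_zero_cancel, rule Lim_null_comparison)
  have sq: "sq_integrable M (F n)" "sq_integrable M f" for n using F by (auto simp: l2_tendsto_def)
  have "(\<integral>t. F n t * g t \<partial>M) - (\<integral>t. f t * g t \<partial>M) = (\<integral>t. (F n t - f t) * g t \<partial>M)" for n
    by (simp add: left_diff_distrib sq_integrable_mult sq g)
  then show "\<forall>\<^sub>F n in sequentially. norm ((\<integral>t. F n t * g t \<partial>M) - (\<integral>t. f t * g t \<partial>M))
      \<le> sqrt (\<integral>t. (F n t - f t)\<^sup>2 \<partial>M) * sqrt (\<integral>t. (g t)\<^sup>2 \<partial>M)"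
    using integral_cauchy_schwarz[OF sq_integrable_diff[OF sq] g] by simp
  have "(\<lambda>n. sqrt (\<integral>t. (F n t - f t)\<^sup>2 \<partial>M) * sqrt (\<integral>t. (g t)\<^sup>2 \<partial>M)) \<longlonglongrightarrow> sqrt 0 * sqrt (\<integral>t. (g t)\<^sup>2 \<partial>M)"
    using F unfolding l2_tendsto_def by (intro tendsto_intros) auto
  then show "(\<lambda>n. sqrt (\<integral>t. (F n t - f t)\<^sup>2 \<partial>M) * sqrt (\<integral>t. (g t)\<^sup>2 \<partial>M)) \<longlonglongrightarrow> 0" by simp
qed

lemma l2_tendsto_integral_square:
  assumes F: "l2_tendsto M F f"
  shows "(\<lambda>n. \<integral>t. (F n t)\<^sup>2 \<partial>M) \<longlonglongrightarrow> (\<integral>t. (f t)\<^sup>2 \<partial>M)"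
proof -
  have sq: "sq_integrable M (F n)" "sq_integrable M f" for n using F by (auto simp: l2_tendsto_def)
  have "(\<integral>t. (F n t)\<^sup>2 \<partial>M) = (\<integral>t. (F n t - f t)\<^sup>2 \<partial>M) + 2 * (\<integral>t. F n t * f t \<partial>M) - (\<integral>t. (f t)\<^sup>2 \<partial>M)" for n
  proof -
    have "(\<integral>t. (F n t - f t)\<^sup>2 \<partial>M) = (\<integral>t. (F n t)\<^sup>2 + (f t)\<^sup>2 - 2 * (F n t * f t) \<partial>M)"
      by (simp add: power2_diff mult.assoc)
    also have "\<dots> = (\<integral>t. (F n t)\<^sup>2 \<partial>M) + (\<integral>t. (f t)\<^sup>2 \<partial>M) - 2 * (\<integral>t. F n t * f t \<partial>M)"
      using sq sq_integrable_mult[OF sq] by (simp add: sq_integrable_def)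
    finally show ?thesis by simp
  qed
  moreover have "(\<lambda>n. (\<integral>t. (F n t - f t)\<^sup>2 \<partial>M) + 2 * (\<integral>t. F n t * f t \<partial>M) - (\<integral>t. (f t)\<^sup>2 \<partial>M))
      \<longlonglongrightarrow> 0 + 2 * (\<integral>t. f t * f t \<partial>M) - (\<integral>t. (f t)\<^sup>2 \<partial>M)"
    using F unfolding l2_tendsto_def by (intro tendsto_intros l2_tendsto_integral_mult F) auto
  ultimately show ?thesis by (simp add: power2_eq_square)
qed

lemma l2_dist_triangle:
  assumes "sq_integrable M f" "sq_integrable M g" "sq_integrable M h"
  shows "(\<integral>t. (f t - h t)\<^sup>2 \<partial>M) \<le> 2 * (\<integral>t. (f t - g t)\<^sup>2 \<partial>M) + 2 * (\<integral>t. (g t - h t)\<^sup>2 \<partial>M)"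
proof -
  have i: "integrable M (\<lambda>t. (f t - g t)\<^sup>2)" "integrable M (\<lambda>t. (g t - h t)\<^sup>2)" "integrable M (\<lambda>t. (f t - h t)\<^sup>2)"
    using assms by (auto intro!: sq_integrable_square sq_integrable_diff)
  have "(\<integral>t. (f t - h t)\<^sup>2 \<partial>M) \<le> (\<integral>t. 2 * (f t - g t)\<^sup>2 + 2 * (g t - h t)\<^sup>2 \<partial>M)"
  proof (rule integral_mono)
    fix t
    have "0 \<le> ((f t - g t) - (g t - h t))\<^sup>2" by simp
    then show "(f t - h t)\<^sup>2 \<le> 2 * (f t - g t)\<^sup>2 + 2 * (g t - h t)\<^sup>2"
      by (simp add: power2_eq_square algebra_simps)
  qed (use i in auto)
  also have "\<dots> = 2 * (\<integral>t. (f t - g t)\<^sup>2 \<partial>M) + 2 * (\<integral>t. (g t - h t)\<^sup>2 \<partial>M)"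
    using i by simp
  finally show ?thesis .
qed

lemma l2_tendsto_dominated:
  assumes "\<And>n. F n \<in> borel_measurable M" "f \<in> borel_measurable M" "sq_integrable M w"
    and bound: "\<And>n t. \<bar>F n t\<bar> \<le> \<bar>w t\<bar>"
    and lim: "\<And>t. (\<lambda>n. F n t) \<longlonglongrightarrow> f t"
  shows "l2_tendsto M F f"
  unfolding l2_tendsto_def
proof (intro conjI allI)
  have bf: "\<bar>f t\<bar> \<le> \<bar>w t\<bar>" for t
    by (rule LIMSEQ_le_const2[OF tendsto_rabs[OF lim]]) (use bound in auto)
  show F: "sq_integrable M (F n)" for n
    by (rule sq_integrable_bound[OF assms(3,1)]) (use bound in auto)
  show f: "sq_integrable M f"
    by (rule sq_integrable_bound[OF assms(3,2)]) (use bf in auto)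
  have "(\<lambda>n. \<integral>t. (F n t - f t)\<^sup>2 \<partial>M) \<longlonglongrightarrow> (\<integral>t. 0 \<partial>M)"
  proof (rule integral_dominated_convergence[where w="\<lambda>t. 4 * (w t)\<^sup>2"])
    show "integrable M (\<lambda>t. 4 * (w t)\<^sup>2)" using assms(3) by (simp add: sq_integrable_def)
    show "AE t in M. (\<lambda>n. (F n t - f t)\<^sup>2) \<longlonglongrightarrow> 0"
    proof (rule AE_I2)
      fix t
      show "(\<lambda>n. (F n t - f t)\<^sup>2) \<longlonglongrightarrow> 0"
        using tendsto_power[OF LIM_zero[OF lim[of t]], of 2] by simp
    qed
    show "AE t in M. norm ((F n t - f t)\<^sup>2) \<le> 4 * (w t)\<^sup>2" for n
    proof (rule AE_I2)
      fix t
      have "\<bar>F n t - f t\<bar> \<le> \<bar>2 * w t\<bar>" using bound[of n t] bf[of t] by simp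
      then have "(F n t - f t)\<^sup>2 \<le> (2 * w t)\<^sup>2" by (simp only: abs_le_square_iff)
      then show "norm ((F n t - f t)\<^sup>2) \<le> 4 * (w t)\<^sup>2" by simp
    qed
  qed (use assms(1,2) in auto)
  then show "(\<lambda>n. \<integral>t. (F n t - f t)\<^sup>2 \<partial>M) \<longlonglongrightarrow> 0" by simp
qed

lemma l2_tendsto_add:
  assumes F: "l2_tendsto M F f" and G: "l2_tendsto M G g"
  shows "l2_tendsto M (\<lambda>n t. F n t + G n t) (\<lambda>t. f t + g t)"
  unfolding l2_tendsto_def
proof (intro conjI allI)
  have F': "sq_integrable M (F n)" "sq_integrable M f" "(\<lambda>n. \<integral>t. (F n t - f t)\<^sup>2 \<partial>M) \<longlonglongrightarrow> 0"
    and G': "sq_integrable M (G n)" "sq_integrable M g" "(\<lambda>n. \<integral>t. (G n t - g t)\<^sup>2 \<partial>M) \<longlonglongrightarrow> 0" for n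
    using F G by (auto simp: l2_tendsto_def)
  show "sq_integrable M (\<lambda>t. F n t + G n t)" for n by (intro sq_integrable_add F' G')
  show "sq_integrable M (\<lambda>t. f t + g t)" by (intro sq_integrable_add F' G')
  show "(\<lambda>n. \<integral>t. (F n t + G n t - (f t + g t))\<^sup>2 \<partial>M) \<longlonglongrightarrow> 0"
  proof (rule Lim_null_comparison)
    show "\<forall>\<^sub>F n in sequentially. norm (\<integral>t. (F n t + G n t - (f t + g t))\<^sup>2 \<partial>M)
        \<le> 2 * (\<integral>t. (F n t - f t)\<^sup>2 \<partial>M) + 2 * (\<integral>t. (G n t - g t)\<^sup>2 \<partial>M)"
    proof (rule always_eventually, rule allI)
      fix n
      have "(\<integral>t. ((F n t - f t) - (g t - G n t))\<^sup>2 \<partial>M)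
          \<le> 2 * (\<integral>t. ((F n t - f t) - 0)\<^sup>2 \<partial>M) + 2 * (\<integral>t. (0 - (g t - G n t))\<^sup>2 \<partial>M)"
        by (intro l2_dist_triangle sq_integrable_diff F' G') (simp add: sq_integrable_def)
      then show "norm (\<integral>t. (F n t + G n t - (f t + g t))\<^sup>2 \<partial>M)
          \<le> 2 * (\<integral>t. (F n t - f t)\<^sup>2 \<partial>M) + 2 * (\<integral>t. (G n t - g t)\<^sup>2 \<partial>M)"
        by (simp add: algebra_simps)
    qed
    show "(\<lambda>n. 2 * (\<integral>t. (F n t - f t)\<^sup>2 \<partial>M) + 2 * (\<integral>t. (G n t - g t)\<^sup>2 \<partial>M)) \<longlonglongrightarrow> 0"
      using tendsto_add[OF tendsto_mult_left[OF F'(3), of 2] tendsto_mult_left[OF G'(3), of 2]] by simp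
  qed
qed

lemma l2_tendsto_bounded_mult:
  assumes F: "l2_tendsto M F f" and g: "g \<in> borel_measurable M" "AE t in M. \<bar>g t\<bar> \<le> B"
  shows "l2_tendsto M (\<lambda>n t. g t * F n t) (\<lambda>t. g t * f t)"
  unfolding l2_tendsto_def
proof (intro conjI allI)
  have F': "sq_integrable M (F n)" "sq_integrable M f" "(\<lambda>n. \<integral>t. (F n t - f t)\<^sup>2 \<partial>M) \<longlonglongrightarrow> 0" for n
    using F by (auto simp: l2_tendsto_def)
  have gh: "sq_integrable M (\<lambda>t. g t * h t)" if "sq_integrable M h" for h
  proof (rule sq_integrable_bound[OF sq_integrable_cmult[OF that, of B]])
    show "(\<lambda>t. g t * h t) \<in> borel_measurable M" using g that by (auto simp: sq_integrable_def)
    show "AE t in M. \<bar>g t * h t\<bar> \<le> \<bar>B * h t\<bar>"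
      using g(2) by eventually_elim (auto simp: abs_mult intro!: mult_right_mono)
  qed
  show "sq_integrable M (\<lambda>t. g t * F n t)" "sq_integrable M (\<lambda>t. g t * f t)" for n
    by (intro gh F')+
  have d: "sq_integrable M (\<lambda>t. F n t - f t)" for n by (intro sq_integrable_diff F')
  show "(\<lambda>n. \<integral>t. (g t * F n t - g t * f t)\<^sup>2 \<partial>M) \<longlonglongrightarrow> 0"
  proof (rule Lim_null_comparison)
    show "\<forall>\<^sub>F n in sequentially. norm (\<integral>t. (g t * F n t - g t * f t)\<^sup>2 \<partial>M) \<le> B\<^sup>2 * (\<integral>t. (F n t - f t)\<^sup>2 \<partial>M)"
    proof (rule always_eventually, rule allI)
      fix n
      have "(\<integral>t. (g t * (F n t - f t))\<^sup>2 \<partial>M) \<le> (\<integral>t. B\<^sup>2 * (F n t - f t)\<^sup>2 \<partial>M)"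
      proof (rule integral_mono_AE)
        show "AE t in M. (g t * (F n t - f t))\<^sup>2 \<le> B\<^sup>2 * (F n t - f t)\<^sup>2"
          using g(2)
        proof eventually_elim
          case (elim t)
          then have "(g t)\<^sup>2 \<le> B\<^sup>2" by (intro power2_le_iff_abs_le[THEN iffD2]) auto
          then show ?case by (simp add: power_mult_distrib mult_right_mono)
        qed
      qed (use sq_integrable_square[OF gh[OF d]] sq_integrable_square[OF d] in auto)
      then show "norm (\<integral>t. (g t * F n t - g t * f t)\<^sup>2 \<partial>M) \<le> B\<^sup>2 * (\<integral>t. (F n t - f t)\<^sup>2 \<partial>M)"
        by (simp add: right_diff_distrib)
    qed
    show "(\<lambda>n. B\<^sup>2 * (\<integral>t. (F n t - f t)\<^sup>2 \<partial>M)) \<longlonglongrightarrow> 0"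
      using tendsto_mult_left[OF F'(3), of "B\<^sup>2"] by simp
  qed
qed

lemma l2_tendsto_cmult:
  assumes "l2_tendsto M F f"
  shows "l2_tendsto M (\<lambda>n t. c * F n t) (\<lambda>t. c * f t)"
  by (rule l2_tendsto_bounded_mult[OF assms, of _ "\<bar>c\<bar>"]) auto

lemma l2_tendsto_distr:
  assumes F: "l2_tendsto (distr M borel s) F f" and s [measurable]: "s \<in> borel_measurable M"
    and [measurable]: "\<And>n. F n \<in> borel_measurable borel" "f \<in> borel_measurable borel"
  shows "l2_tendsto M (\<lambda>n t. F n (s t)) (\<lambda>t. f (s t))"
  using F unfolding l2_tendsto_def sq_integrable_def
  by (simp add: integrable_distr_eq integral_distr)

section \<open>Polynomials are dense in the mean\<close>

definition unit_interval_measure :: "real measure \<Rightarrow> bool" where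
  "unit_interval_measure M \<longleftrightarrow> finite_measure M \<and> sets M = sets borel \<and> (AE t in M. t \<in> {0..1})"

text \<open>The polynomial is chosen for all measures of the family \<open>S\<close> at once. This is what later makes the
  functional calculus additive, since \<open>x\<close>, \<open>y\<close> and \<open>x + y\<close> have different measures.\<close>

definition poly_approx :: "real measure set \<Rightarrow> (real \<Rightarrow> real) \<Rightarrow> bool" where
  "poly_approx S \<phi> \<longleftrightarrow> (\<forall>M\<in>S. sq_integrable M \<phi>)
     \<and> (\<forall>e>0. \<exists>p. \<forall>M\<in>S. (\<integral>t. (poly p t - \<phi> t)\<^sup>2 \<partial>M) < e)"

lemma bounded_on_unit:
  assumes "continuous_on {0..1} (f :: real \<Rightarrow> real)"
  obtains B where "\<And>t. t \<in> {0..1} \<Longrightarrow> \<bar>f t\<bar> \<le> B"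
proof -
  have "bounded (f ` {0..1})"
    by (intro compact_imp_bounded compact_continuous_image assms) auto
  then show thesis unfolding bounded_iff using that by (metis image_eqI real_norm_def)
qed

context
  fixes S :: "real measure set"
  assumes fin: "finite S" and unit: "\<And>M. M \<in> S \<Longrightarrow> unit_interval_measure M"
begin

lemma unit_measurable: "M \<in> S \<Longrightarrow> \<phi> \<in> borel_measurable borel \<Longrightarrow> \<phi> \<in> borel_measurable M"
  using unit[of M] by (simp add: unit_interval_measure_def measurable_def cong: measurable_cong_sets)

lemma sq_integrable_bounded_unit:
  assumes "M \<in> S" "\<phi> \<in> borel_measurable borel" "\<And>t. t \<in> {0..1} \<Longrightarrow> \<bar>\<phi> t\<bar> \<le> B"
  shows "sq_integrable M \<phi>"
proof -
  interpret finite_measure M using unit[OF assms(1)] by (simp add: unit_interval_measure_def)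
  have "AE t in M. t \<in> {0..1}" using unit[OF assms(1)] by (simp add: unit_interval_measure_def)
  then have "AE t in M. \<bar>\<phi> t\<bar> \<le> B" by eventually_elim (rule assms(3))
  then show ?thesis by (rule sq_integrable_bounded[OF unit_measurable[OF assms(1,2)]])
qed

lemma sq_integrable_poly:
  assumes "M \<in> S"
  shows "sq_integrable M (poly p)"
proof -
  obtain B where "\<And>t. t \<in> {0..1} \<Longrightarrow> \<bar>poly p t\<bar> \<le> B"
    by (rule bounded_on_unit[of "poly p"]) (auto intro: continuous_intros)
  then show ?thesis
    by (intro sq_integrable_bounded_unit[OF assms] borel_measurable_continuous_onI continuous_intros)
qed

lemma poly_approx_closed:
  assumes \<phi>: "\<And>M. M \<in> S \<Longrightarrow> sq_integrable M \<phi>"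
    and approx: "\<And>e. e > 0 \<Longrightarrow> \<exists>\<psi>. poly_approx S \<psi> \<and> (\<forall>M\<in>S. (\<integral>t. (\<psi> t - \<phi> t)\<^sup>2 \<partial>M) < e)"
  shows "poly_approx S \<phi>"
  unfolding poly_approx_def
proof (intro conjI ballI allI impI \<phi>)
  fix e :: real assume e: "e > 0"
  then obtain \<psi> where \<psi>: "poly_approx S \<psi>" "\<And>M. M \<in> S \<Longrightarrow> (\<integral>t. (\<psi> t - \<phi> t)\<^sup>2 \<partial>M) < e / 4"
    using approx[of "e / 4"] by auto
  then obtain p where p: "\<And>M. M \<in> S \<Longrightarrow> (\<integral>t. (poly p t - \<psi> t)\<^sup>2 \<partial>M) < e / 4"
    using e unfolding poly_approx_def by (metis divide_pos_pos zero_less_numeral)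
  have "(\<integral>t. (poly p t - \<phi> t)\<^sup>2 \<partial>M) < e" if M: "M \<in> S" for M
    using l2_dist_triangle[OF sq_integrable_poly[OF M, of p] _ \<phi>[OF M], of \<psi>] p[OF M] \<psi> M
    unfolding poly_approx_def by force
  then show "\<exists>p. \<forall>M\<in>S. (\<integral>t. (poly p t - \<phi> t)\<^sup>2 \<partial>M) < e" by blast
qed

lemma poly_approx_l2_limit:
  assumes "\<And>n. poly_approx S (F n)" and lim: "\<And>M. M \<in> S \<Longrightarrow> l2_tendsto M F \<phi>"
  shows "poly_approx S \<phi>"
proof (rule poly_approx_closed)
  show "sq_integrable M \<phi>" if "M \<in> S" for M using lim[OF that] by (simp add: l2_tendsto_def)
  fix e :: real assume e: "e > 0"
  have "\<forall>\<^sub>F n in sequentially. \<forall>M\<in>S. (\<integral>t. (F n t - \<phi> t)\<^sup>2 \<partial>M) < e"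
  proof (rule eventually_ball_finite[OF fin], rule ballI)
    fix M assume "M \<in> S"
    then have "(\<lambda>n. \<integral>t. (F n t - \<phi> t)\<^sup>2 \<partial>M) \<longlonglongrightarrow> 0" using lim by (simp add: l2_tendsto_def)
    then show "\<forall>\<^sub>F n in sequentially. (\<integral>t. (F n t - \<phi> t)\<^sup>2 \<partial>M) < e" using e by (rule order_tendstoD(2))
  qed
  then obtain n where "\<forall>M\<in>S. (\<integral>t. (F n t - \<phi> t)\<^sup>2 \<partial>M) < e"
    using eventually_happens'[OF sequentially_bot] by blast
  then show "\<exists>\<psi>. poly_approx S \<psi> \<and> (\<forall>M\<in>S. (\<integral>t. (\<psi> t - \<phi> t)\<^sup>2 \<partial>M) < e)"
    using assms(1) by blast
qed

lemma poly_approx_add: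
  assumes "poly_approx S f" "poly_approx S g"
  shows "poly_approx S (\<lambda>t. f t + g t)"
  unfolding poly_approx_def
proof (intro conjI ballI allI impI)
  show "sq_integrable M (\<lambda>t. f t + g t)" if "M \<in> S" for M
    using assms that by (auto simp: poly_approx_def intro: sq_integrable_add)
  fix e :: real assume "e > 0"
  then have e: "e / 4 > 0" by simp
  obtain p where p: "\<And>M. M \<in> S \<Longrightarrow> (\<integral>t. (poly p t - f t)\<^sup>2 \<partial>M) < e / 4"
    using assms(1) e unfolding poly_approx_def by blast
  obtain q where q: "\<And>M. M \<in> S \<Longrightarrow> (\<integral>t. (poly q t - g t)\<^sup>2 \<partial>M) < e / 4"
    using assms(2) e unfolding poly_approx_def by blast
  have "(\<integral>t. (poly (p + q) t - (f t + g t))\<^sup>2 \<partial>M) < e" if M: "M \<in> S" for M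
  proof -
    have f: "sq_integrable M f" "sq_integrable M g" using assms M by (auto simp: poly_approx_def)
    have "(\<integral>t. (poly (p + q) t - (f t + g t))\<^sup>2 \<partial>M) = (\<integral>t. ((poly p t - f t) - (g t - poly q t))\<^sup>2 \<partial>M)"
      by (simp add: algebra_simps)
    also have "\<dots> \<le> 2 * (\<integral>t. ((poly p t - f t) - 0)\<^sup>2 \<partial>M) + 2 * (\<integral>t. (0 - (g t - poly q t))\<^sup>2 \<partial>M)"
      using f sq_integrable_poly[OF M]
      by (intro l2_dist_triangle sq_integrable_diff) (auto simp: sq_integrable_def)
    also have "\<dots> < e"
      using p[OF M] q[OF M] by (simp add: power2_commute)
    finally show ?thesis .
  qed
  then show "\<exists>p. \<forall>M\<in>S. (\<integral>t. (poly p t - (f t + g t))\<^sup>2 \<partial>M) < e" by blast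
qed

lemma poly_approx_cmult:
  assumes "poly_approx S f"
  shows "poly_approx S (\<lambda>t. c * f t)"
proof (cases "c = 0")
  case True
  then show ?thesis
    unfolding poly_approx_def by (auto simp: sq_integrable_def intro!: exI[of _ 0])
next
  case False
  show ?thesis
    unfolding poly_approx_def
  proof (intro conjI ballI allI impI)
    show "sq_integrable M (\<lambda>t. c * f t)" if "M \<in> S" for M
      using assms that by (auto simp: poly_approx_def intro: sq_integrable_cmult)
    fix e :: real assume "e > 0"
    then have e: "e / c\<^sup>2 > 0" using False by simp
    obtain p where p: "\<And>M. M \<in> S \<Longrightarrow> (\<integral>t. (poly p t - f t)\<^sup>2 \<partial>M) < e / c\<^sup>2"
      using assms e unfolding poly_approx_def by blast
    have "(\<integral>t. (poly (smult c p) t - c * f t)\<^sup>2 \<partial>M) < e" if "M \<in> S" for M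
    proof -
      have "(\<lambda>t. (poly (smult c p) t - c * f t)\<^sup>2) = (\<lambda>t. c\<^sup>2 * (poly p t - f t)\<^sup>2)"
        by (simp add: power2_eq_square algebra_simps)
      then show ?thesis using p[OF that] False by (simp add: field_simps)
    qed
    then show "\<exists>p. \<forall>M\<in>S. (\<integral>t. (poly p t - c * f t)\<^sup>2 \<partial>M) < e" by blast
  qed
qed

text \<open>Weierstrass approximation on \<open>[0, 1]\<close> is uniform, hence simultaneous for finitely
  many finite measures.\<close>

lemma poly_approx_continuous:
  assumes f: "continuous_on UNIV f"
  shows "poly_approx S f"
  unfolding poly_approx_def
proof (intro conjI ballI allI impI)
  have f01: "continuous_on {0..1} f" using f by (rule continuous_on_subset) simp
  obtain B where "\<And>t. t \<in> {0..1} \<Longrightarrow> \<bar>f t\<bar> \<le> B" using bounded_on_unit[OF f01] by blast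
  then show sqf: "sq_integrable M f" if "M \<in> S" for M
    by (intro sq_integrable_bounded_unit that borel_measurable_continuous_onI f)
  fix e :: real assume e: "e > 0"
  define K where "K = (\<Sum>M\<in>S. measure M UNIV) + 1"
  have K: "measure M UNIV < K" if "M \<in> S" for M
    using member_le_sum[OF that, of "\<lambda>M. measure M UNIV"] fin by (simp add: K_def)
  have "K > 0" using sum_nonneg[of S "\<lambda>M. measure M UNIV"] by (simp add: K_def)
  define d where "d = sqrt (e / K)"
  have "d > 0" using e \<open>K > 0\<close> by (simp add: d_def)
  from Bernstein_Weierstrass[OF f01 this] obtain N where
    N: "\<And>t. t \<in> {0..1} \<Longrightarrow> \<bar>f t - (\<Sum>k\<le>N. f (real k / real N) * Bernstein N k t)\<bar> < d"
    by blast
  define p where "p = (\<Sum>k\<le>N. smult (f (real k / real N)) (bernstein_poly N k))"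
  have p: "\<bar>poly p t - f t\<bar> \<le> d" if "t \<in> {0..1}" for t
  proof -
    have "poly p t = (\<Sum>k\<le>N. f (real k / real N) * Bernstein N k t)"
      by (simp add: p_def poly_sum bernstein_poly_def Bernstein_def mult_ac)
    then show ?thesis using N[OF that] by linarith
  qed
  have "(\<integral>t. (poly p t - f t)\<^sup>2 \<partial>M) < e" if M: "M \<in> S" for M
  proof -
    interpret finite_measure M using unit[OF M] by (simp add: unit_interval_measure_def)
    have sp: "space M = UNIV" using unit[OF M] sets_eq_imp_space_eq[of M borel]
      by (simp add: unit_interval_measure_def)
    have "AE t in M. t \<in> {0..1}" using unit[OF M] by (simp add: unit_interval_measure_def)
    then have ae: "AE t in M. (poly p t - f t)\<^sup>2 \<le> d\<^sup>2"
    proof eventually_elim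
      case (elim t)
      show ?case using p[OF elim] by (rule power2_le_iff_abs_le[THEN iffD2, rotated]) (use \<open>d > 0\<close> in simp)
    qed
    have "(\<integral>t. (poly p t - f t)\<^sup>2 \<partial>M) \<le> (\<integral>t. d\<^sup>2 \<partial>M)"
      by (rule integral_mono_AE[OF sq_integrable_square[OF sq_integrable_diff[OF sq_integrable_poly[OF M] sqf[OF M]]] _ ae])
         simp
    also have "\<dots> = measure M UNIV * (e / K)"
      using e \<open>K > 0\<close> by (simp add: sp d_def)
    also have "\<dots> < K * (e / K)"
      using K[OF M] e \<open>K > 0\<close> by (intro mult_strict_right_mono) auto
    finally show ?thesis using \<open>K > 0\<close> by simp
  qed
  then show "\<exists>p. \<forall>M\<in>S. (\<integral>t. (poly p t - f t)\<^sup>2 \<partial>M) < e" by blast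
qed

lemma poly_approx_dominated:
  assumes "\<And>n. poly_approx S (F n)" "\<And>n. F n \<in> borel_measurable borel"
    and "\<phi> \<in> borel_measurable borel"
    and w: "\<And>M. M \<in> S \<Longrightarrow> sq_integrable M w"
    and bound: "\<And>n t. \<bar>F n t\<bar> \<le> \<bar>w t\<bar>" and lim: "\<And>t. (\<lambda>n. F n t) \<longlonglongrightarrow> \<phi> t"
  shows "poly_approx S \<phi>"
proof (rule poly_approx_l2_limit[OF assms(1)])
  fix M assume M: "M \<in> S"
  show "l2_tendsto M F \<phi>"
    by (rule l2_tendsto_dominated[OF unit_measurable[OF M assms(2)] unit_measurable[OF M assms(3)] w[OF M]
        bound lim])
qed

lemma sq_integrable_one: "M \<in> S \<Longrightarrow> sq_integrable M (\<lambda>_. 1)"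
  by (rule sq_integrable_bounded_unit[of _ _ 1]) auto

lemma poly_approx_atMost: "poly_approx S (indicator {..a})"
proof (rule poly_approx_dominated[where w="\<lambda>_. 1" and F="\<lambda>n t. max 0 (min 1 (1 - real n * (t - a)))"])
  show "poly_approx S (\<lambda>t. max 0 (min 1 (1 - real n * (t - a))))" for n
    by (intro poly_approx_continuous continuous_intros)
  show "(\<lambda>n. max 0 (min 1 (1 - real n * (t - a)))) \<longlonglongrightarrow> indicator {..a} t" for t
  proof (cases "t \<le> a")
    case True
    then have "real n * (t - a) \<le> 0" for n
      by (intro mult_nonneg_nonpos) auto
    then have "1 \<le> 1 - real n * (t - a)" for n by (simp only: le_diff_eq) simp
    then have "max 0 (min 1 (1 - real n * (t - a))) = 1" for n
      by (simp only: min_absorb1)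
    then show ?thesis using True by simp
  next
    case False
    then have "t - a > 0" by simp
    from filterlim_at_top_mult_tendsto_pos[OF tendsto_const this filterlim_real_sequentially]
    have "\<forall>\<^sub>F n in sequentially. real n * (t - a) > 1"
      by (simp only: filterlim_at_top_dense)
    then have "\<forall>\<^sub>F n in sequentially. max 0 (min 1 (1 - real n * (t - a))) = 0"
      by eventually_elim simp
    then show ?thesis using False by (simp add: tendsto_eventually)
  qed
qed (auto simp: sq_integrable_one)

text \<open>The approximable sets form a Dynkin system that contains the half-lines, which are
  limits of piecewise linear functions.\<close>

lemma poly_approx_indicator:
  assumes "B \<in> sets borel"
  shows "poly_approx S (indicator B)"
proof -
  have bor: "sigma_sets UNIV (range (\<lambda>a. {..a::real})) = sets borel"
    by (subst borel_eq_atMost) simp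
  have mem: "B \<in> sigma_sets UNIV (range (\<lambda>a. {..a::real}))"
    using assms by (simp only: bor)
  have stable: "Int_stable (range (\<lambda>a. {..a::real}))"
    by (auto simp: Int_stable_def)
  have sub: "range (\<lambda>a. {..a::real}) \<subseteq> Pow UNIV" by simp
  from stable sub mem show ?thesis
  proof (induction rule: sigma_sets_induct_disjoint)
    case (basic B)
    then show ?case using poly_approx_atMost by auto
  next
    case empty
    have "(indicator {} :: real \<Rightarrow> real) = (\<lambda>t. 0)" by auto
    then show ?case by (simp only:) (intro poly_approx_continuous continuous_intros)
  next
    case (compl B)
    have "(indicator (UNIV - B) :: real \<Rightarrow> real) = (\<lambda>t. 1 + (- 1) * indicator B t)"
      by (auto simp: indicator_def)
    moreover have "poly_approx S (\<lambda>t. 1 + (- 1) * indicator B t)"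
      by (intro poly_approx_add poly_approx_cmult compl poly_approx_continuous continuous_intros)
    ultimately show ?case by simp
  next
    case (union B)
    then have [measurable]: "\<And>i. B i \<in> sets borel" using bor by blast
    show ?case
    proof (rule poly_approx_dominated[where w="\<lambda>_. 1" and F="\<lambda>n t. \<Sum>i<n. indicator (B i) t"])
      show "poly_approx S (\<lambda>t. \<Sum>i<n. indicator (B i) t)" for n
      proof (induction n)
        case 0
        show ?case by (simp, intro poly_approx_continuous continuous_intros)
      next
        case (Suc n)
        show ?case using poly_approx_add[OF Suc union(3)[of n]] by simp
      qed
      have e: "(\<Sum>i<n. indicator (B i) t) = (indicator (\<Union>i<n. B i) t :: real)" for n t
        using union(1) by (intro indicator_UN_disjoint[symmetric]) (auto simp: disjoint_family_on_def)
      show "\<bar>\<Sum>i<n. indicator (B i) t\<bar> \<le> \<bar>1 :: real\<bar>" for n and t :: real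
        unfolding e by simp
      show "(\<lambda>n. \<Sum>i<n. indicator (B i) t) \<longlonglongrightarrow> (indicator (\<Union>i. B i) t :: real)" for t
        unfolding e by (rule LIMSEQ_indicator_UN)
    qed (auto simp: sq_integrable_one)
  qed
qed

lemma poly_approx_nonneg:
  assumes "\<phi> \<in> borel_measurable borel" "\<And>t. 0 \<le> \<phi> t"
  shows "(\<And>M. M \<in> S \<Longrightarrow> sq_integrable M \<phi>) \<Longrightarrow> poly_approx S \<phi>"
  using assms
proof (induction rule: borel_measurable_induct_real)
  case (set A)
  then show ?case by (intro poly_approx_indicator) simp
next
  case (mult u c)
  show ?case
  proof (cases "c = 0")
    case True
    then show ?thesis by (simp, intro poly_approx_continuous continuous_intros)
  next
    case False
    have "sq_integrable M u" if "M \<in> S" for M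
      using sq_integrable_cmult[OF mult.prems(1)[OF that], of "1 / c"] False by simp
    then show ?thesis by (rule poly_approx_cmult[OF mult.IH])
  qed
next
  case (add u v)
  have u: "sq_integrable M u" if M: "M \<in> S" for M
    by (rule sq_integrable_bound[OF add.prems(1)[OF M] unit_measurable[OF M add.hyps(1)]])
       (simp add: add.hyps)
  have v: "sq_integrable M v" if M: "M \<in> S" for M
    by (rule sq_integrable_bound[OF add.prems(1)[OF M] unit_measurable[OF M add.hyps(3)]])
       (simp add: add.hyps)
  show ?case by (rule poly_approx_add[OF add.IH(2)[OF v] add.IH(1)[OF u]])
next
  case (seq U)
  have le: "U i t \<le> \<phi> t" for i t
  proof (rule incseq_le)
    show "incseq (\<lambda>i. U i t)" using seq.hyps(3) by (simp add: mono_def le_fun_def)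
    show "(\<lambda>i. U i t) \<longlonglongrightarrow> \<phi> t" using seq.hyps(4)[of t] by simp
  qed
  have bound: "\<bar>U n t\<bar> \<le> \<bar>\<phi> t\<bar>" for n t
    using le[of n t] seq.hyps(2)[of n t] by linarith
  have "sq_integrable M (U i)" if M: "M \<in> S" for M i
    by (rule sq_integrable_bound[OF seq.prems(1)[OF M] unit_measurable[OF M seq.hyps(1)]]) (simp add: bound)
  then have "poly_approx S (U i)" for i by (rule seq.IH)
  then show ?case
    using seq.hyps(1) assms(1) seq.prems bound
  proof (rule poly_approx_dominated[where w=\<phi>])
    show "(\<lambda>n. U n t) \<longlonglongrightarrow> \<phi> t" for t using seq.hyps(4)[of t] by simp
  qed
qed

text \<open>Nonnegative functions are monotone limits of combinations of indicators, and a general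
  function is a difference of nonnegative ones.\<close>

theorem polynomials_l2_dense:
  assumes "\<phi> \<in> borel_measurable borel" "\<And>M. M \<in> S \<Longrightarrow> sq_integrable M \<phi>"
  shows "\<exists>P. \<forall>M\<in>S. l2_tendsto M (\<lambda>n. poly (P n)) \<phi>"
proof -
  have [measurable]: "\<phi> \<in> borel_measurable borel" by (rule assms(1))
  have pos: "sq_integrable M (\<lambda>t. max 0 (\<phi> t))" "sq_integrable M (\<lambda>t. max 0 (- \<phi> t))" if M: "M \<in> S" for M
    by (rule sq_integrable_bound[OF assms(2)[OF M] unit_measurable[OF M]]; simp)+
  have "poly_approx S (\<lambda>t. max 0 (\<phi> t))"
    using pos by (intro poly_approx_nonneg) auto
  moreover have "poly_approx S (\<lambda>t. max 0 (- \<phi> t))"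
    using pos by (intro poly_approx_nonneg) auto
  ultimately have "poly_approx S (\<lambda>t. max 0 (\<phi> t) + (- 1) * max 0 (- \<phi> t))"
    by (intro poly_approx_add poly_approx_cmult)
  also have "(\<lambda>t. max 0 (\<phi> t) + (- 1) * max 0 (- \<phi> t)) = \<phi>" by auto
  finally have "\<forall>n. \<exists>p. \<forall>M\<in>S. (\<integral>t. (poly p t - \<phi> t)\<^sup>2 \<partial>M) < inverse (real (Suc n))"
    by (simp add: poly_approx_def)
  then obtain P where P: "\<And>n M. M \<in> S \<Longrightarrow> (\<integral>t. (poly (P n) t - \<phi> t)\<^sup>2 \<partial>M) < inverse (real (Suc n))"
    by metis
  have "l2_tendsto M (\<lambda>n. poly (P n)) \<phi>" if M: "M \<in> S" for M
    unfolding l2_tendsto_def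
  proof (intro conjI allI sq_integrable_poly M assms(2))
    show "(\<lambda>n. \<integral>t. (poly (P n) t - \<phi> t)\<^sup>2 \<partial>M) \<longlonglongrightarrow> 0"
      by (rule Lim_null_comparison[OF _ LIMSEQ_inverse_real_of_nat])
         (use P[OF M] in \<open>auto intro!: always_eventually less_imp_le\<close>)
  qed
  then show ?thesis by blast
qed

end

section \<open>Functional calculus of a positive contraction\<close>

context positive_contraction
begin

abbreviation in_l2 :: "'a \<Rightarrow> (real \<Rightarrow> real) \<Rightarrow> bool" where
  "in_l2 x \<equiv> sq_integrable (moment_measure x)"

text \<open>The vector \<open>\<phi>(A) x\<close>: the common limit of \<open>p\<^sub>n(A) x\<close> over all sequences of polynomials that
  converge to \<open>\<phi>\<close> in the mean.\<close>

definition fcalc :: "(real \<Rightarrow> real) \<Rightarrow> 'a \<Rightarrow> 'a" where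
  "fcalc \<phi> x = (THE y. \<forall>P. l2_tendsto (moment_measure x) (\<lambda>n. poly (P n)) \<phi>
      \<longrightarrow> (\<lambda>n. peval (P n) x) \<longlonglongrightarrow> y)"

lemma unit_interval_moment_measure: "unit_interval_measure (moment_measure x)"
  by (simp add: unit_interval_measure_def finite_moment_measure AE_moment_measure del: atLeastAtMost_iff)

lemma in_l2_measurable: "in_l2 x \<phi> \<Longrightarrow> \<phi> \<in> borel_measurable borel"
  by (auto dest: sq_integrable_measurable)

lemma in_l2_bounded:
  assumes "\<phi> \<in> borel_measurable borel" "\<And>t. t \<in> {0..1} \<Longrightarrow> \<bar>\<phi> t\<bar> \<le> B"
  shows "in_l2 x \<phi>"
  by (rule sq_integrable_bounded_unit[of "{moment_measure x}" _ _ B])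
     (use assms unit_interval_moment_measure in auto)

lemma in_l2_poly: "in_l2 x (poly p)"
  by (rule sq_integrable_poly[of "{moment_measure x}"]) (use unit_interval_moment_measure in auto)

lemma poly_approximation:
  assumes "\<phi> \<in> borel_measurable borel" "finite S" "\<And>M. M \<in> S \<Longrightarrow> unit_interval_measure M"
    and "\<And>M. M \<in> S \<Longrightarrow> sq_integrable M \<phi>"
  obtains P where "\<And>M. M \<in> S \<Longrightarrow> l2_tendsto M (\<lambda>n. poly (P n)) \<phi>"
  using polynomials_l2_dense[OF assms(2,3,1,4)] by blast

lemma poly_approximation_at:
  assumes "in_l2 x \<phi>" "in_l2 y \<phi>" "in_l2 z \<phi>"
  obtains P where "l2_tendsto (moment_measure x) (\<lambda>n. poly (P n)) \<phi>"
    "l2_tendsto (moment_measure y) (\<lambda>n. poly (P n)) \<phi>"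
    "l2_tendsto (moment_measure z) (\<lambda>n. poly (P n)) \<phi>"
proof -
  obtain P where "\<And>M. M \<in> {moment_measure x, moment_measure y, moment_measure z}
      \<Longrightarrow> l2_tendsto M (\<lambda>n. poly (P n)) \<phi>"
    by (rule poly_approximation[of \<phi> "{moment_measure x, moment_measure y, moment_measure z}"])
       (use in_l2_measurable[OF assms(1)] assms unit_interval_moment_measure in auto)
  then show thesis using that by auto
qed

lemma norm_peval: "(norm (peval p x))\<^sup>2 = (\<integral>t. (poly p t)\<^sup>2 \<partial>moment_measure x)"
proof -
  have "(norm (peval p x))\<^sup>2 = inner (peval (p * p) x) x"
    by (simp add: peval_mult symmetric_peval power2_norm_eq_inner)
  also have "\<dots> = (\<integral>t. poly (p * p) t \<partial>moment_measure x)"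
    by (rule integral_poly_moment_measure[symmetric])
  finally show ?thesis by (simp add: power2_eq_square)
qed

text \<open>The map \<open>p \<mapsto> p(A) x\<close> is an isometry for the mean square distance, so that it
  extends from polynomials to all square integrable functions.\<close>

lemma norm_peval_diff:
  "(norm (peval p x - peval q x))\<^sup>2 = (\<integral>t. (poly p t - poly q t)\<^sup>2 \<partial>moment_measure x)"
  using norm_peval[of "p - q" x] by (simp add: peval_diff)

lemma norm_peval_diff_le:
  assumes "in_l2 x \<phi>"
  shows "(norm (peval p x - peval q x))\<^sup>2 \<le> 2 * (\<integral>t. (poly p t - \<phi> t)\<^sup>2 \<partial>moment_measure x)
      + 2 * (\<integral>t. (poly q t - \<phi> t)\<^sup>2 \<partial>moment_measure x)"
  using l2_dist_triangle[OF in_l2_poly[of x p] assms in_l2_poly[of x q]]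
  by (simp add: norm_peval_diff power2_commute[of "\<phi> _"])

lemma convergent_peval:
  assumes P: "l2_tendsto (moment_measure x) (\<lambda>n. poly (P n)) \<phi>"
  shows "convergent (\<lambda>n. peval (P n) x)"
proof (rule Cauchy_convergent, rule metric_CauchyI)
  fix e :: real assume e: "e > 0"
  have \<phi>: "in_l2 x \<phi>" and lim: "(\<lambda>n. \<integral>t. (poly (P n) t - \<phi> t)\<^sup>2 \<partial>moment_measure x) \<longlonglongrightarrow> 0"
    using P by (auto simp: l2_tendsto_def)
  have "e\<^sup>2 / 4 > 0" using e by simp
  from order_tendstoD(2)[OF lim this] obtain N where
    N: "\<And>n. n \<ge> N \<Longrightarrow> (\<integral>t. (poly (P n) t - \<phi> t)\<^sup>2 \<partial>moment_measure x) < e\<^sup>2 / 4"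
    by (auto simp: eventually_sequentially)
  have "dist (peval (P m) x) (peval (P n) x) < e" if "m \<ge> N" "n \<ge> N" for m n
  proof -
    have "(norm (peval (P m) x - peval (P n) x))\<^sup>2 < e\<^sup>2"
      using norm_peval_diff_le[OF \<phi>, of "P m" "P n"] N[OF that(1)] N[OF that(2)] by linarith
    then show ?thesis using e by (simp add: dist_norm power2_less_imp_less)
  qed
  then show "\<exists>N. \<forall>m\<ge>N. \<forall>n\<ge>N. dist (peval (P m) x) (peval (P n) x) < e" by blast
qed

lemma fcalc_tendsto:
  assumes P: "l2_tendsto (moment_measure x) (\<lambda>n. poly (P n)) \<phi>"
  shows "(\<lambda>n. peval (P n) x) \<longlonglongrightarrow> fcalc \<phi> x"
proof -
  obtain y where y: "(\<lambda>n. peval (P n) x) \<longlonglongrightarrow> y"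
    using convergent_peval[OF P] by (auto simp: convergent_def)
  have unique: "(\<lambda>n. peval (P' n) x) \<longlonglongrightarrow> y"
    if P': "l2_tendsto (moment_measure x) (\<lambda>n. poly (P' n)) \<phi>" for P'
  proof -
    let ?e = "\<lambda>P n. \<integral>t. (poly (P n) t - \<phi> t)\<^sup>2 \<partial>moment_measure x"
    have \<phi>: "in_l2 x \<phi>" and lim: "?e P \<longlonglongrightarrow> 0" "?e P' \<longlonglongrightarrow> 0"
      using P P' by (auto simp: l2_tendsto_def)
    have "(\<lambda>n. (norm (peval (P' n) x - peval (P n) x))\<^sup>2) \<longlonglongrightarrow> 0"
    proof (rule Lim_null_comparison)
      show "\<forall>\<^sub>F n in sequentially. norm ((norm (peval (P' n) x - peval (P n) x))\<^sup>2) \<le> 2 * ?e P' n + 2 * ?e P n"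
        using norm_peval_diff_le[OF \<phi>] by (intro always_eventually allI) simp
      show "(\<lambda>n. 2 * ?e P' n + 2 * ?e P n) \<longlonglongrightarrow> 0"
        using tendsto_add[OF tendsto_mult_left[OF lim(2), of 2] tendsto_mult_left[OF lim(1), of 2]] by simp
    qed
    then have "(\<lambda>n. peval (P' n) x - peval (P n) x) \<longlonglongrightarrow> 0"
      using tendsto_real_sqrt[of "\<lambda>n. (norm (peval (P' n) x - peval (P n) x))\<^sup>2" 0] by (simp add: tendsto_norm_zero_iff)
    from tendsto_add[OF this y] show ?thesis by simp
  qed
  have "fcalc \<phi> x = y"
    unfolding fcalc_def
  proof (rule the_equality)
    fix z assume "\<forall>P. l2_tendsto (moment_measure x) (\<lambda>n. poly (P n)) \<phi> \<longrightarrow> (\<lambda>n. peval (P n) x) \<longlonglongrightarrow> z"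
    then show "z = y" using P y LIMSEQ_unique by blast
  qed (use unique in blast)
  then show ?thesis using y by simp
qed

lemma fcalc_approximation:
  assumes "in_l2 x \<phi>"
  obtains P where "l2_tendsto (moment_measure x) (\<lambda>n. poly (P n)) \<phi>" "(\<lambda>n. peval (P n) x) \<longlonglongrightarrow> fcalc \<phi> x"
  using poly_approximation_at[OF assms assms assms] fcalc_tendsto by metis

lemma fcalc_poly: "fcalc (poly p) x = peval p x"
proof -
  have "l2_tendsto (moment_measure x) (\<lambda>n. poly p) (poly p)"
    by (simp add: l2_tendsto_def in_l2_poly)
  from fcalc_tendsto[OF this] show ?thesis by (simp add: LIMSEQ_const_iff)
qed

lemma fcalc_cong_AE:
  assumes "in_l2 x \<phi>" "in_l2 x \<psi>" "AE t in moment_measure x. \<phi> t = \<psi> t"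
  shows "fcalc \<phi> x = fcalc \<psi> x"
proof -
  obtain P where P: "l2_tendsto (moment_measure x) (\<lambda>n. poly (P n)) \<phi>" "(\<lambda>n. peval (P n) x) \<longlonglongrightarrow> fcalc \<phi> x"
    using fcalc_approximation[OF assms(1)] .
  have m: "\<phi> \<in> borel_measurable (moment_measure x)" "\<psi> \<in> borel_measurable (moment_measure x)"
    "poly p \<in> borel_measurable (moment_measure x)" for p
    using sq_integrable_measurable assms(1,2) in_l2_poly by blast+
  have "(\<integral>t. (poly (P n) t - \<phi> t)\<^sup>2 \<partial>moment_measure x) = (\<integral>t. (poly (P n) t - \<psi> t)\<^sup>2 \<partial>moment_measure x)" for n
    using assms(3) m by (intro integral_cong_AE) auto
  then have "l2_tendsto (moment_measure x) (\<lambda>n. poly (P n)) \<psi>"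
    using P(1) assms(2) by (simp add: l2_tendsto_def)
  from fcalc_tendsto[OF this] show ?thesis using P(2) LIMSEQ_unique by blast
qed

lemma fcalc_add:
  assumes "in_l2 x \<phi>" "in_l2 x \<psi>"
  shows "fcalc (\<lambda>t. \<phi> t + \<psi> t) x = fcalc \<phi> x + fcalc \<psi> x"
proof -
  obtain P Q where P: "l2_tendsto (moment_measure x) (\<lambda>n. poly (P n)) \<phi>" "(\<lambda>n. peval (P n) x) \<longlonglongrightarrow> fcalc \<phi> x"
    and Q: "l2_tendsto (moment_measure x) (\<lambda>n. poly (Q n)) \<psi>" "(\<lambda>n. peval (Q n) x) \<longlonglongrightarrow> fcalc \<psi> x"
    using assms by (metis fcalc_approximation)
  have "l2_tendsto (moment_measure x) (\<lambda>n. poly (P n + Q n)) (\<lambda>t. \<phi> t + \<psi> t)"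
    using l2_tendsto_add[OF P(1) Q(1)] by (simp add: fun_eq_iff[symmetric] poly_add[abs_def])
  from fcalc_tendsto[OF this] have "(\<lambda>n. peval (P n) x + peval (Q n) x) \<longlonglongrightarrow> fcalc (\<lambda>t. \<phi> t + \<psi> t) x"
    by (simp add: peval_add)
  then show ?thesis using tendsto_add[OF P(2) Q(2)] by (rule LIMSEQ_unique)
qed

lemma fcalc_cmult:
  assumes "in_l2 x \<phi>"
  shows "fcalc (\<lambda>t. c * \<phi> t) x = c *\<^sub>R fcalc \<phi> x"
proof -
  obtain P where P: "l2_tendsto (moment_measure x) (\<lambda>n. poly (P n)) \<phi>" "(\<lambda>n. peval (P n) x) \<longlonglongrightarrow> fcalc \<phi> x"
    using assms by (metis fcalc_approximation)
  have "l2_tendsto (moment_measure x) (\<lambda>n. poly (smult c (P n))) (\<lambda>t. c * \<phi> t)"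
    using l2_tendsto_cmult[OF P(1)] by (simp add: poly_smult[abs_def])
  from fcalc_tendsto[OF this] have "(\<lambda>n. c *\<^sub>R peval (P n) x) \<longlonglongrightarrow> fcalc (\<lambda>t. c * \<phi> t) x"
    by (simp add: peval_smult)
  then show ?thesis using tendsto_scaleR[OF tendsto_const P(2)] by (rule LIMSEQ_unique)
qed

lemma fcalc_diff:
  assumes "in_l2 x \<phi>" "in_l2 x \<psi>"
  shows "fcalc (\<lambda>t. \<phi> t - \<psi> t) x = fcalc \<phi> x - fcalc \<psi> x"
  using fcalc_add[OF assms(1) sq_integrable_cmult[OF assms(2), of "-1"]] fcalc_cmult[OF assms(2), of "-1"]
  by simp

lemma norm_fcalc:
  assumes "in_l2 x \<phi>"
  shows "(norm (fcalc \<phi> x))\<^sup>2 = (\<integral>t. (\<phi> t)\<^sup>2 \<partial>moment_measure x)"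
proof -
  obtain P where P: "l2_tendsto (moment_measure x) (\<lambda>n. poly (P n)) \<phi>" "(\<lambda>n. peval (P n) x) \<longlonglongrightarrow> fcalc \<phi> x"
    using assms by (metis fcalc_approximation)
  have "(\<lambda>n. (norm (peval (P n) x))\<^sup>2) \<longlonglongrightarrow> (norm (fcalc \<phi> x))\<^sup>2"
    by (intro tendsto_intros P)
  then show ?thesis
    using l2_tendsto_integral_square[OF P(1)] LIMSEQ_unique unfolding norm_peval by blast
qed

lemma inner_fcalc_self:
  assumes "in_l2 x \<phi>"
  shows "inner (fcalc \<phi> x) x = (\<integral>t. \<phi> t \<partial>moment_measure x)"
proof -
  obtain P where P: "l2_tendsto (moment_measure x) (\<lambda>n. poly (P n)) \<phi>" "(\<lambda>n. peval (P n) x) \<longlonglongrightarrow> fcalc \<phi> x"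
    using assms by (metis fcalc_approximation)
  have "(\<lambda>n. inner (peval (P n) x) x) \<longlonglongrightarrow> inner (fcalc \<phi> x) x"
    by (intro tendsto_intros P)
  moreover have "in_l2 x (\<lambda>_. 1)" by (rule in_l2_bounded[of _ 1]) auto
  from l2_tendsto_integral_mult[OF P(1) this]
  have "(\<lambda>n. inner (peval (P n) x) x) \<longlonglongrightarrow> (\<integral>t. \<phi> t \<partial>moment_measure x)"
    by (simp add: integral_poly_moment_measure)
  ultimately show ?thesis by (rule LIMSEQ_unique)
qed

text \<open>Here and in \<open>fcalc_add_vec\<close> the identity passes from polynomials to \<open>\<phi>\<close> along one sequence that
  approximates \<open>\<phi>\<close> for all the vectors that occur.\<close>

lemma fcalc_symmetric:
  assumes "in_l2 x \<phi>" "in_l2 y \<phi>"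
  shows "inner (fcalc \<phi> x) y = inner x (fcalc \<phi> y)"
proof -
  obtain P where P: "l2_tendsto (moment_measure x) (\<lambda>n. poly (P n)) \<phi>"
    "l2_tendsto (moment_measure y) (\<lambda>n. poly (P n)) \<phi>"
    using poly_approximation_at[OF assms assms(2)] .
  have "(\<lambda>n. inner (peval (P n) x) y) \<longlonglongrightarrow> inner (fcalc \<phi> x) y"
    by (intro tendsto_intros fcalc_tendsto P)
  moreover have "(\<lambda>n. inner (peval (P n) x) y) \<longlonglongrightarrow> inner x (fcalc \<phi> y)"
    unfolding symmetric_peval by (intro tendsto_intros fcalc_tendsto P)
  ultimately show ?thesis by (rule LIMSEQ_unique)
qed

lemma fcalc_l2_continuous:
  assumes F: "l2_tendsto (moment_measure x) F \<phi>"
  shows "(\<lambda>n. fcalc (F n) x) \<longlonglongrightarrow> fcalc \<phi> x"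
proof -
  have sq: "in_l2 x (F n)" "in_l2 x \<phi>" for n using F by (auto simp: l2_tendsto_def)
  have "(norm (fcalc (F n) x - fcalc \<phi> x))\<^sup>2 = (\<integral>t. (F n t - \<phi> t)\<^sup>2 \<partial>moment_measure x)" for n
    using norm_fcalc[OF sq_integrable_diff[OF sq]] by (simp add: fcalc_diff sq)
  then have "(\<lambda>n. (norm (fcalc (F n) x - fcalc \<phi> x))\<^sup>2) \<longlonglongrightarrow> 0"
    using F by (simp add: l2_tendsto_def)
  then have "(\<lambda>n. fcalc (F n) x - fcalc \<phi> x) \<longlonglongrightarrow> 0"
    using tendsto_real_sqrt[of "\<lambda>n. (norm (fcalc (F n) x - fcalc \<phi> x))\<^sup>2" 0] by (simp add: tendsto_norm_zero_iff)
  then show ?thesis by (rule LIM_zero_cancel)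
qed

section \<open>Truncation and the domain\<close>

definition trunc :: "(real \<Rightarrow> real) \<Rightarrow> nat \<Rightarrow> real \<Rightarrow> real" where
  "trunc \<phi> k t = (if \<bar>\<phi> t\<bar> \<le> real k then \<phi> t else 0)"

lemma trunc_bound: "\<bar>trunc \<phi> k t\<bar> \<le> real k"
  by (simp add: trunc_def)

lemma trunc_le: "\<bar>trunc \<phi> k t\<bar> \<le> \<bar>\<phi> t\<bar>"
  by (simp add: trunc_def)

lemma trunc_measurable [measurable (raw)]:
  assumes [measurable]: "\<phi> \<in> borel_measurable borel"
  shows "trunc \<phi> k \<in> borel_measurable borel"
  unfolding trunc_def[abs_def] by measurable

lemma eventually_trunc: "\<forall>\<^sub>F k in sequentially. \<bar>\<phi> t\<bar> \<le> real k"
proof -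
  obtain N where "\<bar>\<phi> t\<bar> \<le> real N" using real_arch_simple by blast
  then show ?thesis by (intro eventually_sequentiallyI[of N]) simp
qed

lemma trunc_tendsto: "(\<lambda>k. trunc \<phi> k t) \<longlonglongrightarrow> \<phi> t"
  using eventually_trunc[of \<phi> t] by (rule tendsto_eventually[OF eventually_mono]) (simp add: trunc_def)

lemma in_l2_trunc:
  assumes "\<phi> \<in> borel_measurable borel"
  shows "in_l2 x (trunc \<phi> k)"
  by (rule in_l2_bounded[of _ "real k"]) (use assms trunc_bound in auto)

lemma fcalc_trunc_tendsto:
  assumes "in_l2 x \<phi>"
  shows "(\<lambda>k. fcalc (trunc \<phi> k) x) \<longlonglongrightarrow> fcalc \<phi> x"
proof (rule fcalc_l2_continuous, rule l2_tendsto_dominated[where w=\<phi>])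
  show "trunc \<phi> n \<in> borel_measurable (moment_measure x)" for n
    using trunc_measurable[OF in_l2_measurable[OF assms]] by simp
  show "\<phi> \<in> borel_measurable (moment_measure x)" using assms by (rule sq_integrable_measurable)
qed (auto simp: trunc_le trunc_tendsto assms)

text \<open>By monotone convergence, a vector on which the truncations of \<open>\<phi>\<close> stay bounded belongs to the domain of
  \<open>\<phi>(A)\<close>; the converse is \<open>norm_fcalc_trunc_le\<close>. Statements on unbounded functions reduce to bounded
  ones in this way.\<close>

lemma in_l2I_trunc_bounded:
  assumes \<phi>: "\<phi> \<in> borel_measurable borel" and K: "\<And>k. norm (fcalc (trunc \<phi> k) x) \<le> K"
  shows "in_l2 x \<phi>"
  unfolding sq_integrable_def
proof
  show m: "\<phi> \<in> borel_measurable (moment_measure x)" using \<phi> by simp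
  let ?a = "\<lambda>k. \<integral>t. (trunc \<phi> k t)\<^sup>2 \<partial>moment_measure x"
  have int: "integrable (moment_measure x) (\<lambda>t. (trunc \<phi> k t)\<^sup>2)" for k
    by (rule sq_integrable_square[OF in_l2_trunc[OF \<phi>]])
  have mono: "(trunc \<phi> k t)\<^sup>2 \<le> (trunc \<phi> l t)\<^sup>2" if "k \<le> l" for k l t
    using that by (auto simp: trunc_def)
  have le: "?a k \<le> K\<^sup>2" for k
    unfolding norm_fcalc[OF in_l2_trunc[OF \<phi>], symmetric] using K by (intro power_mono) auto
  have "incseq ?a"
    unfolding incseq_def using mono int by (auto intro!: integral_mono)
  then obtain L where L: "?a \<longlonglongrightarrow> L"
    using incseq_convergent[of ?a "K\<^sup>2"] le by blast
  show "integrable (moment_measure x) (\<lambda>t. (\<phi> t)\<^sup>2)"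
  proof (rule integral_monotone_convergence_nonneg(1)[OF int _ _ _ L])
    show "AE t in moment_measure x. mono (\<lambda>n. (trunc \<phi> n t)\<^sup>2)"
      using mono by (auto simp: mono_def)
    show "AE t in moment_measure x. (\<lambda>i. (trunc \<phi> i t)\<^sup>2) \<longlonglongrightarrow> (\<phi> t)\<^sup>2"
      by (intro AE_I2 tendsto_intros trunc_tendsto)
    show "(\<lambda>t. (\<phi> t)\<^sup>2) \<in> borel_measurable (moment_measure x)" using m by simp
  qed auto
qed

lemma norm_fcalc_trunc_le:
  assumes "in_l2 z \<phi>"
  shows "norm (fcalc (trunc \<phi> k) z) \<le> norm (fcalc \<phi> z)"
proof (rule power2_le_imp_le)
  have m: "\<phi> \<in> borel_measurable borel" using assms by (rule in_l2_measurable)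
  show "(norm (fcalc (trunc \<phi> k) z))\<^sup>2 \<le> (norm (fcalc \<phi> z))\<^sup>2"
    unfolding norm_fcalc[OF in_l2_trunc[OF m]] norm_fcalc[OF assms]
    using assms trunc_le[of \<phi>]
    by (intro integral_mono sq_integrable_square in_l2_trunc m) (auto simp: abs_le_square_iff)
qed simp

text \<open>The domain is closed under addition because the truncations of \<open>\<phi>\<close>, for which additivity is
  already known, stay bounded on \<open>x + y\<close>.\<close>

lemma fcalc_add_vec:
  assumes x: "in_l2 x \<phi>" and y: "in_l2 y \<phi>"
  shows "fcalc \<phi> (x + y) = fcalc \<phi> x + fcalc \<phi> y" and "in_l2 (x + y) \<phi>"
proof -
  have add: "fcalc \<psi> (x + y) = fcalc \<psi> x + fcalc \<psi> y"
    if \<psi>: "in_l2 x \<psi>" "in_l2 y \<psi>" "in_l2 (x + y) \<psi>" for \<psi>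
  proof -
    obtain P where P: "l2_tendsto (moment_measure x) (\<lambda>n. poly (P n)) \<psi>"
      "l2_tendsto (moment_measure y) (\<lambda>n. poly (P n)) \<psi>"
      "l2_tendsto (moment_measure (x + y)) (\<lambda>n. poly (P n)) \<psi>"
      using poly_approximation_at[OF \<psi>] .
    have "(\<lambda>n. peval (P n) (x + y)) \<longlonglongrightarrow> fcalc \<psi> x + fcalc \<psi> y"
      unfolding linear_add[OF linear_peval] by (intro tendsto_intros fcalc_tendsto P)
    then show ?thesis using fcalc_tendsto[OF P(3)] LIMSEQ_unique by blast
  qed
  have m: "\<phi> \<in> borel_measurable borel" using x by (rule in_l2_measurable)
  show xy: "in_l2 (x + y) \<phi>"
  proof (rule in_l2I_trunc_bounded[OF m])
    show "norm (fcalc (trunc \<phi> k) (x + y)) \<le> norm (fcalc \<phi> x) + norm (fcalc \<phi> y)" for k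
      unfolding add[OF in_l2_trunc[OF m] in_l2_trunc[OF m] in_l2_trunc[OF m]]
      by (rule order_trans[OF norm_triangle_ineq add_mono[OF norm_fcalc_trunc_le[OF x] norm_fcalc_trunc_le[OF y]]])
  qed
  show "fcalc \<phi> (x + y) = fcalc \<phi> x + fcalc \<phi> y" by (rule add[OF x y xy])
qed

lemma peval_intertwining:
  assumes V: "linear V" and s: "\<And>x. A (V x) = V (peval s x)"
  shows "peval p (V x) = V (peval (pcompose p s) x)"
proof (induction p)
  case 0
  then show ?case by (simp add: linear_0[OF V])
next
  case (pCons c p)
  then show ?case
    by (simp add: pcompose_pCons peval_add peval_mult s linear_add[OF V] linear_scale[OF V])
qed

text \<open>An operator that intertwines \<open>s(A)\<close> with \<open>A\<close> intertwines \<open>(\<phi> \<circ> s)(A)\<close> with \<open>\<phi>(A)\<close>. This is used for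
  complex scalars (\<open>s(t) = t\<close>) and for the fundamental symmetry (\<open>s(t) = 1 - t\<close>). The approximating
  polynomials are chosen for the measure of \<open>V x\<close> and the image of the measure of \<open>x\<close> under \<open>s\<close>.\<close>

lemma fcalc_intertwining:
  assumes V: "bounded_linear V" and s: "\<And>x. A (V x) = V (peval s x)"
    and s01: "\<And>t. t \<in> {0..1} \<Longrightarrow> poly s t \<in> {0..1}"
    and m: "\<phi> \<in> borel_measurable borel" and x: "in_l2 x (\<lambda>t. \<phi> (poly s t))"
  shows "fcalc \<phi> (V x) = V (fcalc (\<lambda>t. \<phi> (poly s t)) x)" and "in_l2 (V x) \<phi>"
proof -
  have s_meas [measurable]: "poly s \<in> borel_measurable borel"
    by (intro borel_measurable_continuous_onI continuous_intros)
  have p_meas: "poly p \<in> borel_measurable borel" for p :: "real poly"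
    by (intro borel_measurable_continuous_onI continuous_intros)
  have lin: "linear V" using V by (rule bounded_linear.linear)
  let ?D = "distr (moment_measure x) borel (poly s)"
  have D: "unit_interval_measure ?D"
    unfolding unit_interval_measure_def
  proof (intro conjI)
    show "finite_measure ?D"
      by (intro finite_measure.finite_measure_distr finite_moment_measure) simp
    show "AE t in ?D. t \<in> {0..1}"
    proof (subst AE_distr_iff)
      show "AE t in moment_measure x. poly s t \<in> {0..1}"
        using AE_moment_measure[of x] by eventually_elim (rule s01)
    qed auto
  qed simp
  have commute: "fcalc \<psi> (V x) = V (fcalc (\<lambda>t. \<psi> (poly s t)) x)"
    if \<psi> [measurable]: "\<psi> \<in> borel_measurable borel"
      and \<psi>2: "in_l2 (V x) \<psi>" "in_l2 x (\<lambda>t. \<psi> (poly s t))" for \<psi>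
  proof -
    have "sq_integrable ?D \<psi>"
      using \<psi>2(2) by (simp add: sq_integrable_def integrable_distr_eq)
    then have sq: "sq_integrable M \<psi>" if "M \<in> {moment_measure (V x), ?D}" for M
      using that \<psi>2(1) by blast
    have unit: "unit_interval_measure M" if "M \<in> {moment_measure (V x), ?D}" for M
      using that D unit_interval_moment_measure by blast
    have "\<exists>P. \<forall>M\<in>{moment_measure (V x), ?D}. l2_tendsto M (\<lambda>n. poly (P n)) \<psi>"
      by (rule polynomials_l2_dense[OF _ unit \<psi> sq]) simp_all
    then obtain P where P: "l2_tendsto (moment_measure (V x)) (\<lambda>n. poly (P n)) \<psi>"
      "l2_tendsto ?D (\<lambda>n. poly (P n)) \<psi>"
      by auto
    have "l2_tendsto (moment_measure x) (\<lambda>n t. poly (P n) (poly s t)) (\<lambda>t. \<psi> (poly s t))"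
      by (rule l2_tendsto_distr[OF P(2) _ p_meas \<psi>]) simp
    then have "l2_tendsto (moment_measure x) (\<lambda>n. poly (pcompose (P n) s)) (\<lambda>t. \<psi> (poly s t))"
      by (simp add: poly_pcompose[abs_def] fun_eq_iff[symmetric])
    then have "(\<lambda>n. V (peval (pcompose (P n) s) x)) \<longlonglongrightarrow> V (fcalc (\<lambda>t. \<psi> (poly s t)) x)"
      by (intro bounded_linear.tendsto[OF V] fcalc_tendsto)
    moreover have "(\<lambda>n. peval (P n) (V x)) \<longlonglongrightarrow> fcalc \<psi> (V x)"
      by (rule fcalc_tendsto[OF P(1)])
    ultimately show ?thesis
      unfolding peval_intertwining[OF lin s] using LIMSEQ_unique by blast
  qed
  have tr: "(\<lambda>t. trunc \<phi> k (poly s t)) = trunc (\<lambda>t. \<phi> (poly s t)) k" for k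
    by (simp add: trunc_def fun_eq_iff)
  have ms: "(\<lambda>t. \<phi> (poly s t)) \<in> borel_measurable borel" using m by measurable
  have trV: "fcalc (trunc \<phi> k) (V x) = V (fcalc (trunc (\<lambda>t. \<phi> (poly s t)) k) x)" for k
    using commute[OF trunc_measurable[OF m] in_l2_trunc[OF m], of k] in_l2_trunc[OF ms, of x k]
    by (simp add: tr)
  obtain K where K: "K > 0" "\<And>y. norm (V y) \<le> norm y * K"
    using bounded_linear.pos_bounded[OF V] by blast
  show Vx: "in_l2 (V x) \<phi>"
  proof (rule in_l2I_trunc_bounded[OF m])
    show "norm (fcalc (trunc \<phi> k) (V x)) \<le> norm (fcalc (\<lambda>t. \<phi> (poly s t)) x) * K" for k
      unfolding trV
      by (rule order_trans[OF K(2) mult_right_mono[OF norm_fcalc_trunc_le[OF x]]]) (use K in simp)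
  qed
  show "fcalc \<phi> (V x) = V (fcalc (\<lambda>t. \<phi> (poly s t)) x)"
    by (rule commute[OF m Vx x])
qed

section \<open>Products\<close>

lemma bounded_linear_peval: "bounded_linear (peval p)"
proof -
  obtain B where B: "\<And>t. t \<in> {0..1} \<Longrightarrow> \<bar>poly p t\<bar> \<le> B"
    by (rule bounded_on_unit[of "poly p"]) (auto intro: continuous_intros)
  have "B \<ge> 0" using B[of 0] by (simp add: order_trans[OF abs_ge_zero])
  have "norm (peval p x) \<le> norm x * B" for x
  proof (rule power2_le_imp_le)
    have one: "in_l2 x (\<lambda>_. 1)" by (rule in_l2_bounded[of _ 1]) auto
    have "(norm (peval p x))\<^sup>2 \<le> (\<integral>t. B\<^sup>2 * (1::real)\<^sup>2 \<partial>moment_measure x)"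
      unfolding norm_peval
    proof (rule integral_mono_AE)
      show "AE t in moment_measure x. (poly p t)\<^sup>2 \<le> B\<^sup>2 * 1\<^sup>2"
        using AE_moment_measure[of x]
        by eventually_elim (use B \<open>B \<ge> 0\<close> in \<open>simp only: power2_le_iff_abs_le power_one mult_1_right\<close>)
      show "integrable (moment_measure x) (\<lambda>t. B\<^sup>2 * (1::real)\<^sup>2)"
        by (rule integrable_mult_right, rule sq_integrable_square[OF one])
    qed (rule sq_integrable_square[OF in_l2_poly])
    also have "\<dots> = B\<^sup>2 * (\<integral>t. poly 1 t \<partial>moment_measure x)" by simp
    also have "\<dots> = (norm x * B)\<^sup>2"
      by (simp only: integral_poly_moment_measure) (simp add: one_pCons dot_square_norm power_mult_distrib)
    finally show "(norm (peval p x))\<^sup>2 \<le> (norm x * B)\<^sup>2" .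
  qed (use \<open>B \<ge> 0\<close> in simp)
  then show ?thesis
    using linear_peval[of p] by (intro bounded_linear_intro) (auto simp: linear_add linear_scale)
qed

lemma peval_fcalc:
  assumes "in_l2 x \<eta>"
  shows "peval p (fcalc \<eta> x) = fcalc (\<lambda>t. poly p t * \<eta> t) x"
proof -
  obtain P where P: "l2_tendsto (moment_measure x) (\<lambda>n. poly (P n)) \<eta>" "(\<lambda>n. peval (P n) x) \<longlonglongrightarrow> fcalc \<eta> x"
    using assms by (metis fcalc_approximation)
  obtain B where B: "\<And>t. t \<in> {0..1} \<Longrightarrow> \<bar>poly p t\<bar> \<le> B"
    by (rule bounded_on_unit[of "poly p"]) (auto intro: continuous_intros)
  have ae: "AE t in moment_measure x. \<bar>poly p t\<bar> \<le> B"
    using AE_moment_measure[of x] by eventually_elim (rule B)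
  have "l2_tendsto (moment_measure x) (\<lambda>n t. poly p t * poly (P n) t) (\<lambda>t. poly p t * \<eta> t)"
    by (rule l2_tendsto_bounded_mult[OF P(1) sq_integrable_measurable[OF in_l2_poly] ae])
  then have "l2_tendsto (moment_measure x) (\<lambda>n. poly (p * P n)) (\<lambda>t. poly p t * \<eta> t)"
    by (simp add: poly_mult[abs_def] fun_eq_iff[symmetric])
  then have "(\<lambda>n. peval p (peval (P n) x)) \<longlonglongrightarrow> fcalc (\<lambda>t. poly p t * \<eta> t) x"
    unfolding peval_mult[symmetric] by (rule fcalc_tendsto)
  then show ?thesis
    using bounded_linear.tendsto[OF bounded_linear_peval P(2)] LIMSEQ_unique by blast
qed

text \<open>Multiplicativity of the calculus when the inner function is bounded. For bounded \<open>\<psi>\<close> it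
  follows by approximating \<open>\<psi>\<close> at \<open>x\<close> and at \<open>\<eta>(A) x\<close> with the same polynomials; truncation gives the general case,
  including the domain.\<close>

lemma fcalc_fcalc:
  assumes \<eta>: "\<eta> \<in> borel_measurable borel" "\<And>t. t \<in> {0..1} \<Longrightarrow> \<bar>\<eta> t\<bar> \<le> B"
    and \<psi>: "\<psi> \<in> borel_measurable borel" and x: "in_l2 x (\<lambda>t. \<psi> t * \<eta> t)"
  shows "fcalc \<psi> (fcalc \<eta> x) = fcalc (\<lambda>t. \<psi> t * \<eta> t) x" and "in_l2 (fcalc \<eta> x) \<psi>"
proof -
  have \<eta>x: "in_l2 x \<eta>" using \<eta> by (rule in_l2_bounded)
  have ae: "AE t in moment_measure x. \<bar>\<eta> t\<bar> \<le> B"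
    using AE_moment_measure[of x] by eventually_elim (rule \<eta>)
  have \<eta>m: "\<eta> \<in> borel_measurable (moment_measure x)" using \<eta> by simp
  have bounded: "fcalc \<xi> (fcalc \<eta> x) = fcalc (\<lambda>t. \<xi> t * \<eta> t) x"
    if \<xi>: "\<xi> \<in> borel_measurable borel" "\<And>t. t \<in> {0..1} \<Longrightarrow> \<bar>\<xi> t\<bar> \<le> C" for \<xi> C
  proof -
    obtain P where P: "l2_tendsto (moment_measure x) (\<lambda>n. poly (P n)) \<xi>"
      "l2_tendsto (moment_measure (fcalc \<eta> x)) (\<lambda>n. poly (P n)) \<xi>"
      using poly_approximation_at[OF in_l2_bounded[OF \<xi>] in_l2_bounded[OF \<xi>] in_l2_bounded[OF \<xi>]] .
    have "l2_tendsto (moment_measure x) (\<lambda>n t. poly (P n) t * \<eta> t) (\<lambda>t. \<xi> t * \<eta> t)"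
      using l2_tendsto_bounded_mult[OF P(1) \<eta>m ae] by (simp add: mult.commute)
    then have "(\<lambda>n. peval (P n) (fcalc \<eta> x)) \<longlonglongrightarrow> fcalc (\<lambda>t. \<xi> t * \<eta> t) x"
      unfolding peval_fcalc[OF \<eta>x] by (rule fcalc_l2_continuous)
    then show ?thesis using fcalc_tendsto[OF P(2)] LIMSEQ_unique by blast
  qed
  have "l2_tendsto (moment_measure x) (\<lambda>k t. trunc \<psi> k t * \<eta> t) (\<lambda>t. \<psi> t * \<eta> t)"
  proof (rule l2_tendsto_dominated[OF _ _ x])
    show "(\<lambda>t. trunc \<psi> n t * \<eta> t) \<in> borel_measurable (moment_measure x)" for n
      using trunc_measurable[OF \<psi>] \<eta> by simp
    show "(\<lambda>t. \<psi> t * \<eta> t) \<in> borel_measurable (moment_measure x)"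
      using \<psi> \<eta> by simp
    show "\<bar>trunc \<psi> n t * \<eta> t\<bar> \<le> \<bar>\<psi> t * \<eta> t\<bar>" for n t
      unfolding abs_mult by (intro mult_right_mono trunc_le) simp
    show "(\<lambda>n. trunc \<psi> n t * \<eta> t) \<longlonglongrightarrow> \<psi> t * \<eta> t" for t
      by (intro tendsto_intros trunc_tendsto)
  qed
  then have lim: "(\<lambda>k. fcalc (\<lambda>t. trunc \<psi> k t * \<eta> t) x) \<longlonglongrightarrow> fcalc (\<lambda>t. \<psi> t * \<eta> t) x"
    by (rule fcalc_l2_continuous)
  have tr: "fcalc (trunc \<psi> k) (fcalc \<eta> x) = fcalc (\<lambda>t. trunc \<psi> k t * \<eta> t) x" for k
    by (rule bounded[OF trunc_measurable[OF \<psi>] trunc_bound])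
  obtain K where "\<And>k. norm (fcalc (\<lambda>t. trunc \<psi> k t * \<eta> t) x) \<le> K"
    using convergent_imp_Bseq[OF convergentI[OF lim]] by (auto simp: Bseq_def)
  then show in\<psi>: "in_l2 (fcalc \<eta> x) \<psi>"
    by (intro in_l2I_trunc_bounded[OF \<psi>]) (simp add: tr)
  show "fcalc \<psi> (fcalc \<eta> x) = fcalc (\<lambda>t. \<psi> t * \<eta> t) x"
    using fcalc_trunc_tendsto[OF in\<psi>] lim unfolding tr by (rule LIMSEQ_unique)
qed

section \<open>Unbounded functions\<close>

definition cutoff :: "(real \<Rightarrow> real) \<Rightarrow> nat \<Rightarrow> real \<Rightarrow> real" where
  "cutoff \<phi> k t = (if \<bar>\<phi> t\<bar> \<le> real k then 1 else 0)"

lemma cutoff_measurable [measurable (raw)]: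
  assumes [measurable]: "\<phi> \<in> borel_measurable borel"
  shows "cutoff \<phi> k \<in> borel_measurable borel"
  unfolding cutoff_def[abs_def] by measurable

lemma cutoff_bound: "\<bar>cutoff \<phi> k t\<bar> \<le> 1"
  by (simp add: cutoff_def)

lemma in_l2_cutoff: "\<phi> \<in> borel_measurable borel \<Longrightarrow> in_l2 x (cutoff \<phi> k)"
  by (rule in_l2_bounded[of _ 1]) (auto simp: cutoff_bound)

lemma fcalc_cutoff_tendsto:
  assumes "\<phi> \<in> borel_measurable borel"
  shows "(\<lambda>k. fcalc (cutoff \<phi> k) x) \<longlonglongrightarrow> x"
proof -
  have "(\<lambda>k. fcalc (cutoff \<phi> k) x) \<longlonglongrightarrow> fcalc (\<lambda>_. 1) x"
  proof (rule fcalc_l2_continuous, rule l2_tendsto_dominated[where w="\<lambda>_. 1"])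
    show "cutoff \<phi> n \<in> borel_measurable (moment_measure x)" for n using cutoff_measurable[OF assms] by simp
    show "in_l2 x (\<lambda>_. 1)" by (rule in_l2_bounded[of _ 1]) auto
    show "(\<lambda>k. cutoff \<phi> k t) \<longlonglongrightarrow> 1" for t
      using eventually_trunc[of \<phi> t] by (rule tendsto_eventually[OF eventually_mono]) (simp add: cutoff_def)
  qed (auto simp: cutoff_bound)
  moreover have "fcalc (\<lambda>_. 1) x = x"
  proof -
    have "poly (1 :: real poly) = (\<lambda>_. 1)" by auto
    from fcalc_poly[of 1 x, unfolded this] show ?thesis by (simp add: one_pCons)
  qed
  ultimately show ?thesis by simp
qed

lemma fcalc_fcalc_cutoff:
  assumes \<phi>: "\<phi> \<in> borel_measurable borel"
  shows "fcalc \<phi> (fcalc (cutoff \<phi> k) x) = fcalc (trunc \<phi> k) x" and "in_l2 (fcalc (cutoff \<phi> k) x) \<phi>"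
proof -
  have e: "(\<lambda>t. \<phi> t * cutoff \<phi> k t) = trunc \<phi> k" by (auto simp: cutoff_def trunc_def)
  have l2: "in_l2 x (\<lambda>t. \<phi> t * cutoff \<phi> k t)" unfolding e by (rule in_l2_trunc[OF \<phi>])
  show "fcalc \<phi> (fcalc (cutoff \<phi> k) x) = fcalc (trunc \<phi> k) x"
    using fcalc_fcalc(1)[OF cutoff_measurable[OF \<phi>] cutoff_bound \<phi> l2] unfolding e .
  show "in_l2 (fcalc (cutoff \<phi> k) x) \<phi>"
    by (rule fcalc_fcalc(2)[OF cutoff_measurable[OF \<phi>] cutoff_bound \<phi> l2])
qed

text \<open>Self-adjointness of \<open>\<phi>(A)\<close>: testing against vectors in the spectral subspaces
  \<open>{|\<phi>| \<le> k}\<close> shows that the truncations of \<open>\<phi>\<close> are bounded on \<open>u\<close>.\<close>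

lemma fcalc_adjoint:
  assumes \<phi>: "\<phi> \<in> borel_measurable borel"
    and uv: "\<And>x. in_l2 x \<phi> \<Longrightarrow> inner (fcalc \<phi> x) u = inner x v"
  shows "in_l2 u \<phi>" and "fcalc \<phi> u = v"
proof -
  have tr: "fcalc (trunc \<phi> k) u = fcalc (cutoff \<phi> k) v" for k
  proof -
    have "inner z (fcalc (trunc \<phi> k) u) = inner z (fcalc (cutoff \<phi> k) v)" for z
    proof -
      have "inner z (fcalc (trunc \<phi> k) u) = inner (fcalc \<phi> (fcalc (cutoff \<phi> k) z)) u"
        by (simp add: fcalc_fcalc_cutoff[OF \<phi>] fcalc_symmetric in_l2_trunc[OF \<phi>])
      also have "\<dots> = inner (fcalc (cutoff \<phi> k) z) v"
        by (rule uv[OF fcalc_fcalc_cutoff(2)[OF \<phi>]])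
      also have "\<dots> = inner z (fcalc (cutoff \<phi> k) v)"
        by (rule fcalc_symmetric; rule in_l2_cutoff[OF \<phi>])
      finally show ?thesis .
    qed
    then show ?thesis by (metis inner_commute vector_eq_ldot)
  qed
  have lim: "(\<lambda>k. fcalc (trunc \<phi> k) u) \<longlonglongrightarrow> v"
    unfolding tr by (rule fcalc_cutoff_tendsto[OF \<phi>])
  obtain K where "\<And>k. norm (fcalc (trunc \<phi> k) u) \<le> K"
    using convergent_imp_Bseq[OF convergentI[OF lim]] by (auto simp: Bseq_def)
  then show u: "in_l2 u \<phi>" by (rule in_l2I_trunc_bounded[OF \<phi>])
  show "fcalc \<phi> u = v" by (rule LIMSEQ_unique[OF fcalc_trunc_tendsto[OF u] lim])
qed

end

section \<open>Complex Hilbert spaces and unbounded operators\<close>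

lemma cinner_add_right: "cinner x (y + z) = cinner x y + cinner x z"
  by (metis cinner_add_left cinner_commute complex_cnj_add)

lemma cinner_scaleC_right: "cinner x (c *\<^sub>C y) = cnj c * cinner x y"
  by (metis cinner_commute cinner_scaleC_left complex_cnj_mult)

lemma scaleR_eq_scaleC: "r *\<^sub>R x = complex_of_real r *\<^sub>C (x :: 'a::complex_hilbert)"
  by (simp add: scaleC_of_real)

lemma cinner_scaleR_left: "cinner (r *\<^sub>R x) y = of_real r * cinner x y"
  by (simp add: scaleR_eq_scaleC cinner_scaleC_left)

lemma cinner_scaleR_right: "cinner x (r *\<^sub>R y) = of_real r * cinner x y"
  by (simp add: scaleR_eq_scaleC cinner_scaleC_right)

lemma cinner_minus_left: "cinner (- x) y = - cinner x y"
  using cinner_scaleR_left[of "-1" x y] by simp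

lemma cinner_minus_right: "cinner x (- y) = - cinner x y"
  using cinner_scaleR_right[of x "-1" y] by simp

lemma cinner_diff_left: "cinner (x - y) z = cinner x z - cinner y z"
  using cinner_add_left[of x "- y" z] by (simp add: cinner_minus_left)

lemma cinner_diff_right: "cinner x (y - z) = cinner x y - cinner x z"
  using cinner_add_right[of x y "- z"] by (simp add: cinner_minus_right)

lemma cinner_zero_left [simp]: "cinner 0 y = 0"
  using cinner_scaleR_left[of 0 0 y] by simp

lemma cinner_zero_right [simp]: "cinner x 0 = 0"
  using cinner_scaleR_right[of x 0 0] by simp

lemma cinner_eq_Complex: "cinner x y = Complex (inner x y) (inner x (\<i> *\<^sub>C y))"
  by (simp add: complex_eq_iff inner_eq_Re_cinner cinner_scaleC_right)

lemma cinner_self: "cinner x x = complex_of_real ((norm x)\<^sup>2)"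
proof -
  have "Im (cinner x x) = - Im (cinner x x)" by (metis cinner_commute cnj.simps(2))
  then show ?thesis by (simp add: complex_eq_iff inner_eq_Re_cinner[symmetric] power2_norm_eq_inner)
qed

lemma norm_scaleC: "norm (c *\<^sub>C x) = cmod c * norm x"
proof -
  have "complex_of_real ((norm (c *\<^sub>C x))\<^sup>2) = c * (cnj c * complex_of_real ((norm x)\<^sup>2))"
    by (simp only: cinner_self[symmetric] cinner_scaleC_left cinner_scaleC_right mult.left_commute)
  also have "\<dots> = complex_of_real ((cmod c * norm x)\<^sup>2)"
    by (simp add: mult.assoc[symmetric] complex_norm_square[symmetric] power_mult_distrib)
  finally have "(norm (c *\<^sub>C x))\<^sup>2 = (cmod c * norm x)\<^sup>2" by (simp only: of_real_eq_iff)
  then show ?thesis by (rule power2_eq_imp_eq) auto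
qed

lemma bounded_linear_scaleC: "bounded_linear (\<lambda>x :: 'a::complex_hilbert. c *\<^sub>C x)"
proof (rule bounded_linear_intro)
  show "c *\<^sub>C r *\<^sub>R x = r *\<^sub>R c *\<^sub>C x" for r and x :: 'a
    by (simp add: scaleR_eq_scaleC scaleC_scaleC mult.commute)
  show "norm (c *\<^sub>C x) \<le> norm x * cmod c" for x :: 'a by (simp add: norm_scaleC)
qed (rule scaleC_add_right)

lemma tendsto_cinner:
  assumes "(f \<longlongrightarrow> a) F" "(g \<longlongrightarrow> b) F"
  shows "((\<lambda>x. cinner (f x) (g x)) \<longlongrightarrow> cinner a b) F"
  unfolding cinner_eq_Complex
  by (intro tendsto_Complex tendsto_inner assms bounded_linear.tendsto[OF bounded_linear_scaleC])

text \<open>The vector from a closest point of \<open>S\<close> to a point outside is orthogonal to \<open>S\<close>.\<close>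

lemma closed_subspace_has_orthogonal:
  fixes S :: "'b::{real_inner,complete_space} set"
  assumes S: "subspace S" "closed S" "S \<noteq> UNIV"
  obtains u where "u \<noteq> 0" "\<And>s. s \<in> S \<Longrightarrow> inner u s = 0"
proof -
  obtain x where x: "x \<notin> S" using S(3) by blast
  have ne: "S \<noteq> {}" using subspace_0[OF S(1)] by blast
  define d where "d = infdist x S"
  have d_le: "d \<le> norm (x - s)" if "s \<in> S" for s
    unfolding d_def using infdist_le[OF that, of x] by (simp add: dist_norm)
  have d0: "d \<ge> 0" by (simp add: d_def infdist_nonneg)
  have "\<exists>s\<in>S. norm (x - s) < d + inverse (real (Suc n))" for n
  proof (rule ccontr)
    assume "\<not> ?thesis"
    then have "\<And>s. s \<in> S \<Longrightarrow> d + inverse (real (Suc n)) \<le> dist x s" by (force simp: dist_norm)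
    then have "d + inverse (real (Suc n)) \<le> infdist x S"
      unfolding infdist_def using ne by (auto intro!: cINF_greatest)
    then show False by (simp add: d_def)
  qed
  then obtain s where s: "\<And>n. s n \<in> S" "\<And>n. norm (x - s n) < d + inverse (real (Suc n))"
    by metis
  have lim: "(\<lambda>n. norm (x - s n)) \<longlonglongrightarrow> d"
  proof (rule tendsto_sandwich[of "\<lambda>_. d" _ _ "\<lambda>n. d + inverse (real (Suc n))"])
    show "(\<lambda>n. d + inverse (real (Suc n))) \<longlonglongrightarrow> d"
      using tendsto_add[OF tendsto_const LIMSEQ_inverse_real_of_nat, of d] by simp
  qed (use d_le s in \<open>auto intro!: always_eventually less_imp_le\<close>)
  \<comment> \<open>By the parallelogram law, the minimizing sequence is a Cauchy sequence.\<close>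
  have par: "(norm (s m - s n))\<^sup>2 \<le> 2 * (norm (x - s m))\<^sup>2 + 2 * (norm (x - s n))\<^sup>2 - 4 * d\<^sup>2" for m n
  proof -
    have "(1/2) *\<^sub>R (s m + s n) \<in> S" by (intro subspace_scale[OF S(1)] subspace_add[OF S(1)] s)
    from d_le[OF this] have "d\<^sup>2 \<le> (norm (x - (1/2) *\<^sub>R (s m + s n)))\<^sup>2"
      using d0 by (rule power_mono)
    moreover have "(norm (s m - s n))\<^sup>2 + 4 * (norm (x - (1/2) *\<^sub>R (s m + s n)))\<^sup>2
        = 2 * (norm (x - s m))\<^sup>2 + 2 * (norm (x - s n))\<^sup>2"
      by (simp add: power2_norm_eq_inner inner_diff_left inner_diff_right inner_add_left inner_add_right
          inner_commute field_simps)
    ultimately show ?thesis by linarith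
  qed
  have "Cauchy s"
  proof (rule metric_CauchyI)
    fix e :: real assume e: "e > 0"
    have "(\<lambda>n. (norm (x - s n))\<^sup>2 - d\<^sup>2) \<longlonglongrightarrow> d\<^sup>2 - d\<^sup>2"
      by (intro tendsto_intros lim)
    then have lim0: "(\<lambda>n. (norm (x - s n))\<^sup>2 - d\<^sup>2) \<longlonglongrightarrow> 0" by simp
    have "e\<^sup>2 / 4 > 0" using e by simp
    from order_tendstoD(2)[OF lim0 this]
    obtain N where N: "\<And>n. n \<ge> N \<Longrightarrow> (norm (x - s n))\<^sup>2 - d\<^sup>2 < e\<^sup>2 / 4"
      by (auto simp: eventually_sequentially)
    have "dist (s m) (s n) < e" if "m \<ge> N" "n \<ge> N" for m n
    proof -
      have "(norm (s m - s n))\<^sup>2 < e\<^sup>2"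
        using par[of m n] N[OF that(1)] N[OF that(2)] by linarith
      then show ?thesis using e by (simp add: dist_norm power2_less_imp_less)
    qed
    then show "\<exists>N. \<forall>m\<ge>N. \<forall>n\<ge>N. dist (s m) (s n) < e" by blast
  qed
  then obtain y where y: "s \<longlonglongrightarrow> y" using Cauchy_convergent convergent_def by blast
  have yS: "y \<in> S" using closed_sequentially[OF S(2) s(1) y] .
  define u where "u = x - y"
  have nu: "norm u = d"
    unfolding u_def by (rule LIMSEQ_unique[OF _ lim]) (intro tendsto_intros y)
  have "u \<noteq> 0" using x yS by (auto simp: u_def)
  moreover have "inner u t = 0" if t: "t \<in> S" for t
  proof (cases "t = 0")
    case False
    define c where "c = inner u t / inner t t"
    have "y + c *\<^sub>R t \<in> S" by (intro subspace_add[OF S(1)] subspace_scale[OF S(1)] yS t)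
    from d_le[OF this] have "d \<le> norm (u - c *\<^sub>R t)" by (simp add: u_def algebra_simps)
    then have "(norm u)\<^sup>2 \<le> (norm (u - c *\<^sub>R t))\<^sup>2" using d0 nu by (simp add: power_mono)
    also have "\<dots> = (norm u)\<^sup>2 - 2 * c * inner u t + c * c * inner t t"
      by (simp add: power2_norm_eq_inner inner_diff_left inner_diff_right inner_commute algebra_simps)
    also have "c * c * inner t t = c * inner u t" using False by (simp add: c_def)
    finally have "c * inner u t \<le> 0" by simp
    then have "(inner u t)\<^sup>2 / inner t t \<le> 0" by (simp add: c_def power2_eq_square)
    moreover have "inner t t > 0" using False by simp
    ultimately have "(inner u t)\<^sup>2 \<le> 0" by (simp add: divide_le_0_iff)
    then show ?thesis by simp
  qed simp
  ultimately show thesis using that by blast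
qed

lemma linear_operatorD:
  assumes "linear_operator T"
  shows "(f, h) \<in> T \<Longrightarrow> (f, h') \<in> T \<Longrightarrow> h = h'"
    and "(0, 0) \<in> T"
    and "(f, h) \<in> T \<Longrightarrow> (f', h') \<in> T \<Longrightarrow> (f + f', h + h') \<in> T"
    and "(f, h) \<in> T \<Longrightarrow> (f', h') \<in> T \<Longrightarrow> (f - f', h - h') \<in> T"
    and "(f, h) \<in> T \<Longrightarrow> (c *\<^sub>C f, c *\<^sub>C h) \<in> T"
    and "(f, h) \<in> T \<Longrightarrow> (r *\<^sub>R f, r *\<^sub>R h) \<in> T"
proof -
  have add: "(f, h) \<in> T \<Longrightarrow> (f', h') \<in> T \<Longrightarrow> (f + f', h + h') \<in> T"
    and scale: "(f, h) \<in> T \<Longrightarrow> (c *\<^sub>C f, c *\<^sub>C h) \<in> T" for f h f' h' c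
    using assms unfolding linear_operator_def by blast+
  show "(f, h) \<in> T \<Longrightarrow> (f, h') \<in> T \<Longrightarrow> h = h'"
    using assms unfolding linear_operator_def by (auto dest: single_valuedD)
  show "(0, 0) \<in> T" using assms by (simp add: linear_operator_def)
  show "(f, h) \<in> T \<Longrightarrow> (f', h') \<in> T \<Longrightarrow> (f + f', h + h') \<in> T" by (rule add)
  show "(f, h) \<in> T \<Longrightarrow> (c *\<^sub>C f, c *\<^sub>C h) \<in> T" by (rule scale)
  show sc: "(f, h) \<in> T \<Longrightarrow> (r *\<^sub>R f, r *\<^sub>R h) \<in> T" for f h r
    unfolding scaleR_eq_scaleC by (rule scale)
  show "(f, h) \<in> T \<Longrightarrow> (f', h') \<in> T \<Longrightarrow> (f - f', h - h') \<in> T"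
    using add[OF _ sc[of f' h' "-1"], of f h] by simp
qed

lemma op_app_eq: "linear_operator T \<Longrightarrow> (f, h) \<in> T \<Longrightarrow> op_app T f = h"
  unfolding op_app_def using linear_operatorD(1) by blast

lemma self_adjoint_symmetric:
  assumes "self_adjoint G" "(f, h) \<in> G" "(f', h') \<in> G"
  shows "cinner h f' = cinner f h'"
  using assms unfolding self_adjoint_def op_adjoint_def by blast

lemma self_adjoint_memberI:
  assumes "self_adjoint G" "\<And>f h. (f, h) \<in> G \<Longrightarrow> cinner h u = cinner f v"
  shows "(u, v) \<in> G"
proof -
  have "(u, v) \<in> op_adjoint G" using assms(2) by (auto simp: op_adjoint_def)
  then show ?thesis using assms(1) by (simp add: self_adjoint_def)
qed

lemma self_adjoint_closed_graph:
  assumes G: "self_adjoint G" and "\<And>n. (f n, h n) \<in> G" "f \<longlonglongrightarrow> u" "h \<longlonglongrightarrow> v"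
  shows "(u, v) \<in> G"
proof (rule self_adjoint_memberI[OF G])
  fix f' h' assume "(f', h') \<in> G"
  then have "cinner h' (f n) = cinner f' (h n)" for n
    using self_adjoint_symmetric[OF G] assms(2) by blast
  moreover have "(\<lambda>n. cinner h' (f n)) \<longlonglongrightarrow> cinner h' u" by (intro tendsto_cinner tendsto_const assms)
  moreover have "(\<lambda>n. cinner f' (h n)) \<longlonglongrightarrow> cinner f' v" by (intro tendsto_cinner tendsto_const assms)
  ultimately show "cinner h' u = cinner f' v" by (simp add: LIMSEQ_unique)
qed

text \<open>Taking adjoints reverses inclusions, so a self-adjoint operator has no proper
  self-adjoint extension.\<close>

lemma self_adjoint_maximal:
  assumes "self_adjoint G" "self_adjoint T" "G \<subseteq> T"
  shows "G = T"
proof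
  show "T \<subseteq> G"
  proof safe
    fix u v assume uv: "(u, v) \<in> T"
    show "(u, v) \<in> G"
      by (rule self_adjoint_memberI[OF assms(1)]) (use assms(3) uv self_adjoint_symmetric[OF assms(2)] in blast)
  qed
qed (rule assms(3))

section \<open>Spectral integrals\<close>

text \<open>The inverse of \<open>q \<mapsto> (1 + e\<^sup>q)\<^sup>-\<^sup>1\<close>: it recovers \<open>Q\<close> from the resolvent \<open>(1 + e\<^sup>Q)\<^sup>-\<^sup>1\<close>. The value
  \<open>0\<close> outside the open interval concerns a null set only and keeps the function odd under \<open>t \<mapsto> 1 - t\<close>.\<close>

definition logit :: "real \<Rightarrow> real" where
  "logit t = (if 0 < t \<and> t < 1 then ln ((1 - t) / t) else 0)"

lemma logit_measurable [measurable]: "logit \<in> borel_measurable borel"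
  unfolding logit_def[abs_def] by measurable

lemma logit_reflect: "logit (1 - t) = - logit t"
  by (auto simp: logit_def ln_div)

lemma exp_logit: "0 < t \<Longrightarrow> t < 1 \<Longrightarrow> exp (logit t) = (1 - t) / t"
  by (simp add: logit_def)

locale complex_positive_contraction = positive_contraction A
  for A :: "'a::complex_hilbert \<Rightarrow> 'a" +
  assumes A_scaleC: "A (c *\<^sub>C x) = c *\<^sub>C A x"
    and ker_A: "A x = 0 \<Longrightarrow> x = 0"
    and ker_1_minus_A: "A x = x \<Longrightarrow> x = 0"
begin

lemma fcalc_scaleC:
  assumes "in_l2 x \<phi>"
  shows "fcalc \<phi> (c *\<^sub>C x) = c *\<^sub>C fcalc \<phi> x" and "in_l2 (c *\<^sub>C x) \<phi>"
  using fcalc_intertwining[of "\<lambda>x. c *\<^sub>C x" "[:0, 1:]" \<phi> x, OF bounded_linear_scaleC]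
    assms in_l2_measurable[OF assms]
  by (auto simp: A_scaleC)

lemma cinner_fcalc:
  assumes "in_l2 x \<phi>" "in_l2 y \<phi>"
  shows "cinner (fcalc \<phi> x) y = cinner x (fcalc \<phi> y)"
  by (simp add: cinner_eq_Complex fcalc_symmetric assms fcalc_scaleC(1)[OF assms(2), of \<i>, symmetric]
      fcalc_scaleC(2)[OF assms(2)])

lemma cinner_fcalc_self:
  assumes "in_l2 x \<phi>"
  shows "cinner (fcalc \<phi> x) x = complex_of_real (\<integral>t. \<phi> t \<partial>moment_measure x)"
proof -
  have "cinner (fcalc \<phi> x) x = cnj (cinner (fcalc \<phi> x) x)"
    by (metis assms cinner_commute cinner_fcalc)
  then have "Im (cinner (fcalc \<phi> x) x) = 0" by (simp add: complex_eq_iff)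
  then show ?thesis
    by (simp add: complex_eq_iff inner_eq_Re_cinner[symmetric] inner_fcalc_self[OF assms])
qed

lemma in_l2_zero: "in_l2 0 \<phi>" if "\<phi> \<in> borel_measurable borel"
proof (rule in_l2I_trunc_bounded[OF that])
  show "norm (fcalc (trunc \<phi> k) 0) \<le> 0" for k
    using fcalc_scaleC(1)[OF in_l2_trunc[OF that], where c=0 and x=0] by simp
qed

lemma fcalc_zero: "fcalc \<phi> 0 = 0" if "\<phi> \<in> borel_measurable borel"
  using fcalc_scaleC(1)[OF in_l2_zero[OF that], of 0] by simp

text \<open>The endpoints \<open>0\<close> and \<open>1\<close> are not eigenvalues of \<open>A\<close>, and the spectral projection of a point
  \<open>c\<close> maps into the eigenspace of \<open>c\<close>.\<close>

lemma AE_open_unit_interval: "AE t in moment_measure x. 0 < t \<and> t < 1"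
proof -
  have null: "AE t in moment_measure x. t \<noteq> c"
    if inj: "\<And>y. A y = c *\<^sub>R y \<Longrightarrow> y = 0" for c
  proof -
    have m: "(indicator {c} :: real \<Rightarrow> real) \<in> borel_measurable borel" by simp
    have l2: "in_l2 x (indicator {c})" by (rule in_l2_bounded[OF m, of 1]) (simp add: indicator_def)
    define y where "y = fcalc (indicator {c}) x"
    have "A y = peval [:0, 1:] y" by simp
    also have "\<dots> = fcalc (\<lambda>t. poly [:0, 1:] t * indicator {c} t) x"
      unfolding y_def by (rule peval_fcalc[OF l2])
    also have "(\<lambda>t. poly [:0, 1:] t * indicator {c} t) = (\<lambda>t. c * indicator {c} t)"
      by (auto simp: indicator_def)
    also have "fcalc (\<lambda>t. c * indicator {c} t) x = c *\<^sub>R y"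
      unfolding y_def by (rule fcalc_cmult[OF l2])
    finally have "y = 0" by (rule inj)
    then have "(\<integral>t. (indicator {c} t)\<^sup>2 \<partial>moment_measure x) = (0::real)"
      using norm_fcalc[OF l2] by (simp add: y_def)
    then have "AE t in moment_measure x. (indicator {c} t :: real)\<^sup>2 = 0"
      by (subst (asm) integral_nonneg_eq_0_iff_AE[OF sq_integrable_square[OF l2]]) auto
    then show ?thesis by eventually_elim (auto simp: indicator_def split: if_splits)
  qed
  have "AE t in moment_measure x. t \<noteq> 0" by (rule null) (simp add: ker_A)
  moreover have "AE t in moment_measure x. t \<noteq> 1" by (rule null) (simp add: ker_1_minus_A)
  ultimately show ?thesis
    using AE_moment_measure[of x] by eventually_elim auto
qed

definition fop :: "(real \<Rightarrow> real) \<Rightarrow> 'a rel" where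
  "fop \<phi> = {(x, fcalc \<phi> x) | x. in_l2 x \<phi>}"

lemma fop_iff: "(x, y) \<in> fop \<phi> \<longleftrightarrow> in_l2 x \<phi> \<and> y = fcalc \<phi> x"
  by (auto simp: fop_def)

lemma Domain_fop: "Domain (fop \<phi>) = {x. in_l2 x \<phi>}"
  by (auto simp: fop_def)

lemma linear_operator_fop:
  assumes "\<phi> \<in> borel_measurable borel"
  shows "linear_operator (fop \<phi>)"
  unfolding linear_operator_def
proof (intro conjI allI impI)
  show "single_valued (fop \<phi>)" by (simp add: single_valued_def fop_iff)
  show "(0, 0) \<in> fop \<phi>" by (simp add: fop_iff in_l2_zero fcalc_zero assms)
next
  fix f h f' h' assume "(f, h) \<in> fop \<phi>" "(f', h') \<in> fop \<phi>"
  then show "(f + f', h + h') \<in> fop \<phi>" using fcalc_add_vec[of f \<phi> f'] by (simp add: fop_iff)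
next
  fix c f h assume "(f, h) \<in> fop \<phi>"
  then show "(c *\<^sub>C f, c *\<^sub>C h) \<in> fop \<phi>" using fcalc_scaleC[of f \<phi> c] by (simp add: fop_iff)
qed

lemma self_adjoint_fop:
  assumes \<phi>: "\<phi> \<in> borel_measurable borel"
  shows "self_adjoint (fop \<phi>)"
  unfolding self_adjoint_def
proof (intro conjI linear_operator_fop \<phi>)
  show "closure (Domain (fop \<phi>)) = UNIV"
  proof (rule set_eqI, rule iffI[OF UNIV_I])
    fix x
    have "\<And>n. fcalc (cutoff \<phi> n) x \<in> Domain (fop \<phi>)"
      using fcalc_fcalc_cutoff(2)[OF \<phi>] by (simp add: Domain_fop)
    then show "x \<in> closure (Domain (fop \<phi>))"
      unfolding closure_sequential using fcalc_cutoff_tendsto[OF \<phi>, of x]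
      by (intro exI[of _ "\<lambda>n. fcalc (cutoff \<phi> n) x"]) simp
  qed
  show "op_adjoint (fop \<phi>) = fop \<phi>"
  proof (intro set_eqI, clarify)
    fix u v
    show "(u, v) \<in> op_adjoint (fop \<phi>) \<longleftrightarrow> (u, v) \<in> fop \<phi>"
    proof
      assume "(u, v) \<in> op_adjoint (fop \<phi>)"
      then have "cinner (fcalc \<phi> x) u = cinner x v" if "in_l2 x \<phi>" for x
        using that by (auto simp: op_adjoint_def fop_iff)
      then have uv: "inner (fcalc \<phi> x) u = inner x v" if "in_l2 x \<phi>" for x
        using that by (simp add: inner_eq_Re_cinner)
      show "(u, v) \<in> fop \<phi>"
        using fcalc_adjoint[OF \<phi>, of u v] uv by (auto simp: fop_iff)
    next
      assume "(u, v) \<in> fop \<phi>"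
      then show "(u, v) \<in> op_adjoint (fop \<phi>)"
        by (auto simp: op_adjoint_def fop_iff cinner_fcalc)
    qed
  qed
qed

text \<open>The projections of \<open>A\<close>, indexed by the values of \<open>logit\<close>, so that the spectral variable
  becomes that of \<open>logit(A)\<close>.\<close>

definition spectral_projection :: "real set \<Rightarrow> 'a \<Rightarrow> 'a" where
  "spectral_projection B = fcalc (\<lambda>t. indicator B (logit t))"

lemma indicator_logit:
  assumes "B \<in> sets borel"
  shows "(\<lambda>t. indicator B (logit t) :: real) \<in> borel_measurable borel" and "in_l2 x (\<lambda>t. indicator B (logit t))"
proof -
  note assms [measurable]
  show "(\<lambda>t. indicator B (logit t) :: real) \<in> borel_measurable borel" by measurable
  then show "in_l2 x (\<lambda>t. indicator B (logit t))"
    by (rule in_l2_bounded[of _ 1]) (simp add: indicator_def)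
qed

lemma projection_valued_measure_spectral_projection:
  "projection_valued_measure spectral_projection"
  unfolding projection_valued_measure_def
proof (intro conjI ballI allI impI)
  fix B :: "real set" assume B: "B \<in> sets borel"
  note l2 = indicator_logit[OF B]
  show "orthogonal_projection (spectral_projection B)"
    unfolding orthogonal_projection_def clinear_map_def spectral_projection_def
  proof (intro conjI allI)
    show "fcalc (\<lambda>t. indicator B (logit t)) (x + y)
        = fcalc (\<lambda>t. indicator B (logit t)) x + fcalc (\<lambda>t. indicator B (logit t)) y" for x y
      by (rule fcalc_add_vec(1)[OF l2(2) l2(2)])
    show "fcalc (\<lambda>t. indicator B (logit t)) (c *\<^sub>C x) = c *\<^sub>C fcalc (\<lambda>t. indicator B (logit t)) x" for c x
      by (rule fcalc_scaleC(1)[OF l2(2)])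
    show "cinner (fcalc (\<lambda>t. indicator B (logit t)) x) y = cinner x (fcalc (\<lambda>t. indicator B (logit t)) y)" for x y
      by (rule cinner_fcalc[OF l2(2) l2(2)])
    have e: "(\<lambda>t. indicator B (logit t) * indicator B (logit t)) = (\<lambda>t. indicator B (logit t) :: real)"
      by (auto simp: indicator_def)
    show "fcalc (\<lambda>t. indicator B (logit t)) (fcalc (\<lambda>t. indicator B (logit t)) x)
        = fcalc (\<lambda>t. indicator B (logit t)) x" for x
      using fcalc_fcalc(1)[OF l2(1) _ l2(1), of 1 x] l2(2)[of x] unfolding e by (simp add: indicator_def)
  qed
next
  fix x
  have "(\<lambda>t. indicator UNIV (logit t)) = poly (1 :: real poly)" by auto
  then show "spectral_projection UNIV x = x"
    unfolding spectral_projection_def by (simp only: fcalc_poly) (simp add: one_pCons)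
next
  fix B :: "nat \<Rightarrow> real set" and x assume "range B \<subseteq> sets borel" and disj: "disjoint_family B"
  then have B [measurable]: "\<And>i. B i \<in> sets borel" by auto
  note l2 = indicator_logit[OF B]
  have "(\<lambda>n. fcalc (\<lambda>t. \<Sum>i<n. indicator (B i) (logit t)) x) \<longlonglongrightarrow> spectral_projection (\<Union>i. B i) x"
    unfolding spectral_projection_def
  proof (rule fcalc_l2_continuous, rule l2_tendsto_dominated[where w="\<lambda>_. 1"])
    have e: "(\<Sum>i<n. indicator (B i) t) = (indicator (\<Union>i<n. B i) t :: real)" for n t
      using disj by (intro indicator_UN_disjoint[symmetric]) (auto simp: disjoint_family_on_def)
    show "\<bar>\<Sum>i<n. indicator (B i) (logit t)\<bar> \<le> \<bar>1 :: real\<bar>" for n t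
      unfolding e by simp
    show "(\<lambda>n. \<Sum>i<n. indicator (B i) (logit t)) \<longlonglongrightarrow> (indicator (\<Union>i. B i) (logit t) :: real)" for t
      unfolding e by (rule LIMSEQ_indicator_UN)
    show "in_l2 x (\<lambda>_. 1)" by (rule in_l2_bounded[of _ 1]) auto
    show "(\<lambda>t. \<Sum>i<n. indicator (B i) (logit t) :: real) \<in> borel_measurable (moment_measure x)" for n
      using l2(1) by simp
    show "(\<lambda>t. indicator (\<Union>i. B i) (logit t) :: real) \<in> borel_measurable (moment_measure x)"
      using indicator_logit(1)[of "\<Union>i. B i"] by simp
  qed
  moreover have "fcalc (\<lambda>t. \<Sum>i<n. indicator (B i) (logit t)) x = (\<Sum>i<n. spectral_projection (B i) x)
      \<and> in_l2 x (\<lambda>t. \<Sum>i<n. indicator (B i) (logit t))" for n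
  proof (induction n)
    case 0
    have "(\<lambda>t. 0) = poly (0 :: real poly)" by auto
    then show ?case using in_l2_poly[of x 0] fcalc_poly[of 0 x] by simp
  next
    case (Suc n)
    then show ?case
      using fcalc_add[of x "\<lambda>t. \<Sum>i<n. indicator (B i) (logit t)", OF _ l2(2)[of x n]]
        sq_integrable_add[of "moment_measure x" "\<lambda>t. \<Sum>i<n. indicator (B i) (logit t)", OF _ l2(2)[of x n]]
      by (simp add: spectral_projection_def)
  qed
  ultimately show "(\<lambda>i. spectral_projection (B i) x) sums spectral_projection (\<Union>i. B i) x"
    by (simp add: sums_def)
qed

text \<open>\<open>(1\<^sub>B(A) x, x)\<close> is the integral of \<open>1\<^sub>B\<close>, so the scalar spectral measures are the images of the measures
  that represent the moments.\<close>

lemma spectral_measure_eq: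
  "spectral_measure spectral_projection x = distr (moment_measure x) borel logit"
proof -
  let ?D = "distr (moment_measure x) borel logit"
  have "ennreal (Re (cinner (spectral_projection B x) x)) = emeasure ?D B" if B [measurable]: "B \<in> sets borel" for B
  proof -
    interpret finite_measure "moment_measure x" by (rule finite_moment_measure)
    have "Re (cinner (spectral_projection B x) x) = (\<integral>t. indicator B (logit t) \<partial>moment_measure x)"
      unfolding spectral_projection_def by (simp add: cinner_fcalc_self[OF indicator_logit(2)[OF B]])
    also have "(\<lambda>t. indicator B (logit t)) = (indicator (logit -` B) :: real \<Rightarrow> real)"
      by (auto simp: indicator_def)
    also have "(\<integral>t. indicator (logit -` B) t \<partial>moment_measure x) = measure (moment_measure x) (logit -` B)"
      by simp
    finally show ?thesis
      by (simp add: emeasure_distr emeasure_eq_measure)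
  qed
  then have "measure_of UNIV (sets borel) (\<lambda>B. ennreal (Re (cinner (spectral_projection B x) x)))
      = measure_of UNIV (sets borel) (emeasure ?D)"
    by (intro measure_of_eq) (auto simp: sets.sigma_sets_eq[of borel, simplified])
  also have "\<dots> = ?D" using measure_of_of_measure[of ?D] by simp
  finally show ?thesis by (simp add: spectral_measure_def)
qed

lemma is_spectral_integral_fop:
  assumes [measurable]: "\<phi> \<in> borel_measurable borel"
  shows "is_spectral_integral spectral_projection \<phi> (fop (\<lambda>t. \<phi> (logit t)))"
  unfolding is_spectral_integral_def
proof (intro conjI)
  have m: "(\<lambda>t. \<phi> (logit t)) \<in> borel_measurable borel" by measurable
  show "linear_operator (fop (\<lambda>t. \<phi> (logit t)))" by (rule linear_operator_fop[OF m])
  show "Domain (fop (\<lambda>t. \<phi> (logit t))) = {f. integrable (spectral_measure spectral_projection f) (\<lambda>x. (\<phi> x)\<^sup>2)}"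
    by (simp add: Domain_fop spectral_measure_eq integrable_distr_eq sq_integrable_def m)
  show "\<forall>(f, h)\<in>fop (\<lambda>t. \<phi> (logit t)). cinner h f
      = complex_of_real (integral\<^sup>L (spectral_measure spectral_projection f) \<phi>)"
    by (auto simp: fop_iff spectral_measure_eq integral_distr cinner_fcalc_self)
qed

lemma is_function_of_fop:
  assumes "\<phi> \<in> borel_measurable borel"
  shows "is_function_of (fop logit) \<phi> (fop (\<lambda>t. \<phi> (logit t)))"
  unfolding is_function_of_def
  using self_adjoint_fop[OF logit_measurable] projection_valued_measure_spectral_projection
    is_spectral_integral_fop[of "\<lambda>x. x"] is_spectral_integral_fop[OF assms]
  by auto

end

section \<open>The logarithm and the square root of a positive self-adjoint operator\<close>

locale positive_self_adjoint =
  fixes G :: "'a::complex_hilbert rel"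
  assumes self_adjoint: "self_adjoint G" and positive: "positive_operator G"
begin

lemma linear_operator: "linear_operator G"
  using self_adjoint by (simp add: self_adjoint_def)

lemmas memD = linear_operatorD[OF linear_operator]

lemma inner_pos: "(f, h) \<in> G \<Longrightarrow> f \<noteq> 0 \<Longrightarrow> 0 < inner h f"
  using positive by (auto simp: positive_operator_def inner_eq_Re_cinner)

lemma inner_nonneg: "(f, h) \<in> G \<Longrightarrow> 0 \<le> inner h f"
  using inner_pos[of f h] by (cases "f = 0") auto

lemma norm_le_norm_add:
  assumes "(f, h) \<in> G"
  shows "norm f \<le> norm (f + h)" "norm h \<le> norm (f + h)"
proof -
  have "(norm (f + h))\<^sup>2 = (norm f)\<^sup>2 + 2 * inner h f + (norm h)\<^sup>2"
    by (simp add: power2_norm_eq_inner inner_add_left inner_add_right inner_commute)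
  then have "(norm f)\<^sup>2 \<le> (norm (f + h))\<^sup>2" "(norm h)\<^sup>2 \<le> (norm (f + h))\<^sup>2"
    using inner_nonneg[OF assms] by simp_all
  then show "norm f \<le> norm (f + h)" "norm h \<le> norm (f + h)"
    by (auto intro: power2_le_imp_le)
qed

lemma add_inj:
  assumes "(f, h) \<in> G" "(f', h') \<in> G" "f + h = f' + h'"
  shows "f = f'"
proof -
  have "norm (f - f') \<le> norm ((f - f') + (h - h'))"
    by (rule norm_le_norm_add(1)[OF memD(4)[OF assms(1,2)]])
  also have "(f - f') + (h - h') = 0" using assms(3) by (simp add: algebra_simps)
  finally show ?thesis by simp
qed

text \<open>The range of \<open>1 + G\<close> is closed, because \<open>f\<close> and \<open>G f\<close> are bounded by \<open>f + G f\<close> and the graph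
  is closed. A vector \<open>u\<close> orthogonal to it would satisfy \<open>G u = G\<^sup>* u = - u\<close>, against the positivity of \<open>G\<close>.\<close>

lemma range_1_plus: "\<exists>f h. (f, h) \<in> G \<and> z = f + h"
proof -
  define R where "R = {f + h | f h. (f, h) \<in> G}"
  have "subspace R"
    unfolding subspace_def
  proof (intro conjI ballI allI)
    show "0 \<in> R" unfolding R_def using memD(2) by force
  next
    fix x y assume "x \<in> R" "y \<in> R"
    then obtain f h f' h' where "(f, h) \<in> G" "x = f + h" "(f', h') \<in> G" "y = f' + h'"
      unfolding R_def by blast
    then have "(f + f', h + h') \<in> G" "x + y = (f + f') + (h + h')" using memD(3) by auto
    then show "x + y \<in> R" unfolding R_def by blast
  next
    fix c :: real and x assume "x \<in> R"
    then obtain f h where "(f, h) \<in> G" "x = f + h" unfolding R_def by blast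
    then have "(c *\<^sub>R f, c *\<^sub>R h) \<in> G" "c *\<^sub>R x = c *\<^sub>R f + c *\<^sub>R h"
      using memD(6) by (auto simp: scaleR_add_right)
    then show "c *\<^sub>R x \<in> R" unfolding R_def by blast
  qed
  moreover have "closed R"
    unfolding closed_sequential_limits
  proof (intro allI impI, elim conjE)
    fix z l assume "\<forall>n. z n \<in> R" and l: "z \<longlonglongrightarrow> l"
    then have "\<forall>n. \<exists>f h. (f, h) \<in> G \<and> z n = f + h" unfolding R_def by blast
    then obtain f h where fh: "\<And>n. (f n, h n) \<in> G" "\<And>n. z n = f n + h n" by metis
    have d: "(f m - f n) + (h m - h n) = z m - z n" for m n by (simp add: fh)
    have "Cauchy z" using l by (rule LIMSEQ_imp_Cauchy)
    have "Cauchy f" "Cauchy h"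
    proof -
      show "Cauchy f"
      proof (rule metric_CauchyI)
        fix e :: real assume "e > 0"
        then obtain M where "\<And>m n. m \<ge> M \<Longrightarrow> n \<ge> M \<Longrightarrow> dist (z m) (z n) < e"
          using metric_CauchyD[OF \<open>Cauchy z\<close>] by blast
        then have "\<forall>m\<ge>M. \<forall>n\<ge>M. dist (f m) (f n) < e"
          using norm_le_norm_add(1)[OF memD(4)[OF fh(1) fh(1)]] unfolding d dist_norm by (meson order_le_less_trans)
        then show "\<exists>M. \<forall>m\<ge>M. \<forall>n\<ge>M. dist (f m) (f n) < e" by blast
      qed
      show "Cauchy h"
      proof (rule metric_CauchyI)
        fix e :: real assume "e > 0"
        then obtain M where "\<And>m n. m \<ge> M \<Longrightarrow> n \<ge> M \<Longrightarrow> dist (z m) (z n) < e"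
          using metric_CauchyD[OF \<open>Cauchy z\<close>] by blast
        then have "\<forall>m\<ge>M. \<forall>n\<ge>M. dist (h m) (h n) < e"
          using norm_le_norm_add(2)[OF memD(4)[OF fh(1) fh(1)]] unfolding d dist_norm by (meson order_le_less_trans)
        then show "\<exists>M. \<forall>m\<ge>M. \<forall>n\<ge>M. dist (h m) (h n) < e" by blast
      qed
    qed
    then obtain u v where uv: "f \<longlonglongrightarrow> u" "h \<longlonglongrightarrow> v"
      by (auto dest!: Cauchy_convergent simp: convergent_def)
    have "(u, v) \<in> G" by (rule self_adjoint_closed_graph[OF self_adjoint fh(1) uv])
    moreover have "l = u + v"
      by (rule LIMSEQ_unique[OF l]) (use tendsto_add[OF uv] in \<open>simp add: fh(2)[abs_def]\<close>)
    ultimately show "l \<in> R" unfolding R_def by blast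
  qed
  moreover have "u = 0" if u: "\<And>s. s \<in> R \<Longrightarrow> inner u s = 0" for u
  proof (rule ccontr)
    assume "u \<noteq> 0"
    have "(u, - u) \<in> G"
    proof (rule self_adjoint_memberI[OF self_adjoint])
      fix f h assume fh: "(f, h) \<in> G"
      have "(\<i> *\<^sub>C f, \<i> *\<^sub>C h) \<in> G" using fh by (rule memD(5))
      then have "f + h \<in> R" "\<i> *\<^sub>C (f + h) \<in> R"
        using fh unfolding R_def scaleC_add_right by blast+
      then have "inner u (f + h) = 0" "inner u (\<i> *\<^sub>C (f + h)) = 0" by (auto intro: u)
      then have "cinner u (f + h) = 0" by (simp add: cinner_eq_Complex complex_eq_iff)
      then have "cinner (f + h) u = 0" by (metis cinner_commute complex_cnj_zero)
      then show "cinner h u = cinner f (- u)"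
        by (simp add: cinner_add_left cinner_minus_right add_eq_0_iff)
    qed
    from inner_pos[OF this \<open>u \<noteq> 0\<close>] show False
      using inner_ge_zero[of u] unfolding inner_minus_left by linarith
  qed
  ultimately have "R = UNIV" using closed_subspace_has_orthogonal by metis
  then show ?thesis unfolding R_def by blast
qed

definition resolvent :: "'a \<Rightarrow> 'a" where
  "resolvent z = (THE f. (f, z - f) \<in> G)"

lemma resolvent_eq:
  assumes "(f, h) \<in> G"
  shows "resolvent (f + h) = f"
  unfolding resolvent_def
proof (rule the_equality)
  show "(f, f + h - f) \<in> G" using assms by simp
  show "f' = f" if "(f', f + h - f') \<in> G" for f'
    using add_inj[OF that assms] by simp
qed

lemma resolvent_mem: "(resolvent z, z - resolvent z) \<in> G"
  using range_1_plus[of z] resolvent_eq by fastforce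

sublocale complex_positive_contraction resolvent
proof
  have add: "resolvent (x + y) = resolvent x + resolvent y" for x y
    using resolvent_eq[OF memD(3)[OF resolvent_mem[of x] resolvent_mem[of y]]] by simp
  show scaleC: "resolvent (c *\<^sub>C x) = c *\<^sub>C resolvent x" for c x
    using resolvent_eq[OF memD(5)[OF resolvent_mem[of x], of c]] by (simp add: scaleC_add_right[symmetric])
  show "resolvent (x + y) = resolvent x + resolvent y" for x y by (rule add)
  show "resolvent (r *\<^sub>R x) = r *\<^sub>R resolvent x" for r x by (simp add: scaleR_eq_scaleC scaleC)
  show "inner (resolvent x) y = inner x (resolvent y)" for x y
  proof -
    have "cinner (y - resolvent y) (resolvent x) = cinner (resolvent y) (x - resolvent x)"
      by (rule self_adjoint_symmetric[OF self_adjoint resolvent_mem resolvent_mem])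
    then have "cinner y (resolvent x) = cinner (resolvent y) x"
      by (simp add: cinner_diff_left cinner_diff_right)
    then show ?thesis by (metis inner_commute inner_eq_Re_cinner)
  qed
  show "0 \<le> inner (resolvent x) x" for x
    using inner_nonneg[OF resolvent_mem[of x]] inner_ge_zero[of "resolvent x"]
    unfolding inner_diff_left inner_commute[of x] by linarith
  show "inner (resolvent x) x \<le> inner x x" for x
    using inner_nonneg[OF resolvent_mem[of x]] inner_ge_zero[of "x - resolvent x"]
    unfolding inner_diff_left inner_diff_right inner_commute[of x "resolvent x"] by linarith
  show "x = 0" if "resolvent x = 0" for x
    using resolvent_mem[of x] memD(1)[OF memD(2)] that by simp
  show "x = 0" if "resolvent x = x" for x
    using inner_pos[OF resolvent_mem[of x]] that by fastforce
qed

text \<open>With \<open>A\<close> the resolvent, \<open>f = A z\<close> has \<open>G f = (1 - A) z\<close>, and \<open>exp (logit t) * t = 1 - t\<close> almost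
  everywhere. So \<open>G\<close> is contained in the exponential of \<open>logit(A)\<close>, and both are self-adjoint.\<close>

lemma eq_exp: "G = fop (\<lambda>t. exp (logit t))"
proof (rule self_adjoint_maximal[OF self_adjoint self_adjoint_fop])
  show m: "(\<lambda>t. exp (logit t)) \<in> borel_measurable borel" by measurable
  show "G \<subseteq> fop (\<lambda>t. exp (logit t))"
  proof safe
    fix f h assume fh: "(f, h) \<in> G"
    define z where "z = f + h"
    have f: "resolvent z = f" unfolding z_def by (rule resolvent_eq[OF fh])
    have id: "(\<lambda>t. t) = poly [:0, 1 :: real:]" by auto
    have fz: "fcalc (\<lambda>t. t) z = f" unfolding id fcalc_poly by (simp add: f)
    have ae: "AE t in moment_measure z. exp (logit t) * t = poly [:1, -1:] t"
      using AE_open_unit_interval[of z] by eventually_elim (simp add: exp_logit)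
    have l2: "in_l2 z (\<lambda>t. exp (logit t) * t)"
    proof (rule sq_integrable_bound[OF in_l2_poly])
      show "(\<lambda>t. exp (logit t) * t) \<in> borel_measurable (moment_measure z)"
        using m by simp
      show "AE t in moment_measure z. \<bar>exp (logit t) * t\<bar> \<le> \<bar>poly [:1, -1:] t\<bar>"
        using ae by eventually_elim simp
    qed
    have "fcalc (\<lambda>t. exp (logit t) * t) z = peval [:1, -1:] z"
      unfolding fcalc_poly[symmetric] by (rule fcalc_cong_AE[OF l2 in_l2_poly ae])
    also have "\<dots> = z - f" by (simp add: f linear_neg[OF linear_A])
    also have "\<dots> = h" by (simp add: z_def)
    finally have h: "fcalc (\<lambda>t. exp (logit t) * t) z = h" .
    have "fcalc (\<lambda>t. exp (logit t)) (fcalc (\<lambda>t. t) z) = fcalc (\<lambda>t. exp (logit t) * t) z"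
      "in_l2 (fcalc (\<lambda>t. t) z) (\<lambda>t. exp (logit t))"
      by (rule fcalc_fcalc[OF _ _ m l2, of 1]; simp)+
    then show "(f, h) \<in> fop (\<lambda>t. exp (logit t))"
      by (simp add: fz h fop_iff)
  qed
qed

abbreviation root :: "'a rel" where
  "root \<equiv> fop (\<lambda>t. exp (logit t / 2))"

abbreviation root_app :: "'a \<Rightarrow> 'a" where
  "root_app \<equiv> fcalc (\<lambda>t. exp (logit t / 2))"

lemma root_measurable: "(\<lambda>t. exp (logit t / 2)) \<in> borel_measurable borel"
  by measurable

lemma self_adjoint_root: "self_adjoint root"
  by (rule self_adjoint_fop[OF root_measurable])

lemma norm_root:
  assumes "(u, v) \<in> G"
  shows "(u, root_app u) \<in> root" and "(norm (root_app u))\<^sup>2 = inner v u"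
proof -
  have u: "in_l2 u (\<lambda>t. exp (logit t))" and v: "v = fcalc (\<lambda>t. exp (logit t)) u"
    using equalityD1[OF eq_exp, THEN subsetD, OF assms] by (simp_all add: fop_iff)
  have sq: "(exp (logit t / 2))\<^sup>2 = exp (logit t)" for t
    by (simp add: exp_double[symmetric])
  have "in_l2 u (\<lambda>_. 1)" by (rule in_l2_bounded[of _ 1]) auto
  from sq_integrable_mult[OF u this]
  have l2: "in_l2 u (\<lambda>t. exp (logit t / 2))"
    unfolding sq_integrable_def sq using root_measurable by simp
  then show "(u, root_app u) \<in> root" by (simp add: fop_iff)
  show "(norm (root_app u))\<^sup>2 = inner v u"
    by (simp add: norm_fcalc[OF l2] sq v inner_fcalc_self[OF u])
qed

lemma root_diff:
  assumes "(u, v) \<in> G" "(u', v') \<in> G"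
  shows "root_app (u - u') = root_app u - root_app u'"
  using linear_operatorD(4)[OF linear_operator_fop[OF root_measurable] norm_root(1)[OF assms(1)] norm_root(1)[OF assms(2)]]
  by (simp add: fop_iff)

text \<open>Polarization of \<open>norm_root\<close>.\<close>

lemma inner_root:
  assumes u: "(u, v) \<in> G" and w: "(w, y) \<in> G"
  shows "inner (root_app u) (root_app w) = inner v w"
proof -
  have d: "(u - w, v - y) \<in> G" by (rule memD(4)[OF u w])
  have "inner y u = inner w v"
    using self_adjoint_symmetric[OF self_adjoint w u] by (simp add: inner_eq_Re_cinner)
  then have "(norm (root_app u - root_app w))\<^sup>2
      = (norm (root_app u))\<^sup>2 + (norm (root_app w))\<^sup>2 - 2 * inner v w"
    using norm_root(2)[OF d]
    by (simp add: root_diff[OF u w] norm_root(2)[OF u] norm_root(2)[OF w] inner_diff_left inner_diff_right inner_commute)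
  then show ?thesis
    by (simp add: power2_norm_eq_inner inner_diff_left inner_diff_right inner_commute)
qed

lemma cinner_root:
  assumes u: "(u, v) \<in> G" and w: "(w, y) \<in> G"
  shows "cinner (root_app u) (root_app w) = cinner v w"
proof -
  have iw: "(\<i> *\<^sub>C w, \<i> *\<^sub>C y) \<in> G" by (rule memD(5)[OF w])
  have "in_l2 w (\<lambda>t. exp (logit t / 2))" using norm_root(1)[OF w] by (simp add: fop_iff)
  then have "root_app (\<i> *\<^sub>C w) = \<i> *\<^sub>C root_app w" by (rule fcalc_scaleC)
  then show ?thesis
    using inner_root[OF u w] inner_root[OF u iw] by (simp add: cinner_eq_Complex)
qed

lemma energy_norm_eq:
  assumes "u \<in> Domain G"
  shows "energy_norm G u = norm (root_app u)"
proof -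
  obtain v where v: "(u, v) \<in> G" using assms by blast
  have "energy_norm G u = sqrt (inner v u)"
    by (simp add: energy_norm_def op_app_eq[OF linear_operator v] inner_eq_Re_cinner)
  then show ?thesis by (simp flip: norm_root(2)[OF v])
qed

text \<open>On \<open>D(G)\<close> the energy norm is the norm of \<open>\<surd>G f\<close>, so energy-Cauchy sequences have Cauchy images
  under \<open>\<surd>G\<close>, and \<open>\<surd>G\<close> is closed.\<close>

lemma energy_represents_root:
  assumes X: "energy_represents G X g"
  shows "(g, root_app g) \<in> root" and "(\<lambda>n. root_app (X n)) \<longlonglongrightarrow> root_app g"
proof -
  have dom: "X n \<in> Domain G" for n using X by (simp add: energy_represents_def energy_Cauchy_def)
  have diff: "X m - X n \<in> Domain G" "root_app (X m - X n) = root_app (X m) - root_app (X n)" for m n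
    using dom[of m] dom[of n] memD(4) root_diff by blast+
  have "Cauchy (\<lambda>n. root_app (X n))"
  proof (rule metric_CauchyI)
    fix e :: real assume "e > 0"
    then obtain M where "\<And>m n. m \<ge> M \<Longrightarrow> n \<ge> M \<Longrightarrow> energy_norm G (X m - X n) < e"
      using X unfolding energy_represents_def energy_Cauchy_def by blast
    then show "\<exists>M. \<forall>m\<ge>M. \<forall>n\<ge>M. dist (root_app (X m)) (root_app (X n)) < e"
      by (intro exI[of _ M]) (simp add: energy_norm_eq diff dist_norm)
  qed
  then obtain y where y: "(\<lambda>n. root_app (X n)) \<longlonglongrightarrow> y"
    using Cauchy_convergent convergent_def by blast
  have "(X n, root_app (X n)) \<in> root" for n using dom[of n] norm_root(1) by blast
  moreover have "X \<longlonglongrightarrow> g" using X by (simp add: energy_represents_def)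
  ultimately have "(g, y) \<in> root"
    by (intro self_adjoint_closed_graph[OF self_adjoint_root _ _ y])
  then show "(g, root_app g) \<in> root" "(\<lambda>n. root_app (X n)) \<longlonglongrightarrow> root_app g"
    using y by (auto simp: fop_iff)
qed

text \<open>This identifies distances in the completion with distances of the images under \<open>\<surd>G\<close>.\<close>

lemma energy_dist_eq:
  assumes X: "energy_represents G X g" and u: "u \<in> Domain G"
  shows "energy_dist G X (\<lambda>_. u) = norm (root_app g - root_app u)"
proof -
  have dom: "X n \<in> Domain G" for n using X by (simp add: energy_represents_def energy_Cauchy_def)
  have "energy_norm G (X n - u) = norm (root_app (X n) - root_app u)" for n
  proof -
    have "X n - u \<in> Domain G" "root_app (X n - u) = root_app (X n) - root_app u"
      using dom[of n] u memD(4) root_diff by blast+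
    then show ?thesis by (simp add: energy_norm_eq)
  qed
  moreover have "(\<lambda>n. norm (root_app (X n) - root_app u)) \<longlonglongrightarrow> norm (root_app g - root_app u)"
    by (intro tendsto_intros energy_represents_root(2)[OF X])
  ultimately show ?thesis unfolding energy_dist_def by (simp add: limI)
qed

end

section \<open>Operators of C-symmetry\<close>

locale J_positive_self_adjoint = positive_self_adjoint G
  for G :: "'a::complex_hilbert rel" +
  fixes J :: "'a \<Rightarrow> 'a"
  assumes J: "fundamental_symmetry J"
    and J_inverse: "(f, h) \<in> G \<Longrightarrow> (J h, J f) \<in> G"
begin

lemma J_add: "J (x + y) = J x + J y"
  and J_scaleC: "J (c *\<^sub>C x) = c *\<^sub>C J x"
  and bounded_linear_J: "bounded_linear J"
  and J_symmetric: "cinner (J x) y = cinner x (J y)"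
  and J_J [simp]: "J (J x) = x"
  using J by (auto simp: fundamental_symmetry_def clinear_map_def)

lemma linear_J: "linear J"
  by (rule bounded_linear.linear[OF bounded_linear_J])

lemma J_simps: "J 0 = 0" "J (- x) = - J x" "J (x - y) = J x - J y" "J (r *\<^sub>R x) = r *\<^sub>R J x"
  using linear_J by (simp_all add: linear_0 linear_neg linear_diff linear_scale)

lemma norm_J: "norm (J x) = norm x"
proof -
  have "cinner (J x) (J x) = cinner x x" by (simp add: J_symmetric)
  then have "(norm (J x))\<^sup>2 = (norm x)\<^sup>2" by (simp only: cinner_self of_real_eq_iff)
  then show ?thesis by (rule power2_eq_imp_eq) auto
qed

lemma resolvent_J: "resolvent (J z) = J (z - resolvent z)"
  using resolvent_eq[OF J_inverse[OF resolvent_mem[of z]]] by (simp add: J_simps)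

text \<open>\<open>J\<close> reflects the spectrum of the resolvent at \<open>1/2\<close>, hence the spectrum of its logit at \<open>0\<close>.\<close>

lemma anticommutes_log: "anticommutes J (fop logit)"
proof -
  have refl: "(J x, - J y) \<in> fop logit" if "(x, y) \<in> fop logit" for x y
  proof -
    have x: "in_l2 x logit" "y = fcalc logit x" using that by (auto simp: fop_iff)
    have e: "(\<lambda>t. logit (poly [:1, -1:] t)) = (\<lambda>t. (- 1) * logit t)"
      using logit_reflect by (simp add: fun_eq_iff)
    have l2: "in_l2 x (\<lambda>t. logit (poly [:1, -1:] t))"
      unfolding e by (rule sq_integrable_cmult[OF x(1)])
    have s: "resolvent (J z) = J (peval [:1, -1:] z)" for z
      by (simp add: resolvent_J linear_neg[OF linear_A])
    have "fcalc logit (J x) = J (fcalc (\<lambda>t. logit (poly [:1, -1:] t)) x)" "in_l2 (J x) logit"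
      by (rule fcalc_intertwining[OF bounded_linear_J s _ logit_measurable l2]; simp)+
    moreover have "fcalc (\<lambda>t. (- 1) * logit t) x = - y"
      by (subst fcalc_cmult[OF x(1)]) (simp add: x(2))
    ultimately show ?thesis by (simp only: e fop_iff J_simps)
  qed
  show ?thesis
    unfolding anticommutes_def map_op_def
  proof (intro set_eqI iffI)
    fix p assume "p \<in> {(f, J h) |f h. (f, h) \<in> fop logit}"
    then obtain f h where "p = (f, J h)" "(f, h) \<in> fop logit" by blast
    then have "p = (f, - (- J h))" "(J f, - J h) \<in> fop logit" using refl by auto
    then show "p \<in> {(f, - h) |f h. (J f, h) \<in> fop logit}" by blast
  next
    fix p assume "p \<in> {(f, - h) |f h. (J f, h) \<in> fop logit}"
    then obtain f h where p: "p = (f, - h)" "(J f, h) \<in> fop logit" by blast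
    from refl[OF p(2)] have "(f, - J h) \<in> fop logit" by simp
    moreover have "p = (f, J (- J h))" by (simp add: p J_simps)
    ultimately show "p \<in> {(f, J h) |f h. (f, h) \<in> fop logit}" by blast
  qed
qed

lemma csubspace_graph_eigen:
  assumes "\<And>x y. T (x + y) = T x + T y" "\<And>c x. T (c *\<^sub>C x) = c *\<^sub>C T x" "T 0 = 0"
  shows "csubspace {f. (f, T f) \<in> G}"
proof (rule cvec.subspaceI)
  show "0 \<in> {f. (f, T f) \<in> G}" using memD(2) by (simp only: assms(3) mem_Collect_eq)
  fix x assume x: "x \<in> {f. (f, T f) \<in> G}"
  show "x + y \<in> {f. (f, T f) \<in> G}" if "y \<in> {f. (f, T f) \<in> G}" for y
    using memD(3)[of x "T x" y "T y"] x that by (simp only: assms(1) mem_Collect_eq)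
  show "c *\<^sub>C x \<in> {f. (f, T f) \<in> G}" for c
    using memD(5)[of x "T x" c] x by (simp only: assms(2) mem_Collect_eq)
qed

lemma closed_graph_eigen:
  assumes "bounded_linear T"
  shows "closed {f. (f, T f) \<in> G}"
  unfolding closed_sequential_limits
proof (intro allI impI, elim conjE, rule CollectI)
  fix X l assume X: "\<forall>n. X n \<in> {f. (f, T f) \<in> G}" "X \<longlonglongrightarrow> l"
  show "(l, T l) \<in> G"
    by (rule self_adjoint_closed_graph[OF self_adjoint _ X(2) bounded_linear.tendsto[OF assms X(2)]])
       (use X(1) in simp)
qed

definition eigen_plus :: "'a set" where "eigen_plus = {f. (f, J f) \<in> G}"
definition eigen_minus :: "'a set" where "eigen_minus = {f. (f, - J f) \<in> G}"

lemma positive_eigen_plus: "positive_subspace J eigen_plus"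
  unfolding positive_subspace_def
proof (intro conjI ballI impI)
  show "csubspace eigen_plus"
    unfolding eigen_plus_def by (rule csubspace_graph_eigen) (simp_all add: J_add J_scaleC J_simps)
  show "closed eigen_plus"
    unfolding eigen_plus_def by (rule closed_graph_eigen[OF bounded_linear_J])
  show "0 < Re (indef J f f)" if "f \<in> eigen_plus" "f \<noteq> 0" for f
    using inner_pos[of f "J f"] that by (simp add: eigen_plus_def indef_def inner_eq_Re_cinner)
qed

lemma negative_eigen_minus: "negative_subspace J eigen_minus"
  unfolding negative_subspace_def
proof (intro conjI ballI impI)
  show "csubspace eigen_minus"
    unfolding eigen_minus_def
  proof (rule csubspace_graph_eigen)
    show "- J (c *\<^sub>C x) = c *\<^sub>C - J x" for c x
      using cvec.scale_minus_right[of c "J x"] by (simp add: J_scaleC)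
  qed (simp_all add: J_add J_simps)
  show "closed eigen_minus"
    unfolding eigen_minus_def by (rule closed_graph_eigen[OF bounded_linear_minus[OF bounded_linear_J]])
  show "Re (indef J f f) < 0" if "f \<in> eigen_minus" "f \<noteq> 0" for f
    using inner_pos[of f "- J f"] that
    by (simp add: eigen_minus_def indef_def inner_eq_Re_cinner cinner_minus_left)
qed

lemma definite_subspace_diff:
  "positive_subspace J M \<or> negative_subspace J M \<Longrightarrow> x \<in> M \<Longrightarrow> y \<in> M \<Longrightarrow> x - y \<in> M"
  unfolding positive_subspace_def negative_subspace_def by (auto intro: cvec.subspace_diff)

text \<open>For \<open>m\<close> in a larger positive subspace, the resolvent maps \<open>z = m + J m\<close> to an element \<open>l\<close> of
  the eigenspace, since \<open>J z = z\<close>. It has \<open>l + J l = z\<close>, so \<open>d = m - l\<close> satisfies \<open>J d = - d\<close> and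
  \<open>[d, d] = - \<parallel>d\<parallel>\<^sup>2\<close>. In a positive subspace this forces \<open>d = 0\<close>.\<close>

lemma maximal_positive_eigen_plus: "maximal_positive J eigen_plus"
  unfolding maximal_positive_def
proof (intro conjI positive_eigen_plus notI, elim exE conjE)
  fix M assume M: "positive_subspace J M" and sub: "eigen_plus \<subset> M"
  have "m \<in> eigen_plus" if m: "m \<in> M" for m
  proof -
    define z where "z = m + J m"
    define l where "l = resolvent z"
    have "J z = z" by (simp add: z_def J_add add.commute)
    then have "l = J (z - l)" using resolvent_J[of z] by (simp add: l_def)
    then have zl: "z - l = J l" by (metis J_J)
    have lG: "(l, J l) \<in> G" using resolvent_mem[of z] zl by (simp add: l_def)
    then have l: "l \<in> eigen_plus" by (simp add: eigen_plus_def)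
    have d: "m - l \<in> M" using definite_subspace_diff M m l sub by blast
    have Jd: "J (m - l) = - (m - l)" using zl by (simp add: J_simps z_def algebra_simps)
    have "Re (indef J (m - l) (m - l)) = - (norm (m - l))\<^sup>2"
      unfolding indef_def Jd cinner_minus_left cinner_self by simp
    then have "m - l = 0" using M d unfolding positive_subspace_def by force
    then show ?thesis using l by simp
  qed
  then show False using sub by blast
qed

text \<open>The same argument with \<open>z = m - J m\<close>, for which \<open>J z = - z\<close>.\<close>

lemma maximal_negative_eigen_minus: "maximal_negative J eigen_minus"
  unfolding maximal_negative_def
proof (intro conjI negative_eigen_minus notI, elim exE conjE)
  fix M assume M: "negative_subspace J M" and sub: "eigen_minus \<subset> M"
  have "m \<in> eigen_minus" if m: "m \<in> M" for m
  proof -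
    define z where "z = m - J m"
    define l where "l = resolvent z"
    have "J z = - z" by (simp add: z_def J_simps)
    then have "- l = J (z - l)" using resolvent_J[of z] by (simp add: l_def linear_neg[OF linear_A])
    then have zl: "z - l = - J l" by (metis J_J J_simps(2))
    have lG: "(l, - J l) \<in> G" using resolvent_mem[of z] zl by (simp add: l_def)
    then have l: "l \<in> eigen_minus" by (simp add: eigen_minus_def)
    have d: "m - l \<in> M" using definite_subspace_diff M m l sub by blast
    have Jd: "J (m - l) = m - l" using zl by (simp add: J_simps z_def algebra_simps)
    have "Re (indef J (m - l) (m - l)) = (norm (m - l))\<^sup>2"
      unfolding indef_def Jd cinner_self by simp
    then have "m - l = 0" using M d unfolding negative_subspace_def by force
    then show ?thesis using l by simp
  qed
  then show False using sub by blast
qed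

text \<open>Since \<open>C = J G\<close> is an involution of \<open>D(G)\<close>, every \<open>f\<close> splits as
  \<open>(f + C f) / 2 + (f - C f) / 2\<close>.\<close>

lemma C_op_eigen: "C_op eigen_plus eigen_minus = map_op J G"
proof (intro set_eqI iffI)
  fix p assume "p \<in> C_op eigen_plus eigen_minus"
  then obtain u v where p: "p = (u + v, u - v)" and "(u, J u) \<in> G" "(v, - J v) \<in> G"
    by (auto simp: C_op_def eigen_plus_def eigen_minus_def)
  then have "(u + v, J u + - J v) \<in> G" using memD(3) by blast
  moreover have "p = (u + v, J (J u + - J v))" by (simp add: p J_simps)
  ultimately show "p \<in> map_op J G" unfolding map_op_def by blast
next
  fix p assume "p \<in> map_op J G"
  then obtain f h where p: "p = (f, J h)" and fh: "(f, h) \<in> G" by (auto simp: map_op_def)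
  have Jfh: "(J h, J f) \<in> G" by (rule J_inverse[OF fh])
  define u v where "u = (1/2) *\<^sub>R (f + J h)" and "v = (1/2) *\<^sub>R (f - J h)"
  have "((1/2) *\<^sub>R (f + J h), (1/2) *\<^sub>R (h + J f)) \<in> G" "((1/2) *\<^sub>R (f - J h), (1/2) *\<^sub>R (h - J f)) \<in> G"
    by (rule memD(6)[OF memD(3)[OF fh Jfh]]) (rule memD(6)[OF memD(4)[OF fh Jfh]])
  moreover have "J u = (1/2) *\<^sub>R (h + J f)" "- J v = (1/2) *\<^sub>R (h - J f)"
    by (simp_all add: u_def v_def J_simps J_add algebra_simps)
  ultimately have "u \<in> eigen_plus" "v \<in> eigen_minus"
    by (simp_all only: u_def v_def eigen_plus_def eigen_minus_def mem_Collect_eq)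
  moreover have "p = (u + v, u - v)"
    by (simp add: p u_def v_def scaleR_add_right[symmetric] scaleR_diff_right[symmetric] flip: scaleR_2)
  ultimately show "p \<in> C_op eigen_plus eigen_minus" unfolding C_op_def by blast
qed

lemma C_symmetry_map_op: "C_symmetry J (map_op J G)"
  unfolding C_symmetry_def
proof (intro exI conjI)
  show "dual_maximal_definite J eigen_plus eigen_minus"
    unfolding dual_maximal_definite_def dual_definite_def
  proof (intro conjI ballI positive_eigen_plus negative_eigen_minus
      maximal_positive_eigen_plus maximal_negative_eigen_minus)
    fix f g assume "f \<in> eigen_plus" "g \<in> eigen_minus"
    then have "cinner (J f) g = cinner f (- J g)"
      by (intro self_adjoint_symmetric[OF self_adjoint]) (auto simp: eigen_plus_def eigen_minus_def)
    also have "\<dots> = - cinner (J f) g" by (simp add: cinner_minus_right J_symmetric)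
    finally show "indef J f g = 0" by (simp add: indef_def)
  qed
  show "map_op J G = C_op eigen_plus eigen_minus" by (simp add: C_op_eigen)
  have "Domain (map_op J G) = Domain G" by (auto simp: map_op_def)
  then show "closure (Domain (C_op eigen_plus eigen_minus)) = UNIV"
    using self_adjoint by (simp add: C_op_eigen self_adjoint_def)
qed

end

section \<open>Fourier series of orthonormal sequences\<close>

lemma cinner_sum_left: "cinner (\<Sum>i\<in>I. f i) y = (\<Sum>i\<in>I. cinner (f i) y)"
  by (induction I rule: infinite_finite_induct) (simp_all add: cinner_add_left)

lemma cspan_closure_add:
  assumes "u \<in> closure (cspan B)" "v \<in> closure (cspan B)"
  shows "u + v \<in> closure (cspan B)"
proof -
  obtain x y where "\<And>n. x n \<in> cspan B" "x \<longlonglongrightarrow> u" "\<And>n. y n \<in> cspan B" "y \<longlonglongrightarrow> v"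
    using assms unfolding closure_sequential by blast
  then have "\<And>n. x n + y n \<in> cspan B" "(\<lambda>n. x n + y n) \<longlonglongrightarrow> u + v"
    by (auto intro: cvec.span_add tendsto_add)
  then show ?thesis
    unfolding closure_sequential by (intro exI[of _ "\<lambda>n. x n + y n"]) simp
qed

locale orthonormal_sequence =
  fixes e :: "nat \<Rightarrow> 'a::complex_hilbert"
  assumes orthonormal: "cinner (e n) (e m) = (if n = m then 1 else 0)"
begin

definition partial :: "nat \<Rightarrow> 'a \<Rightarrow> 'a" where
  "partial N x = (\<Sum>n<N. cinner x (e n) *\<^sub>C e n)"

lemma partial_add: "partial N (x + y) = partial N x + partial N y"
  by (simp add: partial_def cinner_add_left scaleC_add_left sum.distrib)

lemma partial_scaleC: "partial N (c *\<^sub>C x) = c *\<^sub>C partial N x"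
  by (simp add: partial_def cinner_scaleC_left cvec.scale_sum_right)

lemma partial_diff: "partial N (x - y) = partial N x - partial N y"
  using partial_add[of N "x - y" y] by (simp add: algebra_simps)

text \<open>The partial sum is the orthogonal projection to the span of the first \<open>N\<close> vectors.\<close>

lemma norm_minus_partial: "norm (x - partial N x) \<le> norm x"
proof -
  have "cinner (partial N x) (e m) = cinner x (e m)" if "m < N" for m
    using that by (simp add: partial_def cinner_sum_left cinner_scaleC_left orthonormal sum.delta if_distrib cong: if_cong)
  then have orth: "cinner (e m) (x - partial N x) = 0" if "m < N" for m
    using that by (metis cinner_commute cinner_diff_left complex_cnj_zero diff_self)
  have "cinner (partial N x) (x - partial N x) = 0"
    by (subst partial_def) (simp add: cinner_sum_left cinner_scaleC_left orth)
  then have "inner (partial N x) (x - partial N x) = 0" by (simp add: inner_eq_Re_cinner)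
  then have "(norm x)\<^sup>2 = (norm (x - partial N x))\<^sup>2 + (norm (partial N x))\<^sup>2"
    by (simp add: power2_norm_eq_inner inner_diff_left inner_diff_right inner_commute)
  then have "(norm (x - partial N x))\<^sup>2 \<le> (norm x)\<^sup>2" by simp
  then show ?thesis by (rule power2_le_imp_le) simp
qed

lemma eventually_partial_span:
  assumes "w \<in> cspan (range e)"
  shows "\<forall>\<^sub>F N in sequentially. partial N w = w"
  using assms
proof (induction rule: cvec.span_induct_alt)
  case base
  then show ?case by (simp add: partial_def)
next
  case (step c x y)
  then obtain i where i: "x = e i" by blast
  have "partial N x = x" if "N > i" for N
    using that by (simp add: partial_def i orthonormal sum.delta if_distrib[of "\<lambda>c. c *\<^sub>C _"] cong: if_cong)
  then have "\<forall>\<^sub>F N in sequentially. partial N x = x"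
    by (intro eventually_sequentiallyI[of "Suc i"]) simp
  with step(2) show ?case
    by eventually_elim (simp add: partial_add partial_scaleC)
qed

text \<open>The partial sums fix every \<open>w\<close> in the span eventually, and \<open>v - w\<close> is changed by at most its
  norm, so approximation of \<open>v\<close> by such \<open>w\<close> is enough.\<close>

lemma fourier_sums:
  assumes v: "v \<in> closure (cspan (range e))"
  shows "(\<lambda>n. cinner v (e n) *\<^sub>C e n) sums v"
proof -
  have "(\<lambda>N. partial N v) \<longlonglongrightarrow> v"
  proof (rule metric_LIMSEQ_I)
    fix r :: real assume "r > 0"
    then obtain w where w: "w \<in> cspan (range e)" "dist w v < r"
      using v closure_approachable by blast
    obtain N0 where N0: "\<And>N. N \<ge> N0 \<Longrightarrow> partial N w = w"
      using eventually_partial_span[OF w(1)] by (auto simp: eventually_sequentially)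
    have "dist (partial N v) v < r" if "N \<ge> N0" for N
    proof -
      have "(v - w) - partial N (v - w) = v - partial N v"
        unfolding partial_diff N0[OF that] by simp
      then have "norm (v - partial N v) \<le> norm (v - w)"
        using norm_minus_partial[of "v - w" N] by (simp only:)
      then show ?thesis using w(2) by (simp add: dist_norm norm_minus_commute)
    qed
    then show "\<exists>N0. \<forall>N\<ge>N0. dist (partial N v) v < r" by blast
  qed
  then show ?thesis by (simp add: sums_def partial_def)
qed

end

section \<open>Quasi bases\<close>

locale quasi_basis_operator = J_positive_self_adjoint G J
  for G :: "'a::complex_hilbert rel" and J +
  fixes f :: "nat \<Rightarrow> 'a"
  assumes J_orthonormal: "J_orthonormal J f"
    and extends: "map_op J (C_op (L_plus J f) (L_minus J f)) \<subseteq> G"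
    and dense: "energy_dense G (Domain (C_op (L_plus J f) (L_minus J f)))"
begin

lemma zero_in_L: "0 \<in> L_plus J f" "0 \<in> L_minus J f"
  unfolding L_plus_def L_minus_def
  by (rule subsetD[OF closure_subset cvec.span_zero])+

lemma L_plus_graph: "u \<in> L_plus J f \<Longrightarrow> (u, J u) \<in> G"
proof -
  assume "u \<in> L_plus J f"
  then have "(u + 0, u - 0) \<in> C_op (L_plus J f) (L_minus J f)"
    using zero_in_L unfolding C_op_def by blast
  then show "(u, J u) \<in> G" using extends unfolding map_op_def by auto
qed

lemma L_minus_graph: "v \<in> L_minus J f \<Longrightarrow> (v, - J v) \<in> G"
proof -
  assume "v \<in> L_minus J f"
  then have "(0 + v, 0 - v) \<in> C_op (L_plus J f) (L_minus J f)"
    using zero_in_L unfolding C_op_def by blast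
  then have "(v, - v) \<in> C_op (L_plus J f) (L_minus J f)" by simp
  then have "(v, J (- v)) \<in> G" using extends unfolding map_op_def by blast
  then show "(v, - J v) \<in> G" by (simp add: J_simps)
qed

text \<open>The number \<open>[f\<^sub>n, f\<^sub>n]\<close>, which is \<open>1\<close> or \<open>- 1\<close>; it decides to which of the two subspaces
  \<open>f\<^sub>n\<close> belongs.\<close>

definition sign :: "nat \<Rightarrow> real" where
  "sign n = Re (indef J (f n) (f n))"

lemma indef_self: "indef J (f n) (f n) = of_real (sign n)" "sign n = 1 \<or> sign n = - 1"
proof -
  have "indef J (f n) (f n) = cnj (indef J (f n) (f n))"
    unfolding indef_def by (metis J_symmetric cinner_commute)
  then show r: "indef J (f n) (f n) = of_real (sign n)"
    by (simp add: sign_def complex_eq_iff)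
  have "cmod (indef J (f n) (f n)) = 1" using J_orthonormal by (simp add: J_orthonormal_def)
  then have "\<bar>sign n\<bar> = 1" unfolding r by simp
  then show "sign n = 1 \<or> sign n = - 1" by linarith
qed

lemma f_in_L: "sign n = 1 \<Longrightarrow> f n \<in> L_plus J f" "sign n = - 1 \<Longrightarrow> f n \<in> L_minus J f"
  unfolding L_plus_def L_minus_def
  by (rule subsetD[OF closure_subset cvec.span_base]; use indef_self(1)[of n] in auto)+

lemma f_graph: "(f n, sign n *\<^sub>R J (f n)) \<in> G"
  using indef_self(2)[of n]
proof
  assume "sign n = 1"
  then show ?thesis using L_plus_graph[OF f_in_L(1)] by simp
next
  assume "sign n = - 1"
  then show ?thesis using L_minus_graph[OF f_in_L(2)] by simp
qed

lemma indef_f: "indef J (f n) (f m) = (if n = m then of_real (sign n) else 0)"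
proof (cases "n = m")
  case False
  then have "cmod (indef J (f n) (f m)) = 0" using J_orthonormal by (simp add: J_orthonormal_def)
  then show ?thesis using False by simp
qed (simp add: indef_self)

abbreviation root_f :: "nat \<Rightarrow> 'a" where
  "root_f n \<equiv> root_app (f n)"

sublocale orthonormal_sequence root_f
proof
  fix n m
  have "cinner (root_f n) (root_f m) = of_real (sign n) * indef J (f n) (f m)"
    unfolding cinner_root[OF f_graph f_graph] by (simp add: cinner_scaleR_left indef_def)
  also have "\<dots> = (if n = m then 1 else 0)"
    using indef_self(2)[of n] by (auto simp: indef_f)
  finally show "cinner (root_f n) (root_f m) = (if n = m then 1 else 0)" .
qed

lemma linear_operator_root: "linear_operator root"
  by (rule linear_operator_fop[OF root_measurable])

lemma f_root: "(f n, root_f n) \<in> root"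
  by (rule norm_root(1)[OF f_graph])

lemma root_span:
  assumes "w \<in> cspan (range f)"
  shows "(w, root_app w) \<in> root \<and> root_app w \<in> cspan (range root_f)"
  using assms
proof (induction rule: cvec.span_induct_alt)
  case base
  show ?case
    using linear_operatorD(2)[OF linear_operator_root] cvec.span_zero[of "range root_f"] by (auto simp: fop_iff)
next
  case (step c x y)
  then obtain i where i: "x = f i" by blast
  have y: "(y, root_app y) \<in> root" "root_app y \<in> cspan (range root_f)" using step(2) by simp_all
  have "(c *\<^sub>C x + y, c *\<^sub>C root_f i + root_app y) \<in> root"
    unfolding i
    by (rule linear_operatorD(3)[OF linear_operator_root linear_operatorD(5)[OF linear_operator_root f_root] y(1)])
  moreover from this have "root_app (c *\<^sub>C x + y) = c *\<^sub>C root_f i + root_app y"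
    by (simp add: fop_iff)
  moreover have "c *\<^sub>C root_f i + root_app y \<in> cspan (range root_f)"
    by (rule cvec.span_add[OF cvec.span_scale[OF cvec.span_base[OF rangeI]] y(2)])
  ultimately show ?case by simp
qed

text \<open>On each of the two subspaces \<open>(G u, u) = |[u, u]| \<le> \<parallel>u\<parallel>\<^sup>2\<close>, so that convergence in the Hilbert
  space implies convergence in the energy norm.\<close>

lemma root_closure_span:
  assumes u: "u \<in> closure (cspan B)" and B: "B \<subseteq> range f"
    and graph: "\<And>x. x \<in> closure (cspan B) \<Longrightarrow> (x, s *\<^sub>R J x) \<in> G" and s: "\<bar>s\<bar> = 1"
  shows "root_app u \<in> closure (cspan (range root_f))"
proof -
  obtain x where x: "\<And>n. x n \<in> cspan B" "x \<longlonglongrightarrow> u"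
    using u unfolding closure_sequential by blast
  have bound: "norm (root_app (x n) - root_app u) \<le> norm (x n - u)" for n
  proof (rule power2_le_imp_le)
    have xG: "(x n, s *\<^sub>R J (x n)) \<in> G" using graph x(1) closure_subset by blast
    have d: "(x n - u, s *\<^sub>R J (x n) - s *\<^sub>R J u) \<in> G" by (rule memD(4)[OF xG graph[OF u]])
    have "(norm (root_app (x n) - root_app u))\<^sup>2 = inner (s *\<^sub>R J (x n) - s *\<^sub>R J u) (x n - u)"
      using norm_root(2)[OF d] by (simp add: root_diff[OF xG graph[OF u]])
    also have "\<dots> = s * inner (J (x n - u)) (x n - u)"
      by (simp add: J_simps inner_diff_left algebra_simps)
    also have "\<dots> \<le> \<bar>s\<bar> * \<bar>inner (J (x n - u)) (x n - u)\<bar>"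
      by (metis abs_ge_self abs_mult)
    also have "\<dots> \<le> (norm (x n - u))\<^sup>2"
      using Cauchy_Schwarz_ineq2[of "J (x n - u)" "x n - u"] s by (simp add: norm_J power2_eq_square)
    finally show "(norm (root_app (x n) - root_app u))\<^sup>2 \<le> (norm (x n - u))\<^sup>2" .
  qed simp
  have "(\<lambda>n. root_app (x n)) \<longlonglongrightarrow> root_app u"
  proof (rule LIM_zero_cancel, rule Lim_null_comparison)
    show "\<forall>\<^sub>F n in sequentially. norm (root_app (x n) - root_app u) \<le> norm (x n - u)"
      using bound by (intro always_eventually allI)
    show "(\<lambda>n. norm (x n - u)) \<longlonglongrightarrow> 0"
      using tendsto_norm[OF LIM_zero[OF x(2)]] by simp
  qed
  moreover have "root_app (x n) \<in> cspan (range root_f)" for n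
    using root_span x(1)[of n] cvec.span_mono[OF B] by blast
  ultimately show ?thesis
    unfolding closure_sequential by (intro exI[of _ "\<lambda>n. root_app (x n)"]) simp
qed

lemma root_domain_C_op:
  assumes "d \<in> Domain (C_op (L_plus J f) (L_minus J f))"
  shows "root_app d \<in> closure (cspan (range root_f))"
proof -
  obtain u v where d: "d = u + v" and u: "u \<in> L_plus J f" and v: "v \<in> L_minus J f"
    using assms by (auto simp: C_op_def)
  have "root_app u \<in> closure (cspan (range root_f))"
    using u unfolding L_plus_def
    by (rule root_closure_span[where s=1]) (use L_plus_graph in \<open>auto simp: L_plus_def\<close>)
  moreover have "root_app v \<in> closure (cspan (range root_f))"
    using v unfolding L_minus_def
    by (rule root_closure_span[where s="-1"]) (use L_minus_graph in \<open>auto simp: L_minus_def\<close>)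
  moreover have "root_app d = root_app u + root_app v"
    using linear_operatorD(3)[OF linear_operator_root norm_root(1)[OF L_plus_graph[OF u]] norm_root(1)[OF L_minus_graph[OF v]]]
    by (simp add: fop_iff d)
  ultimately show ?thesis using cspan_closure_add by simp
qed

text \<open>The density of \<open>D(G\<^sub>0)\<close> in the energy space enters here.\<close>

lemma root_energetic_manifold:
  assumes X: "energy_represents G X g"
  shows "root_app g \<in> closure (cspan (range root_f))"
proof -
  have "root_app g \<in> closure (closure (cspan (range root_f)))"
    unfolding closure_approachable[of _ "closure _"]
  proof (intro allI impI)
    fix r :: real assume "r > 0"
    then obtain d where d: "d \<in> Domain (C_op (L_plus J f) (L_minus J f))" "energy_dist G X (\<lambda>_. d) < r"
      using dense X unfolding energy_dense_def energy_represents_def by blast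
    have "d \<in> Domain G" using d(1) dense by (auto simp: energy_dense_def)
    then have "dist (root_app d) (root_app g) < r"
      using d(2) by (simp add: energy_dist_eq[OF X] dist_norm norm_minus_commute)
    then show "\<exists>y\<in>closure (cspan (range root_f)). dist y (root_app g) < r"
      using root_domain_C_op[OF d(1)] by blast
  qed
  then show ?thesis by simp
qed

lemma C_f: "op_app (map_op J G) (f n) = sign n *\<^sub>R f n"
  unfolding op_app_def
proof (rule the_equality)
  have "(f n, J (sign n *\<^sub>R J (f n))) \<in> map_op J G"
    using f_graph unfolding map_op_def by blast
  then show "(f n, sign n *\<^sub>R f n) \<in> map_op J G" by (simp add: J_simps)
  fix h assume "(f n, h) \<in> map_op J G"
  then obtain h' where "(f n, h') \<in> G" "h = J h'" by (auto simp: map_op_def)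
  moreover from this have "h' = sign n *\<^sub>R J (f n)" using f_graph memD(1) by blast
  ultimately show "h = sign n *\<^sub>R f n" by (simp add: J_simps)
qed

text \<open>For \<open>g\<close> in \<open>D(G)\<close>, \<open>[g, C f\<^sub>n] = (g, G f\<^sub>n) = (\<surd>G g, \<surd>G f\<^sub>n)\<close>; the outer terms extend to the
  energetic manifold by continuity along \<open>X\<close>.\<close>

lemma coefficient_eq:
  assumes X: "energy_represents G X g"
  shows "indef J g (op_app (map_op J G) (f n)) = cinner (root_app g) (root_f n)"
proof -
  have "cinner (X k) (sign n *\<^sub>R J (f n)) = cinner (root_app (X k)) (root_f n)" for k
  proof -
    have "X k \<in> Domain G" using X by (simp add: energy_represents_def energy_Cauchy_def)
    then obtain h where h: "(X k, h) \<in> G" by blast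
    show ?thesis
      using cinner_root[OF h f_graph] self_adjoint_symmetric[OF self_adjoint h f_graph] by simp
  qed
  moreover have "(\<lambda>k. cinner (X k) (sign n *\<^sub>R J (f n))) \<longlonglongrightarrow> cinner g (sign n *\<^sub>R J (f n))"
    using X by (intro tendsto_cinner tendsto_const) (simp add: energy_represents_def)
  moreover have "(\<lambda>k. cinner (root_app (X k)) (root_f n)) \<longlonglongrightarrow> cinner (root_app g) (root_f n)"
    by (intro tendsto_cinner tendsto_const energy_represents_root(2)[OF X])
  ultimately have "cinner g (sign n *\<^sub>R J (f n)) = cinner (root_app g) (root_f n)"
    by (simp add: LIMSEQ_unique)
  moreover have "indef J g (op_app (map_op J G) (f n)) = cinner g (sign n *\<^sub>R J (f n))"
    unfolding C_f by (simp add: indef_def J_symmetric J_simps)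
  ultimately show ?thesis by simp
qed

lemma expansion:
  assumes X: "energy_represents G X g"
  shows "(\<lambda>n. indef J g (op_app (map_op J G) (f n)) *\<^sub>C op_app root (f n)) sums op_app root g"
    and "energy_sums G (\<lambda>n. indef J g (op_app (map_op J G) (f n)) *\<^sub>C f n) g"
proof -
  let ?c = "\<lambda>n. indef J g (op_app (map_op J G) (f n))"
  have sums: "(\<lambda>n. ?c n *\<^sub>C root_f n) sums root_app g"
    unfolding coefficient_eq[OF X] by (rule fourier_sums[OF root_energetic_manifold[OF X]])
  then show "(\<lambda>n. ?c n *\<^sub>C op_app root (f n)) sums op_app root g"
    by (simp add: op_app_eq[OF linear_operator_root f_root]
        op_app_eq[OF linear_operator_root energy_represents_root(1)[OF X]])
  have term_mem: "(?c n *\<^sub>C f n, ?c n *\<^sub>C sign n *\<^sub>R J (f n)) \<in> G" for n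
    by (rule memD(5)[OF f_graph])
  have part: "(\<Sum>n<N. ?c n *\<^sub>C f n) \<in> Domain G
      \<and> root_app (\<Sum>n<N. ?c n *\<^sub>C f n) = (\<Sum>n<N. ?c n *\<^sub>C root_f n)" for N
  proof (induction N)
    case 0
    show ?case
      using memD(2) fcalc_zero[OF root_measurable] by auto
  next
    case (Suc N)
    then obtain h where h: "(\<Sum>n<N. ?c n *\<^sub>C f n, h) \<in> G" by blast
    have "(?c N *\<^sub>C f N, ?c N *\<^sub>C root_f N) \<in> root"
      by (rule linear_operatorD(5)[OF linear_operator_root f_root])
    from linear_operatorD(3)[OF linear_operator_root norm_root(1)[OF h] this]
    have "root_app ((\<Sum>n<N. ?c n *\<^sub>C f n) + ?c N *\<^sub>C f N) = root_app (\<Sum>n<N. ?c n *\<^sub>C f n) + ?c N *\<^sub>C root_f N"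
      by (simp add: fop_iff)
    then show ?case using Suc memD(3)[OF h term_mem[of N]] by auto
  qed
  have "energy_dist G X (\<lambda>_. \<Sum>n<N. ?c n *\<^sub>C f n) = norm (root_app g - (\<Sum>n<N. ?c n *\<^sub>C root_f n))" for N
    using energy_dist_eq[OF X] part[of N] by simp
  moreover have "(\<lambda>N. norm (root_app g - (\<Sum>n<N. ?c n *\<^sub>C root_f n))) \<longlonglongrightarrow> norm (root_app g - root_app g)"
    using sums unfolding sums_def by (intro tendsto_intros)
  ultimately have "(\<lambda>N. energy_dist G X (\<lambda>_. \<Sum>n<N. ?c n *\<^sub>C f n)) \<longlonglongrightarrow> 0" by simp
  then show "energy_sums G (\<lambda>n. ?c n *\<^sub>C f n) g"
    unfolding energy_sums_def using term_mem X by blast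
qed

lemma C_op_subset: "C_op (L_plus J f) (L_minus J f) \<subseteq> map_op J G"
proof safe
  fix a b assume "(a, b) \<in> C_op (L_plus J f) (L_minus J f)"
  then have "(a, J b) \<in> G" using extends unfolding map_op_def by blast
  then have "(a, J (J b)) \<in> map_op J G" unfolding map_op_def by blast
  then show "(a, b) \<in> map_op J G" by simp
qed

end

theorem corollary6p4:
  fixes J :: "'a::complex_hilbert \<Rightarrow> 'a" and f :: "nat \<Rightarrow> 'a"
  assumes "fundamental_symmetry J"
    and "quasi_basis J f"
  shows "\<exists>C Q G S. C_symmetry J C
      \<and> self_adjoint Q \<and> anticommutes J Q
      \<and> is_function_of Q (\<lambda>x. exp x) G \<and> C = map_op J G
      \<and> C_op (L_plus J f) (L_minus J f) \<subseteq> C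
      \<and> is_function_of Q (\<lambda>x. exp (x / 2)) S
      \<and> (\<forall>g \<in> energetic_manifold G.
            energy_sums G (\<lambda>n. indef J g (op_app C (f n)) *\<^sub>C f n) g
          \<and> g \<in> Domain S
          \<and> (\<lambda>n. indef J g (op_app C (f n)) *\<^sub>C op_app S (f n)) sums op_app S g)"
proof -
  obtain G where G: "self_adjoint G" "positive_operator G"
    "map_op J (C_op (L_plus J f) (L_minus J f)) \<subseteq> G"
    "\<forall>(f, h) \<in> G. (J f, J h) \<in> converse G"
    "energy_dense G (Domain (C_op (L_plus J f) (L_minus J f)))"
    using assms(2) unfolding quasi_basis_def quasi_maximal_def by blast
  interpret quasi_basis_operator G J f
  proof
    show "J_orthonormal J f" using assms(2) by (simp add: quasi_basis_def)
    show "(J h, J f) \<in> G" if "(f, h) \<in> G" for f h using G(4) that by blast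
  qed (use assms(1) G in auto)
  show ?thesis
  proof (intro exI conjI ballI)
    show "C_symmetry J (map_op J G)" by (rule C_symmetry_map_op)
    show "self_adjoint (fop logit)" by (rule self_adjoint_fop[OF logit_measurable])
    show "anticommutes J (fop logit)" by (rule anticommutes_log)
    have "is_function_of (fop logit) exp (fop (\<lambda>t. exp (logit t)))"
      by (rule is_function_of_fop) measurable
    then show "is_function_of (fop logit) exp G" unfolding eq_exp[symmetric] .
    show "C_op (L_plus J f) (L_minus J f) \<subseteq> map_op J G" by (rule C_op_subset)
    show "is_function_of (fop logit) (\<lambda>x. exp (x / 2)) root"
      by (rule is_function_of_fop) measurable
    fix g assume "g \<in> energetic_manifold G"
    then obtain X where X: "energy_represents G X g" by (auto simp: energetic_manifold_def)
    show "energy_sums G (\<lambda>n. indef J g (op_app (map_op J G) (f n)) *\<^sub>C f n) g"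
      by (rule expansion(2)[OF X])
    show "g \<in> Domain root" using energy_represents_root(1)[OF X] by blast
    show "(\<lambda>n. indef J g (op_app (map_op J G) (f n)) *\<^sub>C op_app root (f n)) sums op_app root g"
      by (rule expansion(1)[OF X])
  qed simp
qed

end
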